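(* For every fixed $0<\varepsilon<1/6$, there exist $\eta_\varepsilon>0$ and a sequence of finite posets $P$ with maximum antichains $A\subseteq P$ (that is, antichains with $|A|=w(P)$), where $n=|P|\to\infty$ along the sequence, such that $$|A|=\omega(n^{2/3-\varepsilon}),\qquad \delta_3(A;P)\le\tfrac16-\eta_\varepsilon .$$ Furthermore, the posets in the sequence satisfy $S_P=\omega(n^{2/3-\varepsilon})$, and for every fixed integer $k\ge 2$, $\delta_k(P)=1/k!$ for all sufficiently large $n$.
   Context: Let $P$ be a finite poset; $w(P)$ is its width (maximum size of an antichain). Let $F$ be a uniformly random point of the order polytope $\mathcal{O}(P)=\{z\in[0,1]^P: z_x\le z_y\text{ if }x<_P y\}$. For $x\in P$ put $Q_x=\max_{y<_P x}F(y)$ and $R_x=\min_{y>_P x}F(y)$, with $Q_x=0$ if $x$ is minimal and $R_x=1$ if $x$ is maximal, and put $c_x=\mathbb{E}(F(x)-Q_x)=\mathbb{E}(R_x-F(x))$ (these two expectations are equal). Write $S_P=\sum_{x\in P}c_x$. For $X\subseteq P$ with $|X|\ge k$, $\delta_k(X;P)=\max\min_{\pi\in S_k}\mathbb{P}(x_{\pi(1)}\prec\cdots\prec x_{\pi(k)})$, where the maximum is over all $k$-tuples of pairwise distinct $x_1,\dots,x_k\in X$, the minimum over permutations $\pi$ of $\{1,\dots,k\}$, and $\prec$ is a uniformly random linear extension of $P$. Write $\delta_k(P)=\delta_k(P;P)$. $a=\omega(b)$ means $a/b\to\infty$ along the sequence. *)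

theory Defs
  imports "HOL-Probability.Probability" "HOL-Combinatorics.Combinatorics"
begin

text \<open>A poset is a carrier \<open>V\<close> together with its reflexive order relation \<open>r\<close>.\<close>

definition finite_poset :: "'a set \<Rightarrow> 'a rel \<Rightarrow> bool" where
  "finite_poset V r \<longleftrightarrow> finite V \<and> partial_order_on V r"

definition antichain :: "'a set \<Rightarrow> 'a rel \<Rightarrow> 'a set \<Rightarrow> bool" where
  "antichain V r A \<longleftrightarrow> A \<subseteq> V \<and> (\<forall>x\<in>A. \<forall>y\<in>A. x \<noteq> y \<longrightarrow> (x, y) \<notin> r)"

definition width :: "'a set \<Rightarrow> 'a rel \<Rightarrow> nat" where
  "width V r = Max (card ` {A. antichain V r A})"

definition order_polytope :: "'a set \<Rightarrow> 'a rel \<Rightarrow> ('a \<Rightarrow> real) set" where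
  "order_polytope V r =
     {z \<in> V \<rightarrow>\<^sub>E {0..1}. \<forall>x\<in>V. \<forall>y\<in>V. (x, y) \<in> r \<and> x \<noteq> y \<longrightarrow> z x \<le> z y}"

definition random_point :: "'a set \<Rightarrow> 'a rel \<Rightarrow> ('a \<Rightarrow> real) measure" where
  "random_point V r = uniform_measure (Pi\<^sub>M V (\<lambda>_. lborel)) (order_polytope V r)"

definition max_below :: "'a set \<Rightarrow> 'a rel \<Rightarrow> ('a \<Rightarrow> real) \<Rightarrow> 'a \<Rightarrow> real" where
  "max_below V r F x =
     (let B = {y \<in> V. (y, x) \<in> r \<and> y \<noteq> x} in if B = {} then 0 else Max (F ` B))"

definition mean_gap :: "'a set \<Rightarrow> 'a rel \<Rightarrow> 'a \<Rightarrow> real" where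
  "mean_gap V r x = (LINT F|random_point V r. F x - max_below V r F x)"

definition gap_sum :: "'a set \<Rightarrow> 'a rel \<Rightarrow> real" where
  "gap_sum V r = (\<Sum>x\<in>V. mean_gap V r x)"

definition linear_extensions :: "'a set \<Rightarrow> 'a rel \<Rightarrow> 'a rel set" where
  "linear_extensions V r = {l. linear_order_on V l \<and> r \<subseteq> l}"

definition order_prob :: "'a set \<Rightarrow> 'a rel \<Rightarrow> 'a list \<Rightarrow> real" where
  "order_prob V r xs =
     measure_pmf.prob (pmf_of_set (linear_extensions V r))
       {l. sorted_wrt (\<lambda>x y. (x, y) \<in> l \<and> x \<noteq> y) xs}"

text \<open>The maximum below is over an empty set when \<open>card X < k\<close>, so \<open>delta\<close> is
  meaningful only for \<open>card X \<ge> k\<close>.\<close>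

definition delta :: "nat \<Rightarrow> 'a set \<Rightarrow> 'a set \<Rightarrow> 'a rel \<Rightarrow> real" where
  "delta k X V r =
     Max ((\<lambda>xs. Min ((\<lambda>\<pi>. order_prob V r (permute_list \<pi> xs)) ` {\<pi>. \<pi> permutes {..<k}}))
          ` {xs. length xs = k \<and> distinct xs \<and> set xs \<subseteq> X})"

end

(*
  A linear extension is the order of a uniform random point F of the order polytope.  Under an ordinal
  sum V < e < D the point splits into independent pieces: s = F(e) is Beta distributed, F on V is s times
  a random point of V, and F on D is s + (1 - s) times a random point of D.  Reversing the order maps F
  to 1 - F, and disjoint unions give independent points.

  Start with a one-point poset and repeatedly take two disjoint copies of "reverse the order and put a
  long chain on top".  After k steps there are 2^k sites, all with the same law, and a site moves as
  beta * (1 - xi) with xi the position one level below and beta independent of xi.  Let x, y be two sites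
  in one copy and z a site in the other copy.  Then x and y share beta, so, all three laws being equal,
  P(x < z, y < z) is at least 1/3 + Var(E(1[x < z] | beta)).  The chains are chosen so that the variance
  of xi is at most a constant times that of beta; hence beta deviates with probability bounded below so
  far that P(x < z | beta) is at most 1/4, and the gain over 1/3 is bounded below at every level.
  The size n of a tower grows by a factor only slightly above 4 per level, so that a tower has about
  n^(1/2) sites, whose positions fluctuate by n^(-1/2).

  Now take about n^(1/2) towers, with reversed order, and put chains of different lengths on top, such
  that the means in different towers are separated by many standard deviations; then a pair of sites in
  different towers is strongly unbalanced.  The sites form a maximum antichain A with about n elements
  in a poset of size about n^(3/2).  Finally put on top a stack of antichains of size |A| separated by
  single points.  By the splitting rule the gap sum of an ordinal sum is at least a convex combination
  of the two gap sums, which bounds it below by |A|/4; and each antichain of the stack consists of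
  elements that automorphisms permute arbitrarily, whence delta_k = 1/k!.
*)
theory Submission
  imports Defs
begin

text \<open>The obstacle is to keep two sites of one copy correlated at every scale. Without the
  reversal a site would be a product of factors whose mean at least halves at each level, and the
  newest factor, fluctuating by n^(-1/2), would soon be negligible against the relative spread left
  by the older ones. With the reversal the mean stays at most 1/2, so \<open>1 - xi\<close> has mean
  at least 1/2 and each new factor is felt. If a factor had mean exactly 1/2, the bound for variance
  times size would increase by a constant at each level, and no gain independent of the level could
  be drawn from it. A slack of 1/p in the chain lengths turns the recursion into a contraction. Its
  price is growth by up to 4 (1 + 1/p) per level, and p is taken so large that this disappears in
  the epsilon of the exponent. Sites of one copy are in general dependent even given their newest
  shared factor. What is carried along instead is that P(x in H, y in H) is at least the product of
  the marginals for every half-line H, of either direction, since the reversal exchanges the two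
  directions.\<close>

abbreviation lebP :: "'a set \<Rightarrow> ('a \<Rightarrow> real) measure" where
  "lebP V \<equiv> Pi\<^sub>M V (\<lambda>_. lborel)"

section \<open>Lebesgue measure on coordinate spaces and the volume of order polytopes\<close>

interpretation lebP: product_sigma_finite "\<lambda>_::'a. lborel :: real measure"
  by standard

lemma sigma_finite_lebP: "finite V \<Longrightarrow> sigma_finite_measure (lebP V)"
  by (rule lebP.sigma_finite)

text \<open>The one-dimensional substitution is applied to one coordinate at a time. Three instances
  matter later: \<open>s * F\<close> and \<open>s + (1 - s) * G\<close> fit the two parts of an
  ordinal sum into place, and \<open>1 + (-1) * F\<close> reverses the order.\<close>

lemma nn_integral_lebP_affine:
  fixes c t :: real
  assumes "finite V" "c \<noteq> 0" and f: "f \<in> borel_measurable (lebP V)"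
  shows "(\<integral>\<^sup>+F. f F \<partial>lebP V) =
    ennreal (\<bar>c\<bar> ^ card V) * (\<integral>\<^sup>+F. f (\<lambda>i\<in>V. t + c * F i) \<partial>lebP V)"
  using assms(1) f
proof (induction V arbitrary: f rule: finite_induct)
  case empty
  have "(\<lambda>i\<in>{}. t + c * F i) = (\<lambda>k. undefined)" for F :: "'a \<Rightarrow> real"
    by (simp add: restrict_def)
  then show ?case by (simp add: lebP.nn_integral_empty del: nn_integral_const)
next
  case (insert i V)
  note [measurable] = insert.prems
  note fin = insert.hyps
  let ?T = "\<lambda>F. \<lambda>j\<in>V. t + c * F j"
  let ?T' = "\<lambda>F. \<lambda>j\<in>insert i V. t + c * F j"
  interpret sfV: sigma_finite_measure "lebP V" using fin sigma_finite_lebP by blast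
  have upd: "(\<lambda>(y, F). F(i := y)) \<in> lborel \<Otimes>\<^sub>M lebP V \<rightarrow>\<^sub>M lebP (insert i V)"
  proof -
    have "(\<lambda>z. (snd z)(i := fst z)) \<in> lborel \<Otimes>\<^sub>M lebP V \<rightarrow>\<^sub>M lebP (insert i V)"
      by measurable
    then show ?thesis by (simp add: case_prod_beta')
  qed
  have T: "?T \<in> lebP V \<rightarrow>\<^sub>M lebP V" by measurable
  have T': "?T' \<in> lebP (insert i V) \<rightarrow>\<^sub>M lebP (insert i V)" by measurable
  have eqT: "(?T F)(i := t + c * y) = ?T' (F(i := y))" for F y
    using fin by (auto simp: fun_eq_iff restrict_def)
  have m1: "(\<lambda>(y, F). f ((?T F)(i := y))) \<in> borel_measurable (lborel \<Otimes>\<^sub>M lebP V)"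
  proof -
    have "(\<lambda>z. f ((?T (snd z))(i := fst z))) \<in> borel_measurable (lborel \<Otimes>\<^sub>M lebP V)"
      using T by measurable
    then show ?thesis by (simp add: case_prod_beta')
  qed
  have m2: "(\<lambda>y. \<integral>\<^sup>+F. f ((?T F)(i := y)) \<partial>lebP V) \<in> borel_measurable borel"
    using sfV.borel_measurable_nn_integral_fst[OF m1] by simp
  have m3: "(\<lambda>F. f (?T' F)) \<in> borel_measurable (lebP (insert i V))"
    using T' by measurable
  have "(\<integral>\<^sup>+F. f F \<partial>lebP (insert i V)) = (\<integral>\<^sup>+y. (\<integral>\<^sup>+F. f (F(i := y)) \<partial>lebP V) \<partial>lborel)"
    using fin by (intro lebP.product_nn_integral_insert_rev) auto
  also have "\<dots> = (\<integral>\<^sup>+y. ennreal (\<bar>c\<bar> ^ card V) * (\<integral>\<^sup>+F. f ((?T F)(i := y)) \<partial>lebP V) \<partial>lborel)"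
    by (intro nn_integral_cong insert.IH) measurable
  also have "\<dots> = ennreal (\<bar>c\<bar> ^ card V) * (\<integral>\<^sup>+y. (\<integral>\<^sup>+F. f ((?T F)(i := y)) \<partial>lebP V) \<partial>lborel)"
    using m2 by (intro nn_integral_cmult) simp
  also have "(\<integral>\<^sup>+y. (\<integral>\<^sup>+F. f ((?T F)(i := y)) \<partial>lebP V) \<partial>lborel) =
      \<bar>c\<bar> * (\<integral>\<^sup>+y. (\<integral>\<^sup>+F. f ((?T F)(i := t + c * y)) \<partial>lebP V) \<partial>lborel)"
    by (rule nn_integral_real_affine[OF m2 \<open>c \<noteq> 0\<close>])
  also have "(\<integral>\<^sup>+y. (\<integral>\<^sup>+F. f ((?T F)(i := t + c * y)) \<partial>lebP V) \<partial>lborel) =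
      (\<integral>\<^sup>+y. (\<integral>\<^sup>+F. f (?T' (F(i := y))) \<partial>lebP V) \<partial>lborel)"
    by (simp only: eqT)
  also have "\<dots> = (\<integral>\<^sup>+F. f (?T' F) \<partial>lebP (insert i V))"
    using fin by (intro lebP.product_nn_integral_insert_rev[symmetric] m3) auto
  finally show ?case
    by (simp only: card_insert_disjoint[OF fin] power_Suc ennreal_mult abs_ge_zero zero_le_power mult_ac)
qed

lemma order_polytope_eq:
  "order_polytope V r = (V \<rightarrow>\<^sub>E {0..1}) \<inter>
     {z \<in> space (lebP V). \<forall>x\<in>V. \<forall>y\<in>V. (x, y) \<in> r \<and> x \<noteq> y \<longrightarrow> z x \<le> z y}"
  by (auto simp: order_polytope_def space_PiM)

lemma sets_order_polytope [measurable]: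
  assumes "finite V"
  shows "order_polytope V r \<in> sets (lebP V)"
proof -
  have 1: "{z \<in> space (lebP V). \<forall>x\<in>V. \<forall>y\<in>V. (x, y) \<in> r \<and> x \<noteq> y \<longrightarrow> z x \<le> z y} \<in> sets (lebP V)"
    using assms
    by (intro sets.sets_Collect_finite_All sets.sets_Collect_imp sets.sets_Collect_const) auto
  have 2: "(V \<rightarrow>\<^sub>E {0..1::real}) \<in> sets (lebP V)"
    using assms by (intro sets_PiM_I_finite) auto
  show ?thesis unfolding order_polytope_eq using 1 2 by auto
qed

lemma emeasure_order_polytope_le:
  assumes "finite V"
  shows "emeasure (lebP V) (order_polytope V r) \<le> 1"
proof -
  have "emeasure (lebP V) (order_polytope V r) \<le> emeasure (lebP V) (V \<rightarrow>\<^sub>E {0..1})"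
    using assms by (intro emeasure_mono sets_PiM_I_finite) (auto simp: order_polytope_def)
  also have "\<dots> = 1"
    using assms by (subst lebP.emeasure_PiM) auto
  finally show ?thesis .
qed

text \<open>The size of the principal down-set serves as a strictly monotone height: it places a box
  inside the order polytope and finds the maximum of a finite linear order.\<close>

lemma card_below_less:
  assumes "finite_poset V r" "(x, y) \<in> r" "x \<noteq> y"
  shows "card {z. (z, x) \<in> r} < card {z. (z, y) \<in> r}"
proof -
  have fin: "finite V" and po: "partial_order_on V r" using assms by (auto simp: finite_poset_def)
  have sub: "r \<subseteq> V \<times> V" using partial_order_onD(4)[OF po] .
  have "{z. (z, x) \<in> r} \<subset> {z. (z, y) \<in> r}"
  proof
    show "{z. (z, x) \<in> r} \<subseteq> {z. (z, y) \<in> r}"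
      using assms partial_order_onD(2)[OF po] by (auto dest: transD)
    have "y \<in> V" using assms sub by auto
    then have "(y, y) \<in> r" using partial_order_onD(1)[OF po] by (auto simp: refl_on_def)
    moreover have "(y, x) \<notin> r" using assms partial_order_onD(3)[OF po] by (auto dest: antisymD)
    ultimately show "{z. (z, x) \<in> r} \<noteq> {z. (z, y) \<in> r}" by auto
  qed
  moreover have "finite {z. (z, y) \<in> r}"
    using sub by (intro finite_subset[OF _ fin]) auto
  ultimately show ?thesis by (rule psubset_card_mono[rotated])
qed

text \<open>With \<open>f x\<close> the size of the down-set of \<open>x\<close>, the intervals from
  f x/(n + 1) to (f x + 1)/(n + 1) are ordered like the elements, so a cube of side 1/(n + 1) fits
  into the polytope. Positive volume is what makes \<open>random_point\<close> a probability
  measure.\<close>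

lemma emeasure_order_polytope_pos:
  assumes "finite_poset V r"
  shows "emeasure (lebP V) (order_polytope V r) > 0"
proof -
  have fin: "finite V" and po: "partial_order_on V r" using assms by (auto simp: finite_poset_def)
  define f where "f x = card {y. (y, x) \<in> r}" for x
  define n where "n = card V"
  have sub: "r \<subseteq> V \<times> V" using partial_order_onD(4)[OF po] .
  have f_le: "f x \<le> n" for x unfolding f_def n_def using sub fin by (intro card_mono) auto
  have f_less: "f x < f y" if "(x, y) \<in> r" "x \<noteq> y" for x y
    unfolding f_def using card_below_less[OF assms that] .
  define B where "B x = {real (f x) / (real n + 1) .. (real (f x) + 1) / (real n + 1)}" for x
  have "Pi\<^sub>E V B \<subseteq> order_polytope V r"
  proof
    fix z assume z: "z \<in> Pi\<^sub>E V B"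
    have "z x \<in> {0..1}" if "x \<in> V" for x
    proof -
      have zx: "z x \<in> B x" using z that by auto
      have "0 \<le> real (f x) / (real n + 1)" by simp
      moreover have "(real (f x) + 1) / (real n + 1) \<le> 1" using f_le[of x] by simp
      ultimately show ?thesis using zx unfolding B_def atLeastAtMost_iff by linarith
    qed
    moreover have "z x \<le> z y" if "x \<in> V" "y \<in> V" "(x, y) \<in> r" "x \<noteq> y" for x y
    proof -
      have "z x \<le> (real (f x) + 1) / (real n + 1)" using z that by (auto simp: B_def PiE_iff)
      also have "\<dots> \<le> real (f y) / (real n + 1)"
        using f_less[OF that(3,4)] by (intro divide_right_mono) auto
      also have "\<dots> \<le> z y" using z that by (auto simp: B_def PiE_iff)
      finally show ?thesis .
    qed
    ultimately show "z \<in> order_polytope V r"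
      using z by (auto simp: order_polytope_def PiE_iff)
  qed
  then have "emeasure (lebP V) (Pi\<^sub>E V B) \<le> emeasure (lebP V) (order_polytope V r)"
    using fin by (intro emeasure_mono) auto
  moreover have "emeasure (lebP V) (Pi\<^sub>E V B) = (\<Prod>x\<in>V. emeasure lborel (B x))"
    using fin by (intro lebP.emeasure_PiM) (auto simp: B_def)
  moreover have "(\<Prod>x\<in>V. emeasure lborel (B x)) = (\<Prod>x\<in>V. ennreal (1 / (real n + 1)))"
    by (intro prod.cong) (auto simp: B_def divide_right_mono field_simps)
  moreover have "\<dots> > 0"
    by (subst prod_ennreal) (auto intro!: prod_pos)
  ultimately show ?thesis by (auto intro: less_le_trans)
qed

section \<open>Random points: normalisation, null sets and ties\<close>

lemma sets_random_point [simp, measurable_cong]: "sets (random_point V r) = sets (lebP V)"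
  by (simp add: random_point_def)

lemma space_random_point [simp]: "space (random_point V r) = space (lebP V)"
  by (simp add: random_point_def)

lemma finite_poset_finite: "finite_poset V r \<Longrightarrow> finite V"
  by (simp add: finite_poset_def)

lemma order_polytope_nontriv:
  assumes "finite_poset V r"
  shows "emeasure (lebP V) (order_polytope V r) \<noteq> 0" "emeasure (lebP V) (order_polytope V r) \<noteq> \<infinity>"
  using emeasure_order_polytope_pos[OF assms]
    emeasure_order_polytope_le[OF finite_poset_finite[OF assms], of r]
  by (auto simp: top_unique)

lemma prob_space_random_point:
  assumes "finite_poset V r"
  shows "prob_space (random_point V r)"
  unfolding random_point_def using order_polytope_nontriv[OF assms]
  by (intro prob_space_uniform_measure) auto

lemma AE_random_point_in:
  assumes "finite_poset V r"
  shows "AE F in random_point V r. F \<in> order_polytope V r"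
  unfolding random_point_def
  using assms by (intro AE_uniform_measureI) (auto dest: finite_poset_finite)

lemma AE_random_point_lebP:
  assumes "finite_poset V r" "AE F in lebP V. Q F"
  shows "AE F in random_point V r. Q F"
  unfolding random_point_def
  using assms by (intro AE_uniform_measureI) (auto dest: finite_poset_finite)

text \<open>If \<open>M\<close> restricted to \<open>S\<close> is \<open>k\<close> times a
  probability measure, the whole space gives the mass of \<open>S\<close>, and division by it gives
  the uniform law. One computation thus yields the law and the volume of a composed polytope
  together.\<close>

lemma uniform_measure_eqI:
  assumes "prob_space N" and sets: "sets N = sets M" and S: "S \<in> sets M" and k: "k \<noteq> 0" "k \<noteq> \<infinity>"
    and eq: "\<And>B. B \<in> sets M \<Longrightarrow> emeasure M (S \<inter> B) = k * emeasure N B"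
  shows "uniform_measure M S = N" "emeasure M S = k"
proof -
  interpret prob_space N by fact
  have sp: "space N = space M" using sets by (rule sets_eq_imp_space_eq)
  have "S \<inter> space M = S" using S sets.sets_into_space by blast
  then show kS: "emeasure M S = k"
    using eq[of "space M"] emeasure_space_1 sp by simp
  show "uniform_measure M S = N"
  proof (rule measure_eqI)
    fix B assume "B \<in> sets (uniform_measure M S)"
    then have B: "B \<in> sets M" by simp
    have "emeasure (uniform_measure M S) B = k * emeasure N B / k"
      using S B eq[OF B] kS by simp
    also have "\<dots> = emeasure N B"
      using k by (subst mult.commute) (simp add: mult_divide_eq_ennreal)
    finally show "emeasure (uniform_measure M S) B = emeasure N B" .
  qed (simp add: sets)
qed

text \<open>Fubini in the coordinate \<open>x\<close>: as \<open>h\<close> ignores that coordinate,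
  every section of the exceptional set is a single point. Ties between two coordinates and hits of a
  constant are the cases used.\<close>

lemma AE_lebP_neq_fun:
  assumes V: "finite V" "x \<in> V" and h: "h \<in> borel_measurable (lebP V)"
    and upd: "\<And>F s. h (F(x := s)) = h F"
  shows "AE F in lebP V. F x \<noteq> h F"
proof -
  define W where "W = V - {x}"
  have W: "V = insert x W" "x \<notin> W" "finite W" using V by (auto simp: W_def)
  let ?S = "{F \<in> space (lebP V). F x = h F}"
  note [measurable] = h
  have m: "?S \<in> sets (lebP V)" using V by measurable
  have "emeasure (lebP V) ?S = (\<integral>\<^sup>+F. indicator ?S F \<partial>lebP V)"
    using m by simp
  also have "\<dots> = (\<integral>\<^sup>+F. (\<integral>\<^sup>+s. indicator ?S (F(x := s)) \<partial>lborel) \<partial>lebP W)"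
    using m W by (simp only: W(1)) (rule lebP.product_nn_integral_insert, auto)
  also have "\<dots> = (\<integral>\<^sup>+F. (\<integral>\<^sup>+s. indicator {h F} s \<partial>lborel) \<partial>lebP W)"
    using W by (intro nn_integral_cong) (auto simp: space_PiM indicator_def PiE_iff extensional_def upd)
  also have "\<dots> = 0" by simp
  finally have "?S \<in> null_sets (lebP V)" using m by auto
  then show ?thesis by (rule AE_I') auto
qed

lemma AE_lebP_neq:
  assumes "finite V" "x \<in> V" "y \<in> V" "x \<noteq> y"
  shows "AE F in lebP V. F x \<noteq> F y"
  using assms by (intro AE_lebP_neq_fun[where h = "\<lambda>F. F y"]) auto

lemma AE_lebP_neq_const:
  assumes "finite V" "x \<in> V"
  shows "AE F in lebP V. F x \<noteq> c"
  using assms by (intro AE_lebP_neq_fun) auto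

lemma AE_lebP_inj:
  assumes "finite V"
  shows "AE F in lebP V. inj_on F V"
proof -
  have "AE F in lebP V. \<forall>x\<in>V. \<forall>y\<in>V. x \<noteq> y \<longrightarrow> F x \<noteq> F y"
    using assms AE_lebP_neq[OF assms] by (intro AE_finite_allI) auto
  then show ?thesis by (rule AE_mp) (auto simp: inj_on_def)
qed

section \<open>Beta distributions\<close>

text \<open>The Beta function at (a + 1, b + 1). The indices are numbers of points rather than the
  usual parameters: \<open>a\<close> points lie below and \<open>b\<close> points above the one
  whose value is described, whence the shifts by 1 and 2 in the moments.\<close>

definition beta_norm :: "nat \<Rightarrow> nat \<Rightarrow> real" where
  "beta_norm a b = fact a * fact b / fact (a + b + 1)"

definition beta_dens :: "nat \<Rightarrow> nat \<Rightarrow> real \<Rightarrow> real" where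
  "beta_dens a b s = indicator {0..1} s * (s ^ a * (1 - s) ^ b)"

definition beta_distr :: "nat \<Rightarrow> nat \<Rightarrow> real measure" where
  "beta_distr a b = density lborel (\<lambda>s. ennreal (beta_dens a b s / beta_norm a b))"

lemma beta_norm_pos: "beta_norm a b > 0"
  by (simp add: beta_norm_def)

lemma beta_dens_nonneg: "beta_dens a b s \<ge> 0"
  by (auto simp: beta_dens_def indicator_def)

lemma beta_dens_measurable [measurable]: "beta_dens a b \<in> borel_measurable borel"
  unfolding beta_dens_def by measurable

lemma has_bochner_integral_beta_dens:
  "has_bochner_integral lborel (beta_dens a b) (beta_norm a b)"
proof -
  have "((\<lambda>t. t powr (real (a + 1) - 1) * (1 - t) powr (real (b + 1) - 1)) has_integral
      Beta (real (a + 1)) (real (b + 1))) {0..1}"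
    by (rule has_integral_Beta_real) auto
  moreover have "Beta (real (a + 1)) (real (b + 1)) = beta_norm a b"
    using Gamma_fact[of a, where 'a = real] Gamma_fact[of b, where 'a = real]
      Gamma_fact[of "a + b + 1", where 'a = real]
    by (simp add: Beta_def beta_norm_def add_ac)
  ultimately have "((\<lambda>t. t powr (real (a + 1) - 1) * (1 - t) powr (real (b + 1) - 1)) has_integral
      beta_norm a b) {0..1}" by simp
  \<comment> \<open>Real and natural powers may disagree at the endpoints, where
    \<open>0 powr 0\<close> is 0 but \<open>0 ^ 0\<close> is 1; two points do not change the
    integral.\<close>
  then have "((\<lambda>t. t ^ a * (1 - t) ^ b) has_integral beta_norm a b) {0..1}"
    by (rule has_integral_spike_finite[of "{0, 1}", rotated 2]) (auto simp: powr_realpow)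
  then have "((\<lambda>t. if t \<in> {0..1} then t ^ a * (1 - t) ^ b else 0) has_integral beta_norm a b) UNIV"
    by (simp only: has_integral_restrict_UNIV)
  moreover have "(\<lambda>t. if t \<in> {0..1} then t ^ a * (1 - t) ^ b else 0) = beta_dens a b"
    by (auto simp: beta_dens_def fun_eq_iff)
  ultimately have "(beta_dens a b has_integral beta_norm a b) UNIV" by simp
  then have "integral\<^sup>N lborel (beta_dens a b) = ennreal (beta_norm a b)"
    by (intro nn_integral_has_integral_lborel beta_dens_nonneg) auto
  then show ?thesis
    using beta_norm_pos[of a b]
    by (intro has_bochner_integral_nn_integral) (auto intro: beta_dens_nonneg less_imp_le)
qed

lemma sets_beta_distr [simp, measurable_cong]: "sets (beta_distr a b) = sets borel"
  and space_beta_distr [simp]: "space (beta_distr a b) = UNIV"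
  by (simp_all add: beta_distr_def)

lemma prob_space_beta_distr: "prob_space (beta_distr a b)"
proof
  have "emeasure (beta_distr a b) (space (beta_distr a b)) =
      (\<integral>\<^sup>+s. ennreal (beta_dens a b s / beta_norm a b) \<partial>lborel)"
    by (simp add: beta_distr_def emeasure_density)
  also have "\<dots> = ennreal (\<integral>s. beta_dens a b s / beta_norm a b \<partial>lborel)"
    using has_bochner_integral_beta_dens[of a b] beta_norm_pos[of a b]
    by (intro nn_integral_eq_integral)
      (auto simp: has_bochner_integral_iff beta_dens_nonneg less_imp_le)
  also have "\<dots> = 1"
    using has_bochner_integral_beta_dens[of a b] beta_norm_pos[of a b]
    by (simp add: has_bochner_integral_iff)
  finally show "emeasure (beta_distr a b) (space (beta_distr a b)) = 1" .
qed

lemma AE_beta_distr: "AE s in beta_distr a b. 0 < s \<and> s < 1"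
proof -
  have "AE s in lborel. s \<noteq> (0::real) \<and> s \<noteq> 1"
    using AE_lborel_singleton[of "0::real"] AE_lborel_singleton[of "1::real"] by eventually_elim auto
  then show ?thesis
    unfolding beta_distr_def
    by (subst AE_density) (simp, erule eventually_mono, auto simp: beta_dens_def indicator_def less_le split: if_splits)
qed

lemma AE_beta_distr_neq: "AE s in beta_distr a b. s \<noteq> c"
  unfolding beta_distr_def
  using AE_lborel_singleton[of c] by (subst AE_density) (auto elim!: eventually_mono)

lemma beta_distr_moment:
  "integral\<^sup>L (beta_distr a b) (\<lambda>s. s ^ i) = beta_norm (a + i) b / beta_norm a b"
proof -
  have "integral\<^sup>L (beta_distr a b) (\<lambda>s. s ^ i) =
      (\<integral>s. beta_dens a b s / beta_norm a b * s ^ i \<partial>lborel)"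
    using beta_norm_pos[of a b] unfolding beta_distr_def
    by (subst integral_density) (auto simp: beta_dens_nonneg less_imp_le)
  also have "\<dots> = (\<integral>s. beta_dens (a + i) b s / beta_norm a b \<partial>lborel)"
    by (intro Bochner_Integration.integral_cong) (auto simp: beta_dens_def power_add)
  finally show ?thesis
    using has_bochner_integral_beta_dens[of "a + i" b] by (simp add: has_bochner_integral_iff)
qed

lemma beta_norm_Suc:
  "beta_norm (Suc a) b = (real a + 1) / (real a + real b + 2) * beta_norm a b"
proof -
  have "fact (Suc a + b + 1) = (real a + real b + 2) * fact (a + b + 1)"
    by (simp add: algebra_simps)
  moreover have "fact (Suc a) = (real a + 1) * fact a"
    by (simp add: algebra_simps)
  ultimately show ?thesis unfolding beta_norm_def by (simp only: times_divide_times_eq mult.assoc)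
qed

lemma beta_distr_mean: "integral\<^sup>L (beta_distr a b) (\<lambda>s. s) = (real a + 1) / (real a + real b + 2)"
  using beta_distr_moment[of a b 1] beta_norm_pos[of a b] by (simp add: beta_norm_Suc)

lemma beta_distr_second_moment:
  "integral\<^sup>L (beta_distr a b) (\<lambda>s. s\<^sup>2) =
     (real a + 1) * (real a + 2) / ((real a + real b + 2) * (real a + real b + 3))"
  using beta_distr_moment[of a b 2] beta_norm_pos[of a b]
  by (simp add: beta_norm_Suc numeral_2_eq_2 mult_ac add_ac)

section \<open>Laws of random points of composed posets\<close>

text \<open>The separating point makes the two parts decouple: once the value of \<open>e\<close> is
  fixed, \<open>V\<close> is confined to the interval below it and \<open>D\<close> to the interval
  above it, with no further condition between them.\<close>

definition osum :: "'a set \<Rightarrow> 'a rel \<Rightarrow> 'a \<Rightarrow> 'a set \<Rightarrow> 'a rel \<Rightarrow> 'a rel" where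
  "osum V r e D d = r \<union> d \<union> V \<times> insert e D \<union> {e} \<times> insert e D"

text \<open>Coordinates in which the polytope of an ordinal sum becomes a product. Each coordinate
  in \<open>V\<close> is scaled by \<open>s\<close> and each one in \<open>D\<close> by
  \<open>1 - s\<close>, so the volume factor is s^|V| (1 - s)^|D|, the unnormalised Beta
  density.\<close>

definition osum_map :: "'a set \<Rightarrow> 'a \<Rightarrow> 'a set \<Rightarrow> real \<times> ('a \<Rightarrow> real) \<times> ('a \<Rightarrow> real) \<Rightarrow> 'a \<Rightarrow> real" where
  "osum_map V e D = (\<lambda>(s, F, G). \<lambda>i\<in>insert e (V \<union> D).
     if i \<in> V then s * F i else if i = e then s else s + (1 - s) * G i)"

lemma finite_poset_osum:
  assumes "finite_poset V r" "finite_poset D d" "V \<inter> D = {}" "e \<notin> V" "e \<notin> D"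
  shows "finite_poset (insert e (V \<union> D)) (osum V r e D d)"
proof -
  have V: "r \<subseteq> V \<times> V" "refl_on V r" "trans r" "antisym r" "finite V"
    and D: "d \<subseteq> D \<times> D" "refl_on D d" "trans d" "antisym d" "finite D"
    using assms by (auto simp: finite_poset_def partial_order_on_def preorder_on_def)
  have "refl_on (insert e (V \<union> D)) (osum V r e D d)"
    using V D by (auto simp: refl_on_def osum_def)
  moreover have "trans (osum V r e D d)"
    using V(1) D(1) assms(3-5) transD[OF V(3)] transD[OF D(3)]
    unfolding trans_def osum_def by blast
  moreover have "antisym (osum V r e D d)"
    using V(1) D(1) assms(3-5) antisymD[OF V(4)] antisymD[OF D(4)]
    unfolding antisym_def osum_def by blast
  moreover have "osum V r e D d \<subseteq> insert e (V \<union> D) \<times> insert e (V \<union> D)"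
    using V(1) D(1) by (auto simp: osum_def)
  ultimately show ?thesis
    using V D by (auto simp: finite_poset_def partial_order_on_def preorder_on_def)
qed

lemma finite_poset_Un:
  assumes "finite_poset V r" "finite_poset D d" "V \<inter> D = {}"
  shows "finite_poset (V \<union> D) (r \<union> d)"
proof -
  have V: "r \<subseteq> V \<times> V" "refl_on V r" "trans r" "antisym r" "finite V"
    and D: "d \<subseteq> D \<times> D" "refl_on D d" "trans d" "antisym d" "finite D"
    using assms by (auto simp: finite_poset_def partial_order_on_def preorder_on_def)
  have "refl_on (V \<union> D) (r \<union> d)"
    using V D by (auto simp: refl_on_def)
  moreover have "trans (r \<union> d)"
    using V(1) D(1) assms(3) transD[OF V(3)] transD[OF D(3)]
    unfolding trans_def by blast
  moreover have "antisym (r \<union> d)"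
    using V(1) D(1) assms(3) antisymD[OF V(4)] antisymD[OF D(4)]
    unfolding antisym_def by blast
  moreover have "r \<union> d \<subseteq> (V \<union> D) \<times> (V \<union> D)"
    using V(1) D(1) by auto
  ultimately show ?thesis
    using V D by (auto simp: finite_poset_def partial_order_on_def preorder_on_def)
qed

lemma finite_poset_converse: "finite_poset V r \<Longrightarrow> finite_poset V (r\<inverse>)"
  by (simp add: finite_poset_def)

lemma finite_poset_subset: "finite_poset V r \<Longrightarrow> r \<subseteq> V \<times> V"
  by (simp add: finite_poset_def partial_order_onD(4))

lemma osum_map_measurable [measurable]:
  assumes "sets N = sets borel" "sets M1 = sets (lebP V)" "sets M2 = sets (lebP D)"
  shows "osum_map V e D \<in> N \<Otimes>\<^sub>M (M1 \<Otimes>\<^sub>M M2) \<rightarrow>\<^sub>M lebP (insert e (V \<union> D))"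
proof -
  note [measurable_cong] = assms
  have "(\<lambda>z. \<lambda>i\<in>insert e (V \<union> D). if i \<in> V then fst z * fst (snd z) i else if i = e then fst z
      else fst z + (1 - fst z) * snd (snd z) i) \<in> N \<Otimes>\<^sub>M (M1 \<Otimes>\<^sub>M M2) \<rightarrow>\<^sub>M lebP (insert e (V \<union> D))"
  proof (rule measurable_restrict)
    fix i assume i: "i \<in> insert e (V \<union> D)"
    consider "i \<in> V" | "i \<notin> V" "i = e" | "i \<notin> V" "i \<noteq> e" "i \<in> D" using i by auto
    then show "(\<lambda>z. if i \<in> V then fst z * fst (snd z) i else if i = e then fst z
      else fst z + (1 - fst z) * snd (snd z) i) \<in> N \<Otimes>\<^sub>M (M1 \<Otimes>\<^sub>M M2) \<rightarrow>\<^sub>M lborel"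
      by cases simp_all
  qed
  then show ?thesis by (simp add: osum_map_def case_prod_beta')
qed

text \<open>For \<open>0 < s < 1\<close> the bounds 0 and \<open>s\<close> on \<open>V\<close>, and
  \<open>s\<close> and 1 on \<open>D\<close>, rescale to the unit interval; relations between the
  parts follow from these bounds.\<close>

lemma osum_map_in_order_polytope:
  assumes V: "finite_poset V r" and D: "finite_poset D d"
    and dj: "V \<inter> D = {}" "e \<notin> V" "e \<notin> D"
    and s: "0 < s" "s < 1" and F: "F \<in> extensional V" and G: "G \<in> extensional D"
  shows "osum_map V e D (s, F, G) \<in> order_polytope (insert e (V \<union> D)) (osum V r e D d) \<longleftrightarrow>
    F \<in> order_polytope V r \<and> G \<in> order_polytope D d"
proof -
  note sub = finite_poset_subset[OF V] finite_poset_subset[OF D]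
  let ?z = "osum_map V e D (s, F, G)"
  have zV: "?z i = s * F i" if "i \<in> V" for i using that by (simp add: osum_map_def)
  have ze: "?z e = s" using dj by (simp add: osum_map_def)
  have zD: "?z i = s + (1 - s) * G i" if "i \<in> D" for i using that dj by (auto simp: osum_map_def)
  have D1: "0 \<le> s + (1 - s) * g \<and> s + (1 - s) * g \<le> 1 \<and> s \<le> s + (1 - s) * g \<longleftrightarrow> 0 \<le> g \<and> g \<le> 1" for g
  proof
    assume *: "0 \<le> s + (1 - s) * g \<and> s + (1 - s) * g \<le> 1 \<and> s \<le> s + (1 - s) * g"
    then have "0 \<le> (1 - s) * g" "0 \<le> (1 - s) * (1 - g)" by (auto simp: algebra_simps)
    then show "0 \<le> g \<and> g \<le> 1" using s by (auto simp: zero_le_mult_iff)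
  next
    assume *: "0 \<le> g \<and> g \<le> 1"
    then have "0 \<le> (1 - s) * g" "0 \<le> (1 - s) * (1 - g)" using s by auto
    then show "0 \<le> s + (1 - s) * g \<and> s + (1 - s) * g \<le> 1 \<and> s \<le> s + (1 - s) * g"
      using s by (auto simp: algebra_simps)
  qed
  have V1: "0 \<le> s * g \<and> s * g \<le> s \<longleftrightarrow> 0 \<le> g \<and> g \<le> 1" for g
    using s by (simp add: zero_le_mult_iff)
  show ?thesis
  proof
    assume z: "?z \<in> order_polytope (insert e (V \<union> D)) (osum V r e D d)"
    then have z1: "\<And>i. i \<in> insert e (V \<union> D) \<Longrightarrow> 0 \<le> ?z i \<and> ?z i \<le> 1"
      and z2: "\<And>x y. (x, y) \<in> osum V r e D d \<Longrightarrow> x \<noteq> y \<Longrightarrow> x \<in> insert e (V \<union> D) \<Longrightarrow>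
        y \<in> insert e (V \<union> D) \<Longrightarrow> ?z x \<le> ?z y"
      by (auto simp: order_polytope_def PiE_iff)
    have "0 \<le> F i \<and> F i \<le> 1" if "i \<in> V" for i
      using z1[of i] z2[of i e] that dj by (intro V1[THEN iffD1]) (auto simp: zV ze osum_def)
    moreover have "F x \<le> F y" if "x \<in> V" "y \<in> V" "(x, y) \<in> r" "x \<noteq> y" for x y
      using z2[of x y] that s by (auto simp: zV osum_def)
    moreover have "0 \<le> G i \<and> G i \<le> 1" if "i \<in> D" for i
      using z1[of i] z2[of e i] that dj by (intro D1[THEN iffD1]) (auto simp: zD ze osum_def)
    moreover have "G x \<le> G y" if "x \<in> D" "y \<in> D" "(x, y) \<in> d" "x \<noteq> y" for x y
      using z2[of x y] that s by (auto simp: zD osum_def)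
    ultimately show "F \<in> order_polytope V r \<and> G \<in> order_polytope D d"
      using F G by (auto simp: order_polytope_def PiE_iff)
  next
    assume "F \<in> order_polytope V r \<and> G \<in> order_polytope D d"
    then have F1: "\<And>i. i \<in> V \<Longrightarrow> 0 \<le> F i \<and> F i \<le> 1"
      and F2: "\<And>x y. (x, y) \<in> r \<Longrightarrow> x \<noteq> y \<Longrightarrow> F x \<le> F y"
      and G1: "\<And>i. i \<in> D \<Longrightarrow> 0 \<le> G i \<and> G i \<le> 1"
      and G2: "\<And>x y. (x, y) \<in> d \<Longrightarrow> x \<noteq> y \<Longrightarrow> G x \<le> G y"
      using sub by (auto simp: order_polytope_def PiE_iff)
    have zV': "0 \<le> ?z i \<and> ?z i \<le> s" if "i \<in> V" for i
      using F1[OF that] V1[of "F i"] zV[OF that] by simp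
    have zD': "s \<le> ?z i \<and> ?z i \<le> 1" if "i \<in> D" for i
      using G1[OF that] D1[of "G i"] zD[OF that] by simp
    have "?z x \<le> ?z y" if xy: "(x, y) \<in> osum V r e D d" "x \<noteq> y" for x y
    proof -
      consider "(x, y) \<in> r" | "(x, y) \<in> d" | "x \<in> V" "y = e" | "x \<in> V" "y \<in> D" | "x = e" "y \<in> D"
        using xy by (auto simp: osum_def)
      then show ?thesis
      proof cases
        case 1
        then have "x \<in> V" "y \<in> V" using sub by auto
        then show ?thesis using F2[OF 1 xy(2)] s by (simp add: zV)
      next
        case 2
        then have "x \<in> D" "y \<in> D" using sub by auto
        then show ?thesis using G2[OF 2 xy(2)] s by (simp add: zD mult_left_mono)
      next
        case 3
        then show ?thesis using zV'[of x] ze by simp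
      next
        case 4
        then show ?thesis using zV'[of x] zD'[of y] by simp
      next
        case 5
        then show ?thesis using zD'[of y] ze by simp
      qed
    qed
    moreover have "?z i \<in> {0..1}" if "i \<in> insert e (V \<union> D)" for i
      using that zV'[of i] zD'[of i] ze s by auto
    moreover have "?z \<in> extensional (insert e (V \<union> D))"
      unfolding osum_map_def by (simp only: prod.case) (rule restrict_extensional)
    ultimately show "?z \<in> order_polytope (insert e (V \<union> D)) (osum V r e D d)"
      by (auto simp: order_polytope_def PiE_iff)
  qed
qed

text \<open>Fubini over the value \<open>s\<close> of \<open>e\<close>, then an affine substitution
  in each block; the volume factors \<open>s ^ card V\<close> and \<open>(1 - s) ^ card D\<close>
  combine into \<open>beta_dens\<close>. The integral stays unnormalised so that the volume can be
  read off as well as the law.\<close>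

lemma nn_integral_osum:
  assumes V: "finite_poset V r" and D: "finite_poset D d"
    and dj: "V \<inter> D = {}" "e \<notin> V" "e \<notin> D"
    and f: "f \<in> borel_measurable (lebP (insert e (V \<union> D)))"
  shows "(\<integral>\<^sup>+z. f z * indicator (order_polytope (insert e (V \<union> D)) (osum V r e D d)) z
      \<partial>lebP (insert e (V \<union> D))) =
    (\<integral>\<^sup>+s. ennreal (beta_dens (card V) (card D) s) *
      (\<integral>\<^sup>+F. (\<integral>\<^sup>+G. f (osum_map V e D (s, F, G)) * indicator (order_polytope D d) G \<partial>lebP D)
        * indicator (order_polytope V r) F \<partial>lebP V) \<partial>lborel)"
proof -
  note [measurable] = f
  have fin [simp]: "finite V" "finite D" using V D by (auto simp: finite_poset_def)
  let ?P = "insert e (V \<union> D)"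
  let ?O = "order_polytope ?P (osum V r e D d)"
  define h where "h z = f z * indicator ?O z" for z
  have [measurable]: "h \<in> borel_measurable (lebP ?P)" unfolding h_def by measurable
  interpret sfD: sigma_finite_measure "lebP D" by (rule sigma_finite_lebP) simp
  interpret sfV: sigma_finite_measure "lebP V" by (rule sigma_finite_lebP) simp
  have upd: "(\<lambda>G. (merge V D (F, G))(e := s)) \<in> lebP D \<rightarrow>\<^sub>M lebP ?P" if "F \<in> space (lebP V)" for F s
    using that by measurable
  have upd2: "(\<lambda>(F, G). (merge V D (F, G))(e := s)) \<in> lebP V \<Otimes>\<^sub>M lebP D \<rightarrow>\<^sub>M lebP ?P" for s
  proof -
    have "(\<lambda>z. (merge V D z)(e := s)) \<in> lebP V \<Otimes>\<^sub>M lebP D \<rightarrow>\<^sub>M lebP ?P" by measurable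
    then show ?thesis by (simp add: case_prod_beta')
  qed
  have m2: "(\<lambda>F. \<integral>\<^sup>+G. h ((merge V D (F, G))(e := s)) \<partial>lebP D) \<in> borel_measurable (lebP V)" for s
  proof (rule sfD.borel_measurable_nn_integral)
    have "(\<lambda>z. h ((merge V D z)(e := s))) \<in> borel_measurable (lebP V \<Otimes>\<^sub>M lebP D)"
      by measurable
    then show "(\<lambda>(x, y). h ((merge V D (x, y))(e := s))) \<in> borel_measurable (lebP V \<Otimes>\<^sub>M lebP D)"
      by (simp add: case_prod_beta')
  qed
  have "(\<integral>\<^sup>+z. h z \<partial>lebP ?P) = (\<integral>\<^sup>+s. (\<integral>\<^sup>+z. h (z(e := s)) \<partial>lebP (V \<union> D)) \<partial>lborel)"
    using dj by (intro lebP.product_nn_integral_insert_rev) auto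
  also have "\<dots> = (\<integral>\<^sup>+s. (\<integral>\<^sup>+F. (\<integral>\<^sup>+G. h ((merge V D (F, G))(e := s)) \<partial>lebP D) \<partial>lebP V) \<partial>lborel)"
    using dj by (intro nn_integral_cong lebP.product_nn_integral_fold) auto
  also have "\<dots> = (\<integral>\<^sup>+s. ennreal (beta_dens (card V) (card D) s) *
      (\<integral>\<^sup>+F. (\<integral>\<^sup>+G. f (osum_map V e D (s, F, G)) * indicator (order_polytope D d) G \<partial>lebP D)
        * indicator (order_polytope V r) F \<partial>lebP V) \<partial>lborel)"
  proof (rule nn_integral_cong_AE)
    \<comment> \<open>The values 0 and 1 are set aside because one of the two substitutions would
      have scaling factor 0 there. For \<open>s\<close> outside the unit interval both sides
      vanish.\<close>
    have "AE s in lborel. s \<noteq> (0::real) \<and> s \<noteq> 1"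
      using AE_lborel_singleton[of "0::real"] AE_lborel_singleton[of "1::real"] by eventually_elim auto
    then show "AE s in lborel. (\<integral>\<^sup>+F. (\<integral>\<^sup>+G. h ((merge V D (F, G))(e := s)) \<partial>lebP D) \<partial>lebP V) =
      ennreal (beta_dens (card V) (card D) s) *
      (\<integral>\<^sup>+F. (\<integral>\<^sup>+G. f (osum_map V e D (s, F, G)) * indicator (order_polytope D d) G \<partial>lebP D)
        * indicator (order_polytope V r) F \<partial>lebP V)"
    proof eventually_elim
      case (elim s)
      show ?case
      proof (cases "s \<in> {0<..<1}")
        case False
        then have s: "s \<notin> {0..1}" using elim by auto
        have "F(e := s) \<notin> ?O" for F
        proof
          assume "F(e := s) \<in> ?O"
          then have "F(e := s) \<in> ?P \<rightarrow>\<^sub>E {0..1}" by (simp add: order_polytope_def)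
          from PiE_mem[OF this, of e] show False using s by simp
        qed
        then have "h (F(e := s)) = 0" for F by (simp add: h_def)
        then show ?thesis using s by (simp add: beta_dens_def)
      next
        case True
        then have s: "0 < s" "s < 1" by auto
        have aff: "(\<integral>\<^sup>+F. (\<integral>\<^sup>+G. h ((merge V D (F, G))(e := s)) \<partial>lebP D) \<partial>lebP V) =
          ennreal (\<bar>s\<bar> ^ card V) *
          (\<integral>\<^sup>+F. (\<integral>\<^sup>+G. h ((merge V D (\<lambda>i\<in>V. 0 + s * F i, G))(e := s)) \<partial>lebP D) \<partial>lebP V)"
          using s m2 by (intro nn_integral_lebP_affine) auto
        have inner: "(\<integral>\<^sup>+G. h ((merge V D (\<lambda>i\<in>V. 0 + s * F i, G))(e := s)) \<partial>lebP D) =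
          ennreal ((1 - s) ^ card D) *
          ((\<integral>\<^sup>+G. f (osum_map V e D (s, F, G)) * indicator (order_polytope D d) G \<partial>lebP D)
            * indicator (order_polytope V r) F)" if F: "F \<in> space (lebP V)" for F
        proof -
          let ?F = "\<lambda>i\<in>V. 0 + s * F i"
          have F': "?F \<in> space (lebP V)" by (simp add: space_PiM)
          have "(\<lambda>G. h ((merge V D (?F, G))(e := s))) \<in> borel_measurable (lebP D)"
            using upd[OF F', of s] by measurable
          then have "(\<integral>\<^sup>+G. h ((merge V D (?F, G))(e := s)) \<partial>lebP D) =
            ennreal (\<bar>1 - s\<bar> ^ card D) *
            (\<integral>\<^sup>+G. h ((merge V D (?F, \<lambda>i\<in>D. s + (1 - s) * G i))(e := s)) \<partial>lebP D)"
            using s by (intro nn_integral_lebP_affine) auto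
          also have "(\<integral>\<^sup>+G. h ((merge V D (?F, \<lambda>i\<in>D. s + (1 - s) * G i))(e := s)) \<partial>lebP D) =
            (\<integral>\<^sup>+G. (f (osum_map V e D (s, F, G)) * indicator (order_polytope D d) G)
              * indicator (order_polytope V r) F \<partial>lebP D)"
          proof (rule nn_integral_cong)
            fix G assume G: "G \<in> space (lebP D)"
            have eq: "(merge V D (?F, \<lambda>i\<in>D. s + (1 - s) * G i))(e := s) = osum_map V e D (s, F, G)"
              using dj by (auto simp: osum_map_def merge_def fun_eq_iff)
            have "osum_map V e D (s, F, G) \<in> ?O \<longleftrightarrow> F \<in> order_polytope V r \<and> G \<in> order_polytope D d"
              using F G s by (intro osum_map_in_order_polytope V D dj) (auto simp: space_PiM PiE_iff)
            then show "h ((merge V D (?F, \<lambda>i\<in>D. s + (1 - s) * G i))(e := s)) =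
              (f (osum_map V e D (s, F, G)) * indicator (order_polytope D d) G)
                * indicator (order_polytope V r) F"
              unfolding eq h_def by (auto simp: indicator_def)
          qed
          also have "\<dots> = (\<integral>\<^sup>+G. f (osum_map V e D (s, F, G)) * indicator (order_polytope D d) G \<partial>lebP D)
              * indicator (order_polytope V r) F"
          proof (rule nn_integral_multc)
            have "(\<lambda>G. osum_map V e D (s, F, G)) \<in> lebP D \<rightarrow>\<^sub>M lebP ?P"
            proof (rule measurable_compose[OF _ osum_map_measurable])
              show "(\<lambda>G. (s, F, G)) \<in> lebP D \<rightarrow>\<^sub>M borel \<Otimes>\<^sub>M (lebP V \<Otimes>\<^sub>M lebP D)"
                using F by measurable
            qed auto
            then show "(\<lambda>G. f (osum_map V e D (s, F, G)) * indicator (order_polytope D d) G)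
              \<in> borel_measurable (lebP D)" by measurable
          qed
          moreover have "\<bar>1 - s\<bar> = 1 - s" using s by simp
          ultimately show ?thesis by (simp only: mult.assoc)
        qed
        have m3: "(\<lambda>F. (\<integral>\<^sup>+G. f (osum_map V e D (s, F, G)) * indicator (order_polytope D d) G \<partial>lebP D)
            * indicator (order_polytope V r) F) \<in> borel_measurable (lebP V)"
        proof -
          have "(\<lambda>(F, G). (s, F, G)) \<in> lebP V \<Otimes>\<^sub>M lebP D \<rightarrow>\<^sub>M borel \<Otimes>\<^sub>M (lebP V \<Otimes>\<^sub>M lebP D)"
            by measurable
          from measurable_compose[OF this osum_map_measurable, of V D e]
          have "(\<lambda>z. osum_map V e D (s, fst z, snd z)) \<in> lebP V \<Otimes>\<^sub>M lebP D \<rightarrow>\<^sub>M lebP ?P"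
            by (simp add: case_prod_beta')
          then have "(\<lambda>z. f (osum_map V e D (s, fst z, snd z)) * indicator (order_polytope D d) (snd z))
              \<in> borel_measurable (lebP V \<Otimes>\<^sub>M lebP D)" by measurable
          then have "(\<lambda>(F, G). f (osum_map V e D (s, F, G)) * indicator (order_polytope D d) G)
              \<in> borel_measurable (lebP V \<Otimes>\<^sub>M lebP D)" by (simp add: case_prod_beta')
          from sfD.borel_measurable_nn_integral[OF this] show ?thesis by measurable
        qed
        have "(\<integral>\<^sup>+F. (\<integral>\<^sup>+G. h ((merge V D (\<lambda>i\<in>V. 0 + s * F i, G))(e := s)) \<partial>lebP D) \<partial>lebP V) =
          ennreal ((1 - s) ^ card D) * (\<integral>\<^sup>+F. (\<integral>\<^sup>+G. f (osum_map V e D (s, F, G)) *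
            indicator (order_polytope D d) G \<partial>lebP D) * indicator (order_polytope V r) F \<partial>lebP V)"
          using inner m3 by (subst nn_integral_cmult[symmetric]) (auto intro: nn_integral_cong)
        then show ?thesis
          unfolding aff using s by (simp add: beta_dens_def ennreal_mult mult.assoc)
      qed
    qed
  qed
  finally show ?thesis by (simp add: h_def)
qed

text \<open>The two normalising volumes are moved outside the iterated integral, so that the law of
  an independent pair can be compared with an unnormalised integral over the composed
  polytope.\<close>

lemma nn_integral_random_point_pair:
  assumes V: "finite_poset V r" and D: "finite_poset D d"
    and g: "g \<in> borel_measurable (lebP V \<Otimes>\<^sub>M lebP D)"
  shows "(\<integral>\<^sup>+z. g z \<partial>(random_point V r \<Otimes>\<^sub>M random_point D d)) =
    (\<integral>\<^sup>+F. (\<integral>\<^sup>+G. g (F, G) * indicator (order_polytope D d) G \<partial>lebP D) *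
      indicator (order_polytope V r) F \<partial>lebP V) /
    emeasure (lebP D) (order_polytope D d) / emeasure (lebP V) (order_polytope V r)"
proof -
  note [measurable] = g
  have fin [simp]: "finite V" "finite D" using V D by (auto simp: finite_poset_def)
  let ?vV = "emeasure (lebP V) (order_polytope V r)"
  let ?vD = "emeasure (lebP D) (order_polytope D d)"
  interpret mD: prob_space "random_point D d" by (rule prob_space_random_point[OF D])
  interpret sfD: sigma_finite_measure "lebP D" by (rule sigma_finite_lebP) simp
  have m6: "(\<lambda>F. \<integral>\<^sup>+G. g (F, G) * indicator (order_polytope D d) G \<partial>lebP D) \<in> borel_measurable (lebP V)"
    by measurable
  have gF: "(\<lambda>G. g (F, G)) \<in> borel_measurable (lebP D)" if "F \<in> space (lebP V)" for F
    using measurable_compose[OF measurable_Pair1'[OF that] g] by simp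
  have "(\<integral>\<^sup>+z. g z \<partial>(random_point V r \<Otimes>\<^sub>M random_point D d)) =
    (\<integral>\<^sup>+F. (\<integral>\<^sup>+G. g (F, G) \<partial>random_point D d) \<partial>random_point V r)"
    by (intro mD.nn_integral_fst[symmetric]) measurable
  also have "\<dots> = (\<integral>\<^sup>+F. (\<integral>\<^sup>+G. g (F, G) *
      indicator (order_polytope D d) G \<partial>lebP D) / ?vD \<partial>random_point V r)"
    using gF by (intro nn_integral_cong) (auto simp: random_point_def intro!: nn_integral_uniform_measure)
  also have "\<dots> = (\<integral>\<^sup>+F. ((\<integral>\<^sup>+G. g (F, G) *
      indicator (order_polytope D d) G \<partial>lebP D) / ?vD) * indicator (order_polytope V r) F \<partial>lebP V) / ?vV"
    unfolding random_point_def using m6 by (intro nn_integral_uniform_measure) auto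
  also have "(\<integral>\<^sup>+F. ((\<integral>\<^sup>+G. g (F, G) *
      indicator (order_polytope D d) G \<partial>lebP D) / ?vD) * indicator (order_polytope V r) F \<partial>lebP V) =
     (\<integral>\<^sup>+F. ((\<integral>\<^sup>+G. g (F, G) *
      indicator (order_polytope D d) G \<partial>lebP D) * indicator (order_polytope V r) F) / ?vD \<partial>lebP V)"
    by (intro nn_integral_cong) (simp add: divide_ennreal_def mult_ac)
  also have "\<dots> = (\<integral>\<^sup>+F. (\<integral>\<^sup>+G. g (F, G) * indicator (order_polytope D d) G \<partial>lebP D) *
      indicator (order_polytope V r) F \<partial>lebP V) / ?vD"
    using m6 by (intro nn_integral_divide) auto
  finally show ?thesis .
qed

text \<open>The mass of a measurable part of the composed polytope is \<open>k\<close> times the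
  probability of its preimage under \<open>osum_map\<close>, with \<open>k\<close> the Beta constant
  times both volumes. The volume formula is kept as a second conclusion for the cones of linear
  orders.\<close>

lemma random_point_osum:
  assumes V: "finite_poset V r" and D: "finite_poset D d"
    and dj: "V \<inter> D = {}" "e \<notin> V" "e \<notin> D"
  shows "random_point (insert e (V \<union> D)) (osum V r e D d) =
      distr (beta_distr (card V) (card D) \<Otimes>\<^sub>M (random_point V r \<Otimes>\<^sub>M random_point D d))
        (lebP (insert e (V \<union> D))) (osum_map V e D)" (is ?th1)
    and "emeasure (lebP (insert e (V \<union> D))) (order_polytope (insert e (V \<union> D)) (osum V r e D d)) =
      ennreal (beta_norm (card V) (card D)) * (emeasure (lebP V) (order_polytope V r) *
        emeasure (lebP D) (order_polytope D d))" (is ?th2)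
proof -
  have fin [simp]: "finite V" "finite D" using V D by (auto simp: finite_poset_def)
  let ?P = "insert e (V \<union> D)"
  let ?O = "order_polytope ?P (osum V r e D d)"
  let ?B = "beta_distr (card V) (card D)"
  let ?N = "distr (?B \<Otimes>\<^sub>M (random_point V r \<Otimes>\<^sub>M random_point D d)) (lebP ?P) (osum_map V e D)"
  let ?vV = "emeasure (lebP V) (order_polytope V r)"
  let ?vD = "emeasure (lebP D) (order_polytope D d)"
  note nz = order_polytope_nontriv[OF V] order_polytope_nontriv[OF D]
  interpret B: prob_space ?B by (rule prob_space_beta_distr)
  interpret mV: prob_space "random_point V r" by (rule prob_space_random_point[OF V])
  interpret mD: prob_space "random_point D d" by (rule prob_space_random_point[OF D])
  interpret VD: pair_prob_space "random_point V r" "random_point D d" ..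
  interpret BVD: pair_prob_space ?B "random_point V r \<Otimes>\<^sub>M random_point D d" ..
  interpret sfD: sigma_finite_measure "lebP D" by (rule sigma_finite_lebP) simp
  interpret sfV: sigma_finite_measure "lebP V" by (rule sigma_finite_lebP) simp
  define k where "k = ennreal (beta_norm (card V) (card D)) * (?vV * ?vD)"
  have om: "osum_map V e D \<in> ?B \<Otimes>\<^sub>M (random_point V r \<Otimes>\<^sub>M random_point D d) \<rightarrow>\<^sub>M lebP ?P"
    by (rule osum_map_measurable) auto
  have om': "osum_map V e D \<in> lborel \<Otimes>\<^sub>M (lebP V \<Otimes>\<^sub>M lebP D) \<rightarrow>\<^sub>M lebP ?P"
    by (rule osum_map_measurable) auto
  have eq: "emeasure (lebP ?P) (?O \<inter> A) = k * emeasure ?N A" if A: "A \<in> sets (lebP ?P)" for A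
  proof -
    note [measurable] = A
    define f :: "('a \<Rightarrow> real) \<Rightarrow> ennreal" where "f = indicator A"
    have f[measurable]: "f \<in> borel_measurable (lebP ?P)" by (simp add: f_def)
    define \<Phi> where "\<Phi> s = (\<integral>\<^sup>+F. (\<integral>\<^sup>+G. f (osum_map V e D (s, F, G)) *
      indicator (order_polytope D d) G \<partial>lebP D) * indicator (order_polytope V r) F \<partial>lebP V)" for s
    have fo: "(\<lambda>z. f (osum_map V e D z)) \<in> borel_measurable (lborel \<Otimes>\<^sub>M (lebP V \<Otimes>\<^sub>M lebP D))"
      using om' by measurable
    have fo1: "(\<lambda>z. f (osum_map V e D (fst (fst z), snd (fst z), snd z)))
        \<in> borel_measurable ((lborel \<Otimes>\<^sub>M lebP V) \<Otimes>\<^sub>M lebP D)"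
      using fo by measurable
    have m4: "(\<lambda>z. \<integral>\<^sup>+G. f (osum_map V e D (fst z, snd z, G)) *
      indicator (order_polytope D d) G \<partial>lebP D) \<in> borel_measurable (lborel \<Otimes>\<^sub>M lebP V)"
    proof (rule sfD.borel_measurable_nn_integral)
      have "(\<lambda>z. f (osum_map V e D (fst (fst z), snd (fst z), snd z)) *
        indicator (order_polytope D d) (snd z)) \<in> borel_measurable ((lborel \<Otimes>\<^sub>M lebP V) \<Otimes>\<^sub>M lebP D)"
        using fo1 by measurable
      then show "(\<lambda>(z, G). f (osum_map V e D (fst z, snd z, G)) *
        indicator (order_polytope D d) G) \<in> borel_measurable ((lborel \<Otimes>\<^sub>M lebP V) \<Otimes>\<^sub>M lebP D)"
        by (simp add: case_prod_beta')
    qed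
    have m5: "\<Phi> \<in> borel_measurable lborel"
      unfolding \<Phi>_def
    proof (rule sfV.borel_measurable_nn_integral)
      show "(\<lambda>(s, F). (\<integral>\<^sup>+G. f (osum_map V e D (s, F, G)) * indicator (order_polytope D d) G \<partial>lebP D) *
        indicator (order_polytope V r) F) \<in> borel_measurable (lborel \<Otimes>\<^sub>M lebP V)"
        using m4 by (simp add: case_prod_beta')
    qed
    have "emeasure (lebP ?P) (?O \<inter> A) = (\<integral>\<^sup>+z. indicator (?O \<inter> A) z \<partial>lebP ?P)"
      by simp
    also have "\<dots> = (\<integral>\<^sup>+z. f z * indicator ?O z \<partial>lebP ?P)"
      by (intro nn_integral_cong) (auto simp: f_def indicator_def)
    also have "\<dots> = (\<integral>\<^sup>+s. ennreal (beta_dens (card V) (card D) s) * \<Phi> s \<partial>lborel)"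
      unfolding \<Phi>_def by (rule nn_integral_osum[OF V D dj f])
    finally have lhs: "emeasure (lebP ?P) (?O \<inter> A) =
      (\<integral>\<^sup>+s. ennreal (beta_dens (card V) (card D) s) * \<Phi> s \<partial>lborel)" .
    have "emeasure ?N A = (\<integral>\<^sup>+z. f z \<partial>?N)" by (simp add: f_def)
    also have "\<dots> = (\<integral>\<^sup>+z. f (osum_map V e D z) \<partial>(?B \<Otimes>\<^sub>M (random_point V r \<Otimes>\<^sub>M random_point D d)))"
      using om by (intro nn_integral_distr) auto
    also have "\<dots> = (\<integral>\<^sup>+s. (\<integral>\<^sup>+z. f (osum_map V e D (s, z)) \<partial>(random_point V r \<Otimes>\<^sub>M random_point D d)) \<partial>?B)"
      using om by (intro VD.P.nn_integral_fst[symmetric]) measurable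
    also have "\<dots> = (\<integral>\<^sup>+s. \<Phi> s / ?vD / ?vV \<partial>?B)"
    proof (rule nn_integral_cong)
      fix s :: real
      have "(\<lambda>z. (s, z)) \<in> lebP V \<Otimes>\<^sub>M lebP D \<rightarrow>\<^sub>M lborel \<Otimes>\<^sub>M (lebP V \<Otimes>\<^sub>M lebP D)" by measurable
      from nn_integral_random_point_pair[OF V D measurable_compose[OF this fo]]
      show "(\<integral>\<^sup>+z. f (osum_map V e D (s, z)) \<partial>(random_point V r \<Otimes>\<^sub>M random_point D d)) =
        \<Phi> s / ?vD / ?vV" by (simp only: \<Phi>_def)
    qed
    also have "\<dots> = (\<integral>\<^sup>+s. ennreal (beta_dens (card V) (card D) s / beta_norm (card V) (card D)) *
        (\<Phi> s / ?vD / ?vV) \<partial>lborel)"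
      unfolding beta_distr_def using m5 by (intro nn_integral_density) auto
    finally have rhs: "emeasure ?N A = \<dots>" .
    have "k * emeasure ?N A = (\<integral>\<^sup>+s. k * (ennreal (beta_dens (card V) (card D) s / beta_norm (card V) (card D)) *
        (\<Phi> s / ?vD / ?vV)) \<partial>lborel)"
      unfolding rhs using m5 by (intro nn_integral_cmult[symmetric]) auto
    also have "\<dots> = (\<integral>\<^sup>+s. ennreal (beta_dens (card V) (card D) s) * \<Phi> s \<partial>lborel)"
    proof (rule nn_integral_cong)
      fix s :: real
      have 1: "\<Phi> s / ?vD / ?vV * (?vV * ?vD) = \<Phi> s"
      proof -
        have *: "x / v * v = x" if "v \<noteq> 0" "v \<noteq> \<infinity>" for x v :: ennreal
          using that by (simp add: ennreal_divide_times ennreal_divide_self less_top)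
        show ?thesis using nz by (simp add: mult.assoc[symmetric] *)
      qed
      have 2: "ennreal (beta_norm (card V) (card D)) *
          ennreal (beta_dens (card V) (card D) s / beta_norm (card V) (card D)) =
          ennreal (beta_dens (card V) (card D) s)"
        using beta_norm_pos[of "card V" "card D"]
        by (subst ennreal_mult[symmetric]) (auto simp: beta_dens_nonneg)
      have "k * (ennreal (beta_dens (card V) (card D) s / beta_norm (card V) (card D)) * (\<Phi> s / ?vD / ?vV)) =
        (ennreal (beta_norm (card V) (card D)) *
          ennreal (beta_dens (card V) (card D) s / beta_norm (card V) (card D))) *
        (\<Phi> s / ?vD / ?vV * (?vV * ?vD))"
        by (simp add: k_def mult_ac)
      then show "k * (ennreal (beta_dens (card V) (card D) s / beta_norm (card V) (card D)) *
        (\<Phi> s / ?vD / ?vV)) = ennreal (beta_dens (card V) (card D) s) * \<Phi> s"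
        by (simp only: 1 2)
    qed
    finally show ?thesis using lhs by simp
  qed
  have k: "k \<noteq> 0" "k \<noteq> \<infinity>"
    using nz beta_norm_pos[of "card V" "card D"]
    by (auto simp: k_def ennreal_mult_eq_top_iff)
  have pN: "prob_space ?N" using om by (intro BVD.prob_space_distr)
  have O: "?O \<in> sets (lebP ?P)" by (rule sets_order_polytope) simp
  show ?th1
    unfolding random_point_def[of ?P]
    by (rule uniform_measure_eqI(1)[OF pN _ O k eq]) auto
  show ?th2
    using uniform_measure_eqI(2)[OF pN _ O k eq] by (simp add: k_def)
qed

section \<open>Disjoint unions and order reversal\<close>

lemma merge_in_order_polytope:
  assumes V: "finite_poset V r" and D: "finite_poset D d" and dj: "V \<inter> D = {}"
    and F: "F \<in> extensional V" and G: "G \<in> extensional D"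
  shows "merge V D (F, G) \<in> order_polytope (V \<union> D) (r \<union> d) \<longleftrightarrow>
    F \<in> order_polytope V r \<and> G \<in> order_polytope D d"
proof -
  note sub = finite_poset_subset[OF V] finite_poset_subset[OF D]
  have zV: "merge V D (F, G) i = F i" if "i \<in> V" for i using that by (simp add: merge_def)
  have zD: "merge V D (F, G) i = G i" if "i \<in> D" for i using that dj by (auto simp: merge_def)
  show ?thesis
  proof
    assume "merge V D (F, G) \<in> order_polytope (V \<union> D) (r \<union> d)"
    then have z1: "\<And>i. i \<in> V \<union> D \<Longrightarrow> merge V D (F, G) i \<in> {0..1}"
      and z2: "\<And>x y. (x, y) \<in> r \<union> d \<Longrightarrow> x \<in> V \<union> D \<Longrightarrow> y \<in> V \<union> D \<Longrightarrow> x \<noteq> y \<Longrightarrow>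
        merge V D (F, G) x \<le> merge V D (F, G) y"
      by (auto simp: order_polytope_def PiE_iff)
    have "F i \<in> {0..1}" if "i \<in> V" for i using z1[of i] zV[OF that] that by simp
    moreover have "F x \<le> F y" if "x \<in> V" "y \<in> V" "(x, y) \<in> r" "x \<noteq> y" for x y
      using z2[of x y] that zV by simp
    moreover have "G i \<in> {0..1}" if "i \<in> D" for i using z1[of i] zD[OF that] that by simp
    moreover have "G x \<le> G y" if "x \<in> D" "y \<in> D" "(x, y) \<in> d" "x \<noteq> y" for x y
      using z2[of x y] that zD by simp
    ultimately show "F \<in> order_polytope V r \<and> G \<in> order_polytope D d"
      using F G by (auto simp: order_polytope_def PiE_iff)
  next
    assume "F \<in> order_polytope V r \<and> G \<in> order_polytope D d"
    then have F1: "\<And>i. i \<in> V \<Longrightarrow> F i \<in> {0..1}"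
      and F2: "\<And>x y. (x, y) \<in> r \<Longrightarrow> x \<noteq> y \<Longrightarrow> F x \<le> F y"
      and G1: "\<And>i. i \<in> D \<Longrightarrow> G i \<in> {0..1}"
      and G2: "\<And>x y. (x, y) \<in> d \<Longrightarrow> x \<noteq> y \<Longrightarrow> G x \<le> G y"
      using sub by (auto simp: order_polytope_def PiE_iff)
    have "merge V D (F, G) x \<le> merge V D (F, G) y" if xy: "(x, y) \<in> r \<union> d" "x \<noteq> y" for x y
      using xy(1)
    proof
      assume "(x, y) \<in> r"
      then show ?thesis using F2[of x y] xy(2) sub zV by auto
    next
      assume "(x, y) \<in> d"
      then show ?thesis using G2[of x y] xy(2) sub zD by auto
    qed
    moreover have "merge V D (F, G) i \<in> {0..1}" if "i \<in> V \<union> D" for i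
      using that F1[of i] G1[of i] zV[of i] zD[of i] by auto
    ultimately show "merge V D (F, G) \<in> order_polytope (V \<union> D) (r \<union> d)"
      by (auto simp: order_polytope_def PiE_iff)
  qed
qed

lemma random_point_Un:
  assumes V: "finite_poset V r" and D: "finite_poset D d" and dj: "V \<inter> D = {}"
  shows "random_point (V \<union> D) (r \<union> d) =
    distr (random_point V r \<Otimes>\<^sub>M random_point D d) (lebP (V \<union> D)) (merge V D)"
proof -
  have fin [simp]: "finite V" "finite D" using V D by (auto simp: finite_poset_def)
  let ?O = "order_polytope (V \<union> D) (r \<union> d)"
  let ?N = "distr (random_point V r \<Otimes>\<^sub>M random_point D d) (lebP (V \<union> D)) (merge V D)"
  let ?vV = "emeasure (lebP V) (order_polytope V r)"
  let ?vD = "emeasure (lebP D) (order_polytope D d)"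
  note nz = order_polytope_nontriv[OF V] order_polytope_nontriv[OF D]
  interpret mV: prob_space "random_point V r" by (rule prob_space_random_point[OF V])
  interpret mD: prob_space "random_point D d" by (rule prob_space_random_point[OF D])
  interpret VD: pair_prob_space "random_point V r" "random_point D d" ..
  have mg: "merge V D \<in> random_point V r \<Otimes>\<^sub>M random_point D d \<rightarrow>\<^sub>M lebP (V \<union> D)"
    by measurable
  have mg': "merge V D \<in> lebP V \<Otimes>\<^sub>M lebP D \<rightarrow>\<^sub>M lebP (V \<union> D)"
    by measurable
  have eq: "emeasure (lebP (V \<union> D)) (?O \<inter> A) = ?vV * ?vD * emeasure ?N A" if A: "A \<in> sets (lebP (V \<union> D))" for A
  proof -
    note [measurable] = A
    define f :: "('a \<Rightarrow> real) \<Rightarrow> ennreal" where "f = indicator A"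
    have f[measurable]: "f \<in> borel_measurable (lebP (V \<union> D))" by (simp add: f_def)
    have fm: "(\<lambda>z. f (merge V D z)) \<in> borel_measurable (lebP V \<Otimes>\<^sub>M lebP D)" using mg' by measurable
    have fm': "(\<lambda>G. f (merge V D (F, G))) \<in> borel_measurable (lebP D)" if "F \<in> space (lebP V)" for F
      using measurable_compose[OF measurable_Pair1'[OF that] fm] by simp
    have "emeasure (lebP (V \<union> D)) (?O \<inter> A) = (\<integral>\<^sup>+z. indicator (?O \<inter> A) z \<partial>lebP (V \<union> D))"
      by simp
    also have "\<dots> = (\<integral>\<^sup>+z. f z * indicator ?O z \<partial>lebP (V \<union> D))"
      by (intro nn_integral_cong) (auto simp: f_def indicator_def)
    also have "\<dots> = (\<integral>\<^sup>+F. (\<integral>\<^sup>+G. f (merge V D (F, G)) * indicator ?O (merge V D (F, G)) \<partial>lebP D) \<partial>lebP V)"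
      using dj by (intro lebP.product_nn_integral_fold) auto
    also have "\<dots> = (\<integral>\<^sup>+F. (\<integral>\<^sup>+G. f (merge V D (F, G)) * indicator (order_polytope D d) G \<partial>lebP D) *
      indicator (order_polytope V r) F \<partial>lebP V)"
    proof (rule nn_integral_cong)
      fix F assume F: "F \<in> space (lebP V)"
      have "(\<integral>\<^sup>+G. f (merge V D (F, G)) * indicator ?O (merge V D (F, G)) \<partial>lebP D) =
        (\<integral>\<^sup>+G. f (merge V D (F, G)) * indicator (order_polytope D d) G * indicator (order_polytope V r) F \<partial>lebP D)"
        using F merge_in_order_polytope[OF V D dj, of F]
        by (intro nn_integral_cong) (auto simp: space_PiM indicator_def PiE_iff)
      also have "\<dots> = (\<integral>\<^sup>+G. f (merge V D (F, G)) * indicator (order_polytope D d) G \<partial>lebP D) *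
          indicator (order_polytope V r) F"
        using fm'[OF F] by (intro nn_integral_multc borel_measurable_times borel_measurable_indicator) auto
      finally show "(\<integral>\<^sup>+G. f (merge V D (F, G)) * indicator ?O (merge V D (F, G)) \<partial>lebP D) = \<dots>" .
    qed
    finally have lhs: "emeasure (lebP (V \<union> D)) (?O \<inter> A) = \<dots>" .
    have "emeasure ?N A = (\<integral>\<^sup>+z. f z \<partial>?N)" by (simp add: f_def)
    also have "\<dots> = (\<integral>\<^sup>+z. f (merge V D z) \<partial>(random_point V r \<Otimes>\<^sub>M random_point D d))"
      using mg by (intro nn_integral_distr) auto
    also have "\<dots> = emeasure (lebP (V \<union> D)) (?O \<inter> A) / ?vD / ?vV"
      unfolding lhs by (rule nn_integral_random_point_pair[OF V D fm])
    finally have N: "emeasure ?N A = emeasure (lebP (V \<union> D)) (?O \<inter> A) / ?vD / ?vV" .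
    have *: "x / v * v = x" if "v \<noteq> 0" "v \<noteq> \<infinity>" for x v :: ennreal
      using that by (simp add: ennreal_divide_times ennreal_divide_self less_top)
    have "emeasure ?N A * ?vV * ?vD = emeasure (lebP (V \<union> D)) (?O \<inter> A)"
      unfolding N using nz by (simp add: *)
    then show ?thesis by (simp add: mult_ac)
  qed
  have k: "?vV * ?vD \<noteq> 0" "?vV * ?vD \<noteq> \<infinity>"
    using nz by (auto simp: ennreal_mult_eq_top_iff)
  have pN: "prob_space ?N" using mg by (intro VD.prob_space_distr)
  show ?thesis
    unfolding random_point_def[of "V \<union> D"]
    by (rule uniform_measure_eqI(1)[OF pN _ _ k eq]) auto
qed

lemma random_point_converse:
  assumes V: "finite_poset V r"
  shows "random_point V (r\<inverse>) = distr (random_point V r) (lebP V) (\<lambda>F. \<lambda>i\<in>V. 1 - F i)"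
proof -
  have fin [simp]: "finite V" using V by (auto simp: finite_poset_def)
  note nz = order_polytope_nontriv[OF V]
  let ?v = "emeasure (lebP V) (order_polytope V r)"
  let ?T = "\<lambda>F. \<lambda>i\<in>V. (1::real) - F i"
  interpret mV: prob_space "random_point V r" by (rule prob_space_random_point[OF V])
  have T: "?T \<in> lebP V \<rightarrow>\<^sub>M lebP V" by measurable
  have T': "?T \<in> random_point V r \<rightarrow>\<^sub>M lebP V"
    using T by (simp add: measurable_cong_sets[OF sets_random_point refl])
  let ?N = "distr (random_point V r) (lebP V) ?T"
  have eq: "emeasure (lebP V) (order_polytope V (r\<inverse>) \<inter> A) = ?v * emeasure ?N A" if A: "A \<in> sets (lebP V)" for A
  proof -
    let ?f = "indicator (order_polytope V (r\<inverse>) \<inter> A) :: _ \<Rightarrow> ennreal"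
    have TA: "?T -` A \<inter> space (lebP V) \<in> sets (lebP V)" using T A by (rule measurable_sets)
    have "emeasure (lebP V) (order_polytope V (r\<inverse>) \<inter> A) = (\<integral>\<^sup>+F. ?f F \<partial>lebP V)"
      using A by simp
    also have "\<dots> = ennreal (\<bar>-1\<bar> ^ card V) * (\<integral>\<^sup>+F. ?f (\<lambda>i\<in>V. 1 + (-1) * F i) \<partial>lebP V)"
      using A by (intro nn_integral_lebP_affine) auto
    also have "\<dots> = (\<integral>\<^sup>+F. ?f (?T F) \<partial>lebP V)" by simp
    also have "\<dots> = (\<integral>\<^sup>+F. indicator (order_polytope V r \<inter> (?T -` A \<inter> space (lebP V))) F \<partial>lebP V)"
    proof (rule nn_integral_cong)
      fix F assume F: "F \<in> space (lebP V)"
      have "?T F \<in> order_polytope V (r\<inverse>) \<longleftrightarrow> F \<in> order_polytope V r"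
        using F by (fastforce simp: order_polytope_def space_PiM PiE_iff)
      then show "?f (?T F) = indicator (order_polytope V r \<inter> (?T -` A \<inter> space (lebP V))) F"
        using F by (auto simp: indicator_def)
    qed
    also have "\<dots> = emeasure (lebP V) (order_polytope V r \<inter> (?T -` A \<inter> space (lebP V)))"
      using TA by (intro nn_integral_indicator) auto
    finally have 1: "emeasure (lebP V) (order_polytope V (r\<inverse>) \<inter> A) = \<dots>" .
    have "emeasure ?N A = emeasure (random_point V r) (?T -` A \<inter> space (lebP V))"
      using T' A by (subst emeasure_distr) auto
    also have "\<dots> = emeasure (lebP V) (order_polytope V r \<inter> (?T -` A \<inter> space (lebP V))) / ?v"
      unfolding random_point_def using TA by (intro emeasure_uniform_measure) auto
    finally have "?v * emeasure ?N A = ?v * (emeasure (lebP V) (order_polytope V (r\<inverse>) \<inter> A) / ?v)"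
      unfolding 1 by simp
    also have "\<dots> = emeasure (lebP V) (order_polytope V (r\<inverse>) \<inter> A) * ?v / ?v"
      by (simp add: ennreal_times_divide mult.commute)
    finally show ?thesis using nz by (simp add: mult_divide_eq_ennreal)
  qed
  have pN: "prob_space ?N" using T' by (intro mV.prob_space_distr)
  have "uniform_measure (lebP V) (order_polytope V (r\<inverse>)) = ?N"
    using nz by (intro uniform_measure_eqI(1)[OF pN _ _ nz eq]) auto
  then show ?thesis by (simp add: random_point_def[of V "r\<inverse>"])
qed

section \<open>Linear extensions and cones\<close>

lemma finite_poset_empty: "finite_poset {} {}"
  by (simp add: finite_poset_def)

lemma emeasure_lebP_empty: "emeasure (lebP {}) (order_polytope {} r) = 1"
proof -
  have "order_polytope {} r = {\<lambda>_. undefined}" by (auto simp: order_polytope_def)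
  then show ?thesis using lebP.emeasure_PiM[of "{}" "\<lambda>_. UNIV"] by simp
qed

lemma linear_order_max:
  assumes "finite V" "V \<noteq> {}" "linear_order_on V l"
  obtains e where "e \<in> V" "\<And>x. x \<in> V \<Longrightarrow> (x, e) \<in> l"
proof -
  have po: "finite_poset V l" using assms by (simp add: finite_poset_def linear_order_on_def)
  define f where "f x = card {z. (z, x) \<in> l}" for x
  have "Max (f ` V) \<in> f ` V" using assms by (intro Max_in) auto
  then obtain e where e: "e \<in> V" "Max (f ` V) = f e" by auto
  have "(x, e) \<in> l" if x: "x \<in> V" for x
  proof (cases "x = e")
    case True
    then show ?thesis using assms x by (auto simp: order_on_defs refl_on_def)
  next
    case False
    then have "(x, e) \<in> l \<or> (e, x) \<in> l" using assms x e by (auto simp: order_on_defs total_on_def)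
    moreover have "(e, x) \<notin> l"
    proof
      assume "(e, x) \<in> l"
      then have "f e < f x" unfolding f_def using card_below_less[OF po] False by blast
      moreover have "f x \<le> f e" using x assms(1) e(2)[symmetric] by simp
      ultimately show False by simp
    qed
    ultimately show ?thesis by blast
  qed
  then show ?thesis using that e by blast
qed

text \<open>Induction on the size: removing the maximum \<open>e\<close> presents the linear order
  as the ordinal sum of the rest, \<open>e\<close> and an empty upper part, and
  \<open>beta_norm n 0\<close> is 1/(n + 1).\<close>

lemma emeasure_linear_cone:
  assumes "finite V" "linear_order_on V l"
  shows "emeasure (lebP V) (order_polytope V l) = ennreal (1 / fact (card V))"
  using assms
proof (induction "card V" arbitrary: V l)
  case 0
  then show ?case using emeasure_lebP_empty[of l] by simp
next
  case (Suc n)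
  then have "V \<noteq> {}" by auto
  with Suc obtain e where e: "e \<in> V" "\<And>x. x \<in> V \<Longrightarrow> (x, e) \<in> l"
    using linear_order_max by blast
  define W where "W = V - {e}"
  define m where "m = l \<inter> (W \<times> W)"
  have V: "V = insert e (W \<union> {})" "e \<notin> W" using e by (auto simp: W_def)
  have finW: "finite W" using Suc.prems by (simp add: W_def)
  have cW: "n = card W" using Suc.hyps(2) V finW by simp
  have lin: "l \<subseteq> V \<times> V" "refl_on V l" "trans l" "antisym l" "total_on V l"
    using Suc.prems(2) by (auto simp: order_on_defs)
  have m: "linear_order_on W m"
    unfolding order_on_defs
  proof (intro conjI)
    show "m \<subseteq> W \<times> W" by (simp add: m_def)
    show "refl_on W m" using lin(2) by (auto simp: refl_on_def m_def W_def)
    show "trans m" using lin(3) unfolding m_def trans_def by blast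
    show "antisym m" using lin(4) unfolding m_def antisym_def by blast
    show "total_on W m" using lin(5) by (auto simp: total_on_def m_def W_def)
  qed
  have l: "l = osum W m e {} {}"
  proof
    show "l \<subseteq> osum W m e {} {}"
    proof
      fix z assume "z \<in> l"
      then obtain x y where z: "z = (x, y)" "(x, y) \<in> l" by (cases z) auto
      then have xy: "x \<in> V" "y \<in> V" using lin(1) by auto
      have "x \<in> W" if "y \<in> W"
      proof (rule ccontr)
        assume "x \<notin> W"
        then have "x = e" using xy by (simp add: W_def)
        then have "y = e" using e(2)[of y] z xy lin(4) by (auto dest: antisymD)
        then show False using that by (simp add: W_def)
      qed
      then show "z \<in> osum W m e {} {}" using z xy by (auto simp: osum_def m_def W_def)
    qed
    show "osum W m e {} {} \<subseteq> l" using e by (auto simp: osum_def m_def W_def)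
  qed
  have pW: "finite_poset W m" using m finW by (simp add: finite_poset_def linear_order_on_def)
  have "emeasure (lebP V) (order_polytope V l) =
    ennreal (beta_norm (card W) (card ({} :: 'a set))) *
      (emeasure (lebP W) (order_polytope W m) * emeasure (lebP {}) (order_polytope ({} :: 'a set) {}))"
    using random_point_osum(2)[OF pW finite_poset_empty, of e] V(2)
    unfolding l V(1)[symmetric] by simp
  also have "\<dots> = ennreal (beta_norm n 0 * (1 / fact n))"
    using Suc.hyps(1)[OF cW finW m] cW beta_norm_pos[of n 0]
    by (simp add: emeasure_lebP_empty ennreal_mult[symmetric])
  also have "beta_norm n 0 * (1 / fact n) = 1 / fact (card V)"
    unfolding Suc.hyps(2)[symmetric] beta_norm_def by (simp del: fact_Suc)
  finally show ?case .
qed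

lemma finite_linear_extensions:
  assumes "finite V"
  shows "finite (linear_extensions V r)"
proof (rule finite_subset)
  show "linear_extensions V r \<subseteq> Pow (V \<times> V)"
    by (auto simp: linear_extensions_def order_on_defs)
qed (use assms in simp)

text \<open>A point without ties can lie only in the cone of the order of its own coordinates, so
  the cones of distinct linear extensions overlap in a null set.\<close>

lemma linear_extension_cone_iff:
  assumes "finite_poset V r" "F \<in> space (lebP V)" "inj_on F V" "l \<in> linear_extensions V r"
  shows "F \<in> order_polytope V l \<longleftrightarrow>
    F \<in> V \<rightarrow>\<^sub>E {0..1} \<and> l = {(x, y) \<in> V \<times> V. F x \<le> F y}"
proof -
  have l: "l \<subseteq> V \<times> V" "refl_on V l" "trans l" "antisym l" "total_on V l"
    using assms(4) by (auto simp: linear_extensions_def order_on_defs)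
  show ?thesis
  proof
    assume F: "F \<in> order_polytope V l"
    have "l \<subseteq> {(x, y) \<in> V \<times> V. F x \<le> F y}"
    proof
      fix z assume "z \<in> l"
      then obtain x y where z: "z = (x, y)" "(x, y) \<in> l" by (cases z) auto
      then show "z \<in> {(x, y) \<in> V \<times> V. F x \<le> F y}"
        using F l(1) by (cases "x = y") (auto simp: order_polytope_def)
    qed
    moreover have "{(x, y) \<in> V \<times> V. F x \<le> F y} \<subseteq> l"
    proof clarify
      fix x y assume xy: "x \<in> V" "y \<in> V" "F x \<le> F y"
      show "(x, y) \<in> l"
      proof (rule ccontr)
        assume n: "(x, y) \<notin> l"
        then have neq: "x \<noteq> y" using l(2) xy by (auto simp: refl_on_def)
        then have "(y, x) \<in> l" using n l(5) xy by (auto simp: total_on_def)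
        then have "F y \<le> F x" using F xy neq by (auto simp: order_polytope_def)
        then have "F x = F y" using xy by simp
        then show False using assms(3) xy neq by (auto dest: inj_onD)
      qed
    qed
    ultimately show "F \<in> V \<rightarrow>\<^sub>E {0..1} \<and> l = {(x, y) \<in> V \<times> V. F x \<le> F y}"
      using F by (auto simp: order_polytope_def)
  qed (auto simp: order_polytope_def)
qed

lemma point_order_extension:
  assumes V: "finite_poset V r" and F: "F \<in> order_polytope V r" "inj_on F V"
  shows "{(x, y) \<in> V \<times> V. F x \<le> F y} \<in> linear_extensions V r"
proof -
  let ?l = "{(x, y) \<in> V \<times> V. F x \<le> F y}"
  have "linear_order_on V ?l"
    using F(2) unfolding order_on_defs refl_on_def trans_def antisym_def total_on_def
    by (auto dest: inj_onD)
  moreover have "r \<subseteq> ?l"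
  proof
    fix z assume "z \<in> r"
    then obtain x y where z: "z = (x, y)" "(x, y) \<in> r" by (cases z) auto
    then show "z \<in> ?l" using F(1) finite_poset_subset[OF V]
      by (cases "x = y") (auto simp: order_polytope_def)
  qed
  ultimately show ?thesis by (simp add: linear_extensions_def)
qed

text \<open>Up to a null set the order polytope is the disjoint union of the cones of its linear
  extensions, and these all have volume 1/n!. Hence counting linear extensions amounts to measuring
  an event of the random point.\<close>

lemma prob_linear_extensions:
  assumes V: "finite_poset V r"
    and Q: "{F \<in> space (lebP V). Q F} \<in> sets (lebP V)"
    and QE: "\<And>F. F \<in> space (lebP V) \<Longrightarrow> inj_on F V \<Longrightarrow> Q F \<longleftrightarrow> {(x, y) \<in> V \<times> V. F x \<le> F y} \<in> E"
  shows "measure_pmf.prob (pmf_of_set (linear_extensions V r)) E =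
    measure (random_point V r) {F \<in> space (lebP V). Q F}"
proof -
  have fin [simp]: "finite V" using V by (simp add: finite_poset_def)
  let ?L = "linear_extensions V r"
  define c :: real where "c = 1 / fact (card V)"
  have c: "c > 0" by (simp add: c_def)
  \<comment> \<open>Proved for arbitrary \<open>Q\<close> and \<open>E\<close>, because the event
    that always holds gives the total volume as the number of linear extensions times
    \<open>c\<close>.\<close>
  have cone: "emeasure (lebP V) (order_polytope V r \<inter> {F \<in> space (lebP V). Q F}) =
    ennreal (real (card (?L \<inter> E)) * c)"
    if Q: "{F \<in> space (lebP V). Q F} \<in> sets (lebP V)" and QE: "\<And>F. F \<in> space (lebP V) \<Longrightarrow> inj_on F V \<Longrightarrow> Q F \<longleftrightarrow> {(x, y) \<in> V \<times> V. F x \<le> F y} \<in> E"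
    for Q E
  proof -
    have finL: "finite (?L \<inter> E)" using finite_linear_extensions[of V r] by simp
    have "emeasure (lebP V) (order_polytope V r \<inter> {F \<in> space (lebP V). Q F}) =
      (\<integral>\<^sup>+F. indicator (order_polytope V r \<inter> {F \<in> space (lebP V). Q F}) F \<partial>lebP V)"
      using Q by simp
    also have "\<dots> = (\<integral>\<^sup>+F. (\<Sum>l\<in>?L \<inter> E. indicator (order_polytope V l) F) \<partial>lebP V)"
    proof (rule nn_integral_cong_AE)
      have "AE F in lebP V. F \<in> space (lebP V) \<and> inj_on F V"
        using AE_lebP_inj[of V] by simp
      then show "AE F in lebP V. indicator (order_polytope V r \<inter> {F \<in> space (lebP V). Q F}) F =
        (\<Sum>l\<in>?L \<inter> E. indicator (order_polytope V l) F :: ennreal)"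
      proof eventually_elim
        case (elim F)
        define lF where "lF = {(x, y) \<in> V \<times> V. F x \<le> F y}"
        show ?case
        proof (cases "F \<in> order_polytope V r \<and> Q F")
          case True
          have lL: "lF \<in> ?L" unfolding lF_def using point_order_extension[OF V] elim True by blast
          have "lF \<in> E" using QE elim True by (simp add: lF_def)
          then have lLE: "lF \<in> ?L \<inter> E" using lL by simp
          have "indicator (order_polytope V l) F = (if l = lF then 1 else 0 :: ennreal)" if "l \<in> ?L \<inter> E" for l
            using linear_extension_cone_iff[OF V _ _, of F l] elim that True
            by (auto simp: lF_def indicator_def order_polytope_def)
          then have "(\<Sum>l\<in>?L \<inter> E. indicator (order_polytope V l) F :: ennreal) =
            (\<Sum>l\<in>?L \<inter> E. if l = lF then 1 else 0)" by (intro sum.cong) auto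
          also have "\<dots> = 1" using lLE finL by simp
          finally show ?thesis using True elim by simp
        next
          case False
          have "F \<notin> order_polytope V l" if "l \<in> ?L \<inter> E" for l
          proof
            assume F: "F \<in> order_polytope V l"
            then have "l = lF" using linear_extension_cone_iff[OF V _ _, of F l] elim that
              by (auto simp: lF_def)
            then have "Q F" using QE[of F] elim that by (simp add: lF_def)
            moreover have "F \<in> order_polytope V r"
              using F that by (auto simp: order_polytope_def linear_extensions_def)
            ultimately show False using False by simp
          qed
          then have "(\<Sum>l\<in>?L \<inter> E. indicator (order_polytope V l) F :: ennreal) = 0"
            by (intro sum.neutral) auto
          then show ?thesis using False by auto
        qed
      qed
    qed
    also have "\<dots> = (\<Sum>l\<in>?L \<inter> E. (\<integral>\<^sup>+F. indicator (order_polytope V l) F \<partial>lebP V))"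
      by (intro nn_integral_sum) auto
    also have "\<dots> = (\<Sum>l\<in>?L \<inter> E. ennreal c)"
      using emeasure_linear_cone[of V]
      by (intro sum.cong) (auto simp: linear_extensions_def c_def)
    also have "\<dots> = ennreal (real (card (?L \<inter> E)) * c)"
      using c by (subst sum_ennreal) auto
    finally show ?thesis .
  qed
  have "{F \<in> space (lebP V). True} \<in> sets (lebP V)" by simp
  from cone[OF this, of UNIV]
  have tot: "emeasure (lebP V) (order_polytope V r) = ennreal (real (card ?L) * c)"
    using sets.sets_into_space[OF sets_order_polytope[OF fin, of r]] by (simp add: Int_absorb2)
  have ne: "?L \<noteq> {}"
    using tot emeasure_order_polytope_pos[OF V] by auto
  have cL: "card ?L > 0" using ne finite_linear_extensions[OF fin, of r] by (simp add: card_gt_0_iff)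
  have "emeasure (random_point V r) {F \<in> space (lebP V). Q F} =
    ennreal (real (card (?L \<inter> E)) * c) / ennreal (real (card ?L) * c)"
    unfolding random_point_def using Q cone[OF Q QE] tot
    by (subst emeasure_uniform_measure) auto
  also have "\<dots> = ennreal (real (card (?L \<inter> E)) / real (card ?L))"
    using c cL by (subst divide_ennreal) auto
  finally have "measure (random_point V r) {F \<in> space (lebP V). Q F} =
    real (card (?L \<inter> E)) / real (card ?L)"
    by (simp add: measure_def)
  moreover have "measure_pmf.prob (pmf_of_set ?L) E = real (card (?L \<inter> E)) / real (card ?L)"
    using ne finite_linear_extensions[OF fin, of r] by (rule measure_pmf_of_set)
  ultimately show ?thesis by simp
qed

text \<open>Almost every point of the polytope has distinct coordinates, whose order is a linear
  extension; without extensions the random point would almost surely satisfy a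
  contradiction.\<close>

lemma linear_extensions_nonempty:
  assumes "finite_poset V r"
  shows "linear_extensions V r \<noteq> {}"
proof
  assume "linear_extensions V r = {}"
  moreover have "AE F in random_point V r. False" if "linear_extensions V r = {}"
    using AE_random_point_in[OF assms] AE_random_point_lebP[OF assms AE_lebP_inj[OF finite_poset_finite[OF assms]]]
      AE_space
  proof eventually_elim
    case (elim F)
    then show ?case using point_order_extension[OF assms] that by blast
  qed
  ultimately show False
    using prob_space.AE_False[OF prob_space_random_point[OF assms]] by blast
qed

lemma sets_sorted_wrt_less [measurable]:
  assumes "set xs \<subseteq> V"
  shows "{F \<in> space (lebP V). sorted_wrt (\<lambda>x y. F x < F y) xs} \<in> sets (lebP V)"
  using assms
proof (induction xs)
  case (Cons x xs)
  have "{F \<in> space (lebP V). F x < F y} \<in> sets (lebP V)" if "y \<in> set xs" for y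
  proof -
    have "x \<in> V" "y \<in> V" using Cons.prems that by auto
    then show ?thesis by measurable
  qed
  then have "{F \<in> space (lebP V). \<forall>y\<in>set xs. F x < F y} \<in> sets (lebP V)"
    by (intro sets.sets_Collect_finite_All) auto
  then show ?case using Cons by (auto intro!: sets.sets_Collect_conj)
qed simp

lemma order_prob_eq:
  assumes V: "finite_poset V r" and xs: "set xs \<subseteq> V"
  shows "order_prob V r xs =
    measure (random_point V r) {F \<in> space (lebP V). sorted_wrt (\<lambda>x y. F x < F y) xs}"
  unfolding order_prob_def
proof (rule prob_linear_extensions[OF V sets_sorted_wrt_less[OF xs]])
  fix F :: "'a \<Rightarrow> real" assume F: "inj_on F V"
  let ?l = "{(x, y) \<in> V \<times> V. F x \<le> F y}"
  have "F x < F y \<longleftrightarrow> (x, y) \<in> ?l \<and> x \<noteq> y" if "x \<in> V" "y \<in> V" for x y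
    using that F by (auto simp: less_le dest: inj_onD)
  then have "sorted_wrt (\<lambda>x y. F x < F y) xs \<longleftrightarrow> sorted_wrt (\<lambda>x y. (x, y) \<in> ?l \<and> x \<noteq> y) xs"
    using xs by (intro iffI) (erule sorted_wrt_mono_rel[rotated], blast)+
  then show "sorted_wrt (\<lambda>x y. F x < F y) xs \<longleftrightarrow>
      ?l \<in> {l. sorted_wrt (\<lambda>x y. (x, y) \<in> l \<and> x \<noteq> y) xs}" by simp
qed

section \<open>Moments and tails of Beta distributions\<close>

lemma integrable_beta_distr:
  assumes [measurable]: "f \<in> borel_measurable borel" and "\<And>s. s \<in> {0..1} \<Longrightarrow> \<bar>f s\<bar> \<le> B"
  shows "integrable (beta_distr a b) (f :: real \<Rightarrow> real)"
proof -
  interpret prob_space "beta_distr a b" by (rule prob_space_beta_distr)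
  have "AE s in beta_distr a b. norm (f s) \<le> B"
    using AE_beta_distr by eventually_elim (use assms(2) in auto)
  then show ?thesis by (intro integrable_const_bound) auto
qed

text \<open>The variance is A (N - A) / (N^2 (N + 1)), and A (N - A) is at most N^2 / 4.\<close>

lemma beta_distr_variance_le:
  fixes a b :: nat
  defines "A \<equiv> real a + 1" and "N \<equiv> real a + real b + 2"
  shows "integral\<^sup>L (beta_distr a b) (\<lambda>s. (s - A / N)\<^sup>2) \<le> 1 / (4 * N)"
    and "integral\<^sup>L (beta_distr a b) (\<lambda>s. s\<^sup>2) \<le> 1 / (4 * N) + (A / N)\<^sup>2"
proof -
  interpret prob_space "beta_distr a b" by (rule prob_space_beta_distr)
  have A: "A \<ge> 1" "N \<ge> A + 1" by (auto simp: A_def N_def)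
  have m1: "integral\<^sup>L (beta_distr a b) (\<lambda>s. s) = A / N"
    by (simp add: beta_distr_mean A_def N_def)
  have m2: "integral\<^sup>L (beta_distr a b) (\<lambda>s. s\<^sup>2) = A * (A + 1) / (N * (N + 1))"
    by (simp add: beta_distr_second_moment A_def N_def add_ac)
  have i1: "integrable (beta_distr a b) (\<lambda>s. s)"
    by (rule integrable_beta_distr[of _ 1]) auto
  have i2: "integrable (beta_distr a b) (\<lambda>s. s\<^sup>2)"
    by (rule integrable_beta_distr[of _ 1]) (auto simp: power_le_one)
  have "A * (A + 1) / (N * (N + 1)) - (A / N)\<^sup>2 = A * (N - A) / (N\<^sup>2 * (N + 1))"
    using A by (simp add: divide_simps power2_eq_square) (simp add: algebra_simps)
  also have "\<dots> \<le> (N\<^sup>2 / 4) / (N\<^sup>2 * (N + 1))"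
  proof (rule divide_right_mono)
    have "0 \<le> (N - 2 * A)\<^sup>2" by simp
    then show "A * (N - A) \<le> N\<^sup>2 / 4" by (simp add: power2_eq_square algebra_simps)
  qed (use A in simp)
  also have "\<dots> = 1 / (4 * (N + 1))" using A by simp
  also have "\<dots> \<le> 1 / (4 * N)" using A by (simp add: frac_le)
  finally have v: "A * (A + 1) / (N * (N + 1)) - (A / N)\<^sup>2 \<le> 1 / (4 * N)" .
  then show "integral\<^sup>L (beta_distr a b) (\<lambda>s. s\<^sup>2) \<le> 1 / (4 * N) + (A / N)\<^sup>2"
    using m2 by simp
  have "integral\<^sup>L (beta_distr a b) (\<lambda>s. (s - A / N)\<^sup>2) =
    integral\<^sup>L (beta_distr a b) (\<lambda>s. s\<^sup>2 - 2 * (A / N) * s + (A / N)\<^sup>2)"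
    by (intro Bochner_Integration.integral_cong) (auto simp: power2_eq_square algebra_simps)
  also have "\<dots> = A * (A + 1) / (N * (N + 1)) - (A / N)\<^sup>2"
    using i1 i2 m1 m2 prob_space by (simp add: power2_eq_square)
  finally show "integral\<^sup>L (beta_distr a b) (\<lambda>s. (s - A / N)\<^sup>2) \<le> 1 / (4 * N)" using v by simp
qed

text \<open>Here \<open>t0\<close> is the mode, and \<open>R\<close> in the proof is the logarithm
  of the density ratio. Both bounds come from \<open>ln u \<le> u - 1\<close>: applied to t/t0 and
  (1 - t)/(1 - t0), the linear terms cancel at the mode; applied to the reciprocals, it leaves the
  quadratic loss (a + b) (t - t0)^2 / (t (1 - t)).\<close>

lemma beta_dens_ratio:
  fixes t t0 :: real
  assumes "a \<ge> 1" "b \<ge> 1" and t0: "t0 = real a / (real a + real b)" and t: "0 < t" "t < 1"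
  shows "t ^ a * (1 - t) ^ b \<le> t0 ^ a * (1 - t0) ^ b"
    and "t ^ a * (1 - t) ^ b \<ge>
      t0 ^ a * (1 - t0) ^ b * exp (- ((real a + real b) * (t - t0)\<^sup>2 / (t * (1 - t))))"
proof -
  have ab: "real a > 0" "real b > 0" using assms by auto
  have t0': "0 < t0" "t0 < 1" using ab by (auto simp: t0)
  have q: "real a * (1 - t0) = real b * t0"
    using ab by (simp add: t0 field_simps)
  define R where "R = real a * ln (t / t0) + real b * ln ((1 - t) / (1 - t0))"
  have R: "t ^ a * (1 - t) ^ b = t0 ^ a * (1 - t0) ^ b * exp R"
  proof -
    have "exp R = (t / t0) ^ a * ((1 - t) / (1 - t0)) ^ b"
      using t t0' by (simp add: R_def exp_add exp_of_nat_mult)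
    then show ?thesis using t0' by (simp add: power_divide)
  qed
  have "R \<le> real a * (t / t0 - 1) + real b * ((1 - t) / (1 - t0) - 1)"
    unfolding R_def using t t0' ab
    by (intro add_mono mult_left_mono ln_le_minus_one) auto
  also have "\<dots> = (t - t0) * (real a * (1 - t0) - real b * t0) / (t0 * (1 - t0))"
    using t0' by (simp add: field_simps)
  also have "\<dots> = 0" using q by simp
  finally have "R \<le> 0" .
  then have "exp R \<le> 1" by simp
  then show "t ^ a * (1 - t) ^ b \<le> t0 ^ a * (1 - t0) ^ b"
    unfolding R using t0' by (intro mult_left_le) auto
  have "- R = real a * ln (t0 / t) + real b * ln ((1 - t0) / (1 - t))"
    using t t0' by (simp add: R_def ln_div algebra_simps)
  also have "\<dots> \<le> real a * (t0 / t - 1) + real b * ((1 - t0) / (1 - t) - 1)"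
    using t t0' ab by (intro add_mono mult_left_mono ln_le_minus_one) auto
  also have "\<dots> = (t - t0) * ((real a + real b) * t - real a) / (t * (1 - t))"
    using t by (simp add: field_simps)
  also have "(real a + real b) * t - real a = (real a + real b) * (t - t0)"
    using ab by (simp add: t0 field_simps)
  also have "(t - t0) * ((real a + real b) * (t - t0)) = (real a + real b) * (t - t0)\<^sup>2"
    by (simp add: power2_eq_square)
  finally have "R \<ge> - ((real a + real b) * (t - t0)\<^sup>2 / (t * (1 - t)))" by simp
  then show "t ^ a * (1 - t) ^ b \<ge>
      t0 ^ a * (1 - t0) ^ b * exp (- ((real a + real b) * (t - t0)\<^sup>2 / (t * (1 - t))))"
    unfolding R using t0' by (intro mult_left_mono) auto
qed

lemma measure_beta_distr:
  assumes [measurable]: "S \<in> sets borel"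
  shows "emeasure (beta_distr a b) S =
    (\<integral>\<^sup>+s. ennreal (beta_dens a b s / beta_norm a b) * indicator S s \<partial>lborel)"
  unfolding beta_distr_def by (intro emeasure_density) auto

text \<open>The mode of the density is large by Chebyshev's inequality, and the density decays at
  Gaussian speed away from it; no asymptotic evaluation of the norming constant is needed.\<close>

lemma beta_distr_tail:
  fixes C :: real and a b :: nat
  defines "A \<equiv> real a + 1" and "N \<equiv> real a + real b + 2"
  assumes C: "C \<ge> 0" and AN: "2 * A \<le> N" "N \<le> 4 * A" and big: "16 * (C + 1)\<^sup>2 \<le> A"
  shows "measure (beta_distr a b) {s. A / N + C / sqrt A \<le> s} \<ge> 3 / 8 * exp (- 64 * (C + 2)\<^sup>2)"
proof -
  interpret prob_space "beta_distr a b" by (rule prob_space_beta_distr)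
  define t0 where "t0 = real a / (real a + real b)"
  define m where "m = A / N"
  define f0 where "f0 = t0 ^ a * (1 - t0) ^ b / beta_norm a b"
  have "16 * 1 \<le> 16 * (C + 1)\<^sup>2" using C by (intro mult_left_mono) auto
  then have A16: "A \<ge> 16" using big by simp
  then have N32: "N \<ge> 32" using AN by simp
  have ab: "a \<ge> 1" "b \<ge> a" "b \<ge> 1"
    using A16 AN by (auto simp: A_def N_def)
  have sqA: "4 * (C + 1) \<le> sqrt A"
  proof (rule real_le_rsqrt)
    have "(4 * (C + 1))\<^sup>2 = 16 * (C + 1)\<^sup>2" by (simp only: power_mult_distrib) simp
    then show "(4 * (C + 1))\<^sup>2 \<le> A" using big by simp
  qed
  have sqA0: "sqrt A > 0" using A16 by simp
  have sqN0: "sqrt N > 0" using N32 by simp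
  have m: "1 / 4 \<le> m" "m \<le> 1 / 2"
    using AN A16 N32 by (auto simp: m_def field_simps)
  have t0: "0 < t0" "t0 < 1" using ab by (auto simp: t0_def)
  have f0: "f0 > 0" unfolding f0_def using t0 beta_norm_pos[of a b] by auto
  have mode: "beta_dens a b s / beta_norm a b \<le> f0" for s
  proof (cases "0 < s \<and> s < 1")
    case True
    then show ?thesis
      using beta_dens_ratio(1)[OF ab(1,3) t0_def, of s] beta_norm_pos[of a b]
      by (auto simp: beta_dens_def f0_def intro!: divide_right_mono)
  next
    case False
    then have "beta_dens a b s = 0" using ab by (auto simp: beta_dens_def indicator_def)
    then show ?thesis using f0 by simp
  qed
  \<comment> \<open>Mean and mode differ by at most 1/N, so distances from the mode can be measured
    from the mean at the cost of one unit 1/sqrt A; this turns C + 1 into C + 2 in the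
    exponent.\<close>
  have mt0: "\<bar>m - t0\<bar> \<le> 1 / sqrt A"
  proof -
    have "m - t0 = (real b - real a) / ((real a + real b) * N)"
      using ab by (simp add: m_def t0_def A_def N_def divide_simps) (simp add: algebra_simps)
    moreover have "0 \<le> (real b - real a) / ((real a + real b) * N)"
      using ab N32 by simp
    moreover have "(real b - real a) / ((real a + real b) * N) \<le> 1 / N"
      using ab N32 by (simp add: divide_simps mult_right_mono)
    moreover have "1 / N \<le> 1 / sqrt A"
    proof (rule frac_le)
      have "sqrt A \<le> A" using A16 by (simp add: real_sqrt_le_iff' real_le_lsqrt power2_eq_square)
      then show "sqrt A \<le> N" using AN A16 by simp
    qed (use sqA0 in auto)
    ultimately show ?thesis by linarith
  qed
  have peak: "f0 \<ge> 3 / 8 * sqrt N"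
  proof -
    have i2: "integrable (beta_distr a b) (\<lambda>s. (s - m)\<^sup>2)"
    proof (rule integrable_beta_distr[of _ 1])
      fix s :: real assume "s \<in> {0..1}"
      then have "\<bar>s - m\<bar> \<le> 1" using m by auto
      then show "\<bar>(s - m)\<^sup>2\<bar> \<le> 1" by (simp add: abs_square_le_1)
    qed auto
    have "prob {s. \<not> \<bar>s - m\<bar> \<le> 1 / sqrt N} \<le> 1 / 4"
    proof -
      have ind: "indicator {s. \<not> \<bar>s - m\<bar> \<le> 1 / sqrt N} s \<le> N * (s - m)\<^sup>2" for s :: real
      proof (cases "\<bar>s - m\<bar> \<le> 1 / sqrt N")
        case False
        then have "(1 / sqrt N)\<^sup>2 \<le> \<bar>s - m\<bar>\<^sup>2" using sqN0 by (intro power_mono) auto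
        then show ?thesis using N32 False by (simp add: field_simps)
      qed (use N32 in simp)
      have "prob {s. \<not> \<bar>s - m\<bar> \<le> 1 / sqrt N} =
        integral\<^sup>L (beta_distr a b) (indicator {s. \<not> \<bar>s - m\<bar> \<le> 1 / sqrt N})"
        by simp
      also have "\<dots> \<le> integral\<^sup>L (beta_distr a b) (\<lambda>s. N * (s - m)\<^sup>2)"
        using i2 ind by (intro integral_mono) (auto intro!: integrable_beta_distr[of _ 1] simp: indicator_def)
      also have "\<dots> \<le> N * (1 / (4 * N))"
      proof -
        have "integral\<^sup>L (beta_distr a b) (\<lambda>s. (s - m)\<^sup>2) \<le> 1 / (4 * N)"
          using beta_distr_variance_le(1)[of a b] unfolding m_def A_def N_def .
        then have "N * integral\<^sup>L (beta_distr a b) (\<lambda>s. (s - m)\<^sup>2) \<le> N * (1 / (4 * N))"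
          using N32 by (intro mult_left_mono) auto
        then show ?thesis by simp
      qed
      finally show ?thesis using N32 by simp
    qed
    moreover have "prob {s. \<not> \<bar>s - m\<bar> \<le> 1 / sqrt N} = 1 - prob {s. \<bar>s - m\<bar> \<le> 1 / sqrt N}"
      by (subst prob_compl[symmetric]) (auto intro!: arg_cong[of _ _ prob])
    ultimately have "3 / 4 \<le> prob {s. \<bar>s - m\<bar> \<le> 1 / sqrt N}" by simp
    also have "{s. \<bar>s - m\<bar> \<le> 1 / sqrt N} = {m - 1 / sqrt N .. m + 1 / sqrt N}"
      by (auto simp: abs_le_iff)
    finally have 1: "ennreal (3 / 4) \<le> emeasure (beta_distr a b) {m - 1 / sqrt N .. m + 1 / sqrt N}"
      by (simp add: emeasure_eq_measure)
    also have "\<dots> \<le> (\<integral>\<^sup>+s. ennreal f0 * indicator {m - 1 / sqrt N .. m + 1 / sqrt N} s \<partial>lborel)"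
      by (subst measure_beta_distr) (auto intro!: nn_integral_mono mult_right_mono ennreal_leI mode)
    also have "\<dots> = ennreal f0 * ennreal (2 / sqrt N)"
      using sqN0 by (simp add: nn_integral_cmult_indicator)
    also have "\<dots> = ennreal (f0 * (2 / sqrt N))"
      using f0 sqN0 by (intro ennreal_mult[symmetric]) auto
    finally have "3 / 4 \<le> f0 * (2 / sqrt N)"
      using f0 sqN0 by (simp add: ennreal_le_iff)
    then show ?thesis using sqN0 by (simp add: field_simps)
  qed
  \<comment> \<open>The mass is collected on the window from \<open>lo\<close> to \<open>hi\<close>,
    of length 1/sqrt A. There |t - t0| is at most (C + 2)/sqrt A and t (1 - t) is at least 1/16, and
    a + b is at most 4 A, so the quadratic loss is at most 64 (C + 2)^2.\<close>
  define E where "E = exp (- 64 * (C + 2)\<^sup>2)"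
  define lo where "lo = m + C / sqrt A"
  define hi where "hi = m + (C + 1) / sqrt A"
  have lohi: "hi - lo = 1 / sqrt A" by (simp add: hi_def lo_def add_divide_distrib)
  have low: "f0 * E \<le> beta_dens a b t / beta_norm a b" if t: "t \<in> {lo..hi}" for t
  proof -
    have "(C + 1) / sqrt A \<le> 1 / 4" using sqA sqA0 by (simp add: field_simps)
    moreover have "0 \<le> C / sqrt A" using C sqA0 by simp
    moreover have "m + C / sqrt A \<le> t" "t \<le> m + (C + 1) / sqrt A" using t by (auto simp: lo_def hi_def)
    ultimately have t1: "1 / 4 \<le> t" "t \<le> 3 / 4" using m by linarith+
    have "(1 / 4) * (1 / 4) \<le> t * (1 - t)" using t1 by (intro mult_mono) auto
    then have tt: "1 / 16 \<le> t * (1 - t)" by simp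
    have "0 \<le> C / sqrt A" using C sqA0 by simp
    then have "\<bar>t - m\<bar> \<le> (C + 1) / sqrt A" using t by (auto simp: lo_def hi_def)
    then have "\<bar>t - t0\<bar> \<le> (C + 2) / sqrt A"
      using mt0 by (simp add: add_divide_distrib)
    then have "\<bar>t - t0\<bar>\<^sup>2 \<le> ((C + 2) / sqrt A)\<^sup>2" by (intro power_mono) auto
    then have d2: "(t - t0)\<^sup>2 \<le> (C + 2)\<^sup>2 / A" using A16 by (simp add: power_divide)
    have "(real a + real b) * (t - t0)\<^sup>2 \<le> (4 * A) * ((C + 2)\<^sup>2 / A)"
      using d2 AN A16 by (intro mult_mono) (auto simp: N_def)
    then have n2: "(real a + real b) * (t - t0)\<^sup>2 \<le> 4 * (C + 2)\<^sup>2" using A16 by simp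
    have "(real a + real b) * (t - t0)\<^sup>2 / (t * (1 - t)) \<le> 4 * (C + 2)\<^sup>2 / (1 / 16)"
      using n2 tt by (intro frac_le) auto
    then have ex: "E \<le> exp (- ((real a + real b) * (t - t0)\<^sup>2 / (t * (1 - t))))"
      unfolding E_def by simp
    have "t0 ^ a * (1 - t0) ^ b * E \<le> t ^ a * (1 - t) ^ b"
      using beta_dens_ratio(2)[OF ab(1,3) t0_def, of t] t1 ex t0
      by (auto intro: order_trans[OF mult_left_mono])
    then show ?thesis
      using t1 beta_norm_pos[of a b] by (simp add: f0_def beta_dens_def field_simps)
  qed
  have E0: "E > 0" by (simp add: E_def)
  have "ennreal (f0 * E * (1 / sqrt A)) = (\<integral>\<^sup>+t. ennreal (f0 * E) * indicator {lo..hi} t \<partial>lborel)"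
    using f0 E0 sqA0 lohi by (simp add: nn_integral_cmult_indicator ennreal_mult[symmetric] add_divide_distrib lo_def hi_def divide_right_mono)
  also have "\<dots> \<le> (\<integral>\<^sup>+t. ennreal (beta_dens a b t / beta_norm a b) * indicator {lo..hi} t \<partial>lborel)"
    using low by (intro nn_integral_mono) (auto simp: indicator_def intro!: ennreal_leI)
  also have "\<dots> = emeasure (beta_distr a b) {lo..hi}" by (simp add: measure_beta_distr)
  also have "\<dots> = ennreal (prob {lo..hi})" by (simp add: emeasure_eq_measure)
  finally have "f0 * E * (1 / sqrt A) \<le> prob {lo..hi}" by simp
  also have "\<dots> \<le> prob {s. m + C / sqrt A \<le> s}"
    by (intro finite_measure_mono) (auto simp: lo_def)
  finally have fin: "f0 * E * (1 / sqrt A) \<le> prob {s. m + C / sqrt A \<le> s}" .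
  have "3 / 8 * E * 1 \<le> 3 / 8 * E * (sqrt N / sqrt A)"
    using AN A16 sqA0 E0 by (intro mult_left_mono) auto
  also have "\<dots> = (3 / 8 * sqrt N) * E * (1 / sqrt A)" by simp
  also have "\<dots> \<le> f0 * E * (1 / sqrt A)"
    using peak E0 sqA0 by (intro mult_right_mono) auto
  finally have "3 / 8 * E \<le> f0 * E * (1 / sqrt A)" by simp
  then have "3 / 8 * E \<le> prob {s. m + C / sqrt A \<le> s}" using fin by (rule order_trans)
  then show ?thesis unfolding E_def m_def .
qed

section \<open>Laws on the unit interval\<close>

lemma Fubini_bounded:
  fixes f :: "'a \<Rightarrow> 'b \<Rightarrow> real"
  assumes M: "prob_space M" and N: "prob_space N"
    and f: "case_prod f \<in> borel_measurable (M \<Otimes>\<^sub>M N)" and B: "\<And>x y. \<bar>f x y\<bar> \<le> B"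
  shows "(\<integral>x. (\<integral>y. f x y \<partial>N) \<partial>M) = (\<integral>y. (\<integral>x. f x y \<partial>M) \<partial>N)"
proof -
  interpret M: prob_space M by fact
  interpret N: prob_space N by fact
  interpret MN: pair_prob_space M N ..
  have "integrable (M \<Otimes>\<^sub>M N) (case_prod f)"
    using f B by (intro MN.integrable_const_bound[of _ B]) auto
  then show ?thesis by (rule MN.Fubini_integral[symmetric])
qed

text \<open>Freedom from atoms belongs to the notion because it makes ties between independent
  points null. The moments 1/2 and 1/3 in \<open>cdf_moments\<close> depend on it; an atom would
  lower both.\<close>

definition unit_law :: "real measure \<Rightarrow> bool" where
  "unit_law N \<longleftrightarrow> prob_space N \<and> sets N = sets borel \<and> (AE x in N. 0 \<le> x \<and> x \<le> 1) \<and>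
     (\<forall>c. AE x in N. x \<noteq> c)"

definition mean :: "real measure \<Rightarrow> real" where
  "mean N = integral\<^sup>L N (\<lambda>x. x)"

definition var :: "real measure \<Rightarrow> real" where
  "var N = integral\<^sup>L N (\<lambda>x. (x - mean N)\<^sup>2)"

lemma unit_lawD:
  assumes "unit_law N"
  shows "prob_space N" "sets N = sets borel" "AE x in N. 0 \<le> x \<and> x \<le> 1" "AE x in N. x \<noteq> c"
    "space N = UNIV"
  using assms sets_eq_imp_space_eq[of N borel] by (auto simp: unit_law_def)

lemma unit_law_integrable:
  fixes f :: "real \<Rightarrow> real"
  assumes N: "unit_law N" and f: "f \<in> borel_measurable borel" and B: "\<And>x. x \<in> {0..1} \<Longrightarrow> \<bar>f x\<bar> \<le> B"
  shows "integrable N f"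
proof -
  interpret prob_space N by (rule unit_lawD(1)[OF N])
  have "AE x in N. norm (f x) \<le> B"
    using unit_lawD(3)[OF N] by eventually_elim (use B in auto)
  moreover have "f \<in> borel_measurable N"
    using f by (simp add: measurable_cong_sets[OF unit_lawD(2)[OF N] refl])
  ultimately show ?thesis by (intro integrable_const_bound) auto
qed

lemma unit_law_integral_mono:
  fixes f g :: "real \<Rightarrow> real"
  assumes N: "unit_law N" and "integrable N f" "integrable N g" and le: "\<And>x. x \<in> {0..1} \<Longrightarrow> f x \<le> g x"
  shows "integral\<^sup>L N f \<le> integral\<^sup>L N g"
proof (rule integral_mono_AE)
  show "AE x in N. f x \<le> g x"
    using unit_lawD(3)[OF N] by eventually_elim (use le in auto)
qed fact+

lemma mean_bounds:
  assumes N: "unit_law N"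
  shows "0 \<le> mean N" "mean N \<le> 1"
proof -
  interpret prob_space N by (rule unit_lawD(1)[OF N])
  have i: "integrable N (\<lambda>x. x)" by (rule unit_law_integrable[OF N, of _ 1]) auto
  show "0 \<le> mean N" unfolding mean_def
    using unit_lawD(3)[OF N] by (intro integral_nonneg_AE) auto
  have "mean N \<le> integral\<^sup>L N (\<lambda>x. 1)" unfolding mean_def
    using i by (intro unit_law_integral_mono[OF N]) auto
  then show "mean N \<le> 1" by (simp add: prob_space)
qed

lemma var_nonneg: "0 \<le> var N"
  unfolding var_def by (rule Bochner_Integration.integral_nonneg) simp

lemma integrable_var:
  assumes N: "unit_law N"
  shows "integrable N (\<lambda>x. (x - c)\<^sup>2)"
proof (rule unit_law_integrable[OF N, of _ "(1 + \<bar>c\<bar>)\<^sup>2"])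
  fix x :: real assume "x \<in> {0..1}"
  then have "\<bar>x - c\<bar>\<^sup>2 \<le> (1 + \<bar>c\<bar>)\<^sup>2" by (intro power_mono) auto
  then show "\<bar>(x - c)\<^sup>2\<bar> \<le> (1 + \<bar>c\<bar>)\<^sup>2" by simp
qed auto

lemma var_decomp:
  assumes N: "unit_law N"
  shows "integral\<^sup>L N (\<lambda>x. (x - c)\<^sup>2) = var N + (mean N - c)\<^sup>2"
proof -
  interpret prob_space N by (rule unit_lawD(1)[OF N])
  have i: "integrable N (\<lambda>x. x)" by (rule unit_law_integrable[OF N, of _ 1]) auto
  have "integral\<^sup>L N (\<lambda>x. (x - c)\<^sup>2) =
    integral\<^sup>L N (\<lambda>x. (x - mean N)\<^sup>2 + 2 * (mean N - c) * x - 2 * (mean N - c) * mean N + (mean N - c)\<^sup>2)"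
    by (intro Bochner_Integration.integral_cong) (auto simp: power2_eq_square algebra_simps)
  also have "\<dots> = var N + 2 * (mean N - c) * mean N - 2 * (mean N - c) * mean N + (mean N - c)\<^sup>2"
    using i integrable_var[OF N] by (simp add: var_def prob_space mean_def)
  finally show ?thesis by simp
qed

lemma unit_law_beta_distr: "unit_law (beta_distr a b)"
proof -
  have "AE x in beta_distr a b. 0 \<le> x \<and> x \<le> 1"
    using AE_beta_distr by eventually_elim auto
  then show ?thesis
    using prob_space_beta_distr AE_beta_distr_neq by (simp add: unit_law_def)
qed

lemma mean_beta_distr: "mean (beta_distr a b) = (real a + 1) / (real a + real b + 2)"
  by (simp add: mean_def beta_distr_mean)

lemma var_beta_distr: "var (beta_distr a b) \<le> 1 / (4 * (real a + real b + 2))"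
  unfolding var_def mean_beta_distr using beta_distr_variance_le(1)[of a b] by simp

text \<open>The effect of one tower level on the law of a site: \<open>a\<close> is the number of
  points of the reversed poset, \<open>b\<close> the length of the chain put on top,
  \<open>fst z\<close> the value of the separating point and \<open>1 - snd z\<close> the position
  of the site after reversal.\<close>

definition step_law :: "nat \<Rightarrow> nat \<Rightarrow> real measure \<Rightarrow> real measure" where
  "step_law a b N = distr (beta_distr a b \<Otimes>\<^sub>M N) borel (\<lambda>z. fst z * (1 - snd z))"

lemma sets_step_law [simp]: "sets (step_law a b N) = sets borel"
  by (simp add: step_law_def)

lemma step_law_measurable:
  assumes "sets N = sets borel"
  shows "(\<lambda>z. fst z * (1 - snd z)) \<in> borel_measurable (beta_distr a b \<Otimes>\<^sub>M N)"
proof -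
  note [measurable_cong] = assms
  show ?thesis by measurable
qed

lemma AE_step_pair:
  assumes N: "unit_law N"
  shows "AE z in beta_distr a b \<Otimes>\<^sub>M N. 0 < fst z \<and> fst z < 1 \<and> 0 \<le> snd z \<and> snd z \<le> 1"
proof -
  note [measurable_cong] = unit_lawD(2)[OF N]
  interpret B: prob_space "beta_distr a b" by (rule prob_space_beta_distr)
  interpret N: prob_space N by (rule unit_lawD(1)[OF N])
  interpret BN: pair_prob_space "beta_distr a b" N ..
  show ?thesis
  proof (rule BN.AE_pair_measure)
    show "AE x in beta_distr a b. AE y in N. 0 < fst (x, y) \<and> fst (x, y) < 1 \<and> 0 \<le> snd (x, y) \<and> snd (x, y) \<le> 1"
      using AE_beta_distr
    proof eventually_elim
      case (elim x)
      show ?case using unit_lawD(3)[OF N] by eventually_elim (use elim in auto)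
    qed
  qed measurable
qed

lemma unit_law_step:
  assumes N: "unit_law N"
  shows "unit_law (step_law a b N)"
proof -
  note [measurable_cong] = unit_lawD(2)[OF N]
  interpret B: prob_space "beta_distr a b" by (rule prob_space_beta_distr)
  interpret N: prob_space N by (rule unit_lawD(1)[OF N])
  interpret BN: pair_prob_space "beta_distr a b" N ..
  note m = step_law_measurable[OF unit_lawD(2)[OF N], of a b]
  have "prob_space (step_law a b N)"
    unfolding step_law_def using m by (rule BN.prob_space_distr)
  moreover have "AE x in step_law a b N. 0 \<le> x \<and> x \<le> 1"
    unfolding step_law_def
  proof (subst AE_distr_iff[OF m])
    show "AE z in beta_distr a b \<Otimes>\<^sub>M N. 0 \<le> fst z * (1 - snd z) \<and> fst z * (1 - snd z) \<le> 1"
      using AE_step_pair[OF N] by eventually_elim (auto intro: mult_le_one)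
  qed auto
  moreover have "AE x in step_law a b N. x \<noteq> c" for c
    unfolding step_law_def
  proof (subst AE_distr_iff[OF m])
    show "AE z in beta_distr a b \<Otimes>\<^sub>M N. fst z * (1 - snd z) \<noteq> c"
    proof (rule BN.AE_pair_measure)
      show "AE x in beta_distr a b. AE y in N. fst (x, y) * (1 - snd (x, y)) \<noteq> c"
        using AE_beta_distr
      proof eventually_elim
        case (elim x)
        show ?case using unit_lawD(4)[OF N, of "1 - c / x"] by eventually_elim (use elim in auto)
      qed
    qed measurable
  qed auto
  ultimately show ?thesis by (simp add: unit_law_def)
qed

lemma step_law_integral:
  fixes f :: "real \<Rightarrow> real"
  assumes N: "unit_law N" and f: "f \<in> borel_measurable borel" and B: "\<And>x. x \<in> {0..1} \<Longrightarrow> \<bar>f x\<bar> \<le> C"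
  shows "integral\<^sup>L (step_law a b N) f = (\<integral>s. (\<integral>x. f (s * (1 - x)) \<partial>N) \<partial>beta_distr a b)"
proof -
  interpret B: prob_space "beta_distr a b" by (rule prob_space_beta_distr)
  interpret N: prob_space N by (rule unit_lawD(1)[OF N])
  interpret BN: pair_prob_space "beta_distr a b" N ..
  note m = step_law_measurable[OF unit_lawD(2)[OF N], of a b]
  have fm: "(\<lambda>z. f (fst z * (1 - snd z))) \<in> borel_measurable (beta_distr a b \<Otimes>\<^sub>M N)"
    using measurable_compose[OF m f] .
  have "integral\<^sup>L (step_law a b N) f = integral\<^sup>L (beta_distr a b \<Otimes>\<^sub>M N) (\<lambda>z. f (fst z * (1 - snd z)))"
    unfolding step_law_def by (rule integral_distr[OF m f])
  also have "\<dots> = (\<integral>s. (\<integral>x. f (fst (s, x) * (1 - snd (s, x))) \<partial>N) \<partial>beta_distr a b)"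
  proof (rule BN.integral_fst'[symmetric])
    have "AE z in beta_distr a b \<Otimes>\<^sub>M N. norm (f (fst z * (1 - snd z))) \<le> C"
      using AE_step_pair[OF N]
    proof eventually_elim
      case (elim z)
      then have "fst z * (1 - snd z) \<in> {0..1}" by (auto intro: mult_le_one)
      then show ?case using B by simp
    qed
    then show "integrable (beta_distr a b \<Otimes>\<^sub>M N) (\<lambda>z. f (fst z * (1 - snd z)))"
      using fm by (rule BN.integrable_const_bound)
  qed
  finally show ?thesis by simp
qed

section \<open>Mean and variance after one level\<close>

lemma mean_step_law:
  assumes N: "unit_law N"
  shows "mean (step_law a b N) = (real a + 1) / (real a + real b + 2) * (1 - mean N)"
proof -
  interpret N: prob_space N by (rule unit_lawD(1)[OF N])
  have i: "integrable N (\<lambda>x. x)" by (rule unit_law_integrable[OF N, of _ 1]) auto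
  have "mean (step_law a b N) = (\<integral>s. (\<integral>x. s * (1 - x) \<partial>N) \<partial>beta_distr a b)"
    unfolding mean_def by (rule step_law_integral[OF N, of _ 1]) auto
  also have "\<dots> = (\<integral>s. s * (1 - mean N) \<partial>beta_distr a b)"
    using i by (intro Bochner_Integration.integral_cong) (auto simp: mean_def N.prob_space right_diff_distrib)
  also have "\<dots> = (real a + 1) / (real a + real b + 2) * (1 - mean N)"
    by (simp add: beta_distr_mean)
  finally show ?thesis .
qed

text \<open>With m the mean of \<open>N\<close>, s (1 - x) - \<mu> = (s - A/K) (1 - m) - s (x - m).
  For fixed \<open>s\<close> the cross term integrates to 0 over \<open>x\<close>, so the variance
  is (1 - m)^2 Var(s) + Var(N) E(s^2); the bound 1/(4 K) for Var(s) then enters twice.\<close>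

lemma var_step_law_le:
  fixes a b :: nat
  defines "A \<equiv> real a + 1" and "K \<equiv> real a + real b + 2"
  assumes N: "unit_law N"
  shows "var (step_law a b N) \<le> 1 / (4 * K) + (A / K)\<^sup>2 * var N"
proof -
  interpret N: prob_space N by (rule unit_lawD(1)[OF N])
  interpret B: prob_space "beta_distr a b" by (rule prob_space_beta_distr)
  have K: "K > 0" by (simp add: K_def)
  define m where "m = mean N"
  define \<mu> where "\<mu> = A / K * (1 - m)"
  have i: "integrable N (\<lambda>x. x)" by (rule unit_law_integrable[OF N, of _ 1]) auto
  have mm: "mean (step_law a b N) = \<mu>"
    by (simp add: mean_step_law[OF N] \<mu>_def m_def A_def K_def)
  have inner: "(\<integral>x. (s * (1 - x) - \<mu>)\<^sup>2 \<partial>N) = (1 - m)\<^sup>2 * (s - A / K)\<^sup>2 + var N * s\<^sup>2" for s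
  proof -
    have e: "s * (1 - x) - \<mu> = (s - A / K) * (1 - m) - s * (x - m)" for x
      by (simp add: \<mu>_def right_diff_distrib left_diff_distrib)
    have "(\<integral>x. (s * (1 - x) - \<mu>)\<^sup>2 \<partial>N) =
      (\<integral>x. s\<^sup>2 * (x - m)\<^sup>2 - (2 * (s - A / K) * (1 - m) * s) * (x - m) + ((s - A / K) * (1 - m))\<^sup>2 \<partial>N)"
      unfolding e by (intro Bochner_Integration.integral_cong) (auto simp: power2_diff power_mult_distrib mult_ac)
    also have "\<dots> = s\<^sup>2 * var N - (2 * (s - A / K) * (1 - m) * s) * (m - m) + ((s - A / K) * (1 - m))\<^sup>2"
      using i integrable_var[OF N] by (simp add: var_def m_def N.prob_space mean_def)
    finally show ?thesis by (simp add: power_mult_distrib mult_ac)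
  qed
  have ib1: "integrable (beta_distr a b) (\<lambda>s. (s - A / K)\<^sup>2)"
    by (rule integrable_var[OF unit_law_beta_distr])
  have ib2: "integrable (beta_distr a b) (\<lambda>s. s\<^sup>2)"
    using integrable_var[OF unit_law_beta_distr, of a b 0] by simp
  have "var (step_law a b N) = (\<integral>s. (\<integral>x. (s * (1 - x) - \<mu>)\<^sup>2 \<partial>N) \<partial>beta_distr a b)"
    unfolding var_def mm
  proof (rule step_law_integral[OF N, of _ "(1 + \<bar>\<mu>\<bar>)\<^sup>2"])
    fix x :: real assume "x \<in> {0..1}"
    then have "\<bar>x - \<mu>\<bar>\<^sup>2 \<le> (1 + \<bar>\<mu>\<bar>)\<^sup>2" by (intro power_mono) auto
    then show "\<bar>(x - \<mu>)\<^sup>2\<bar> \<le> (1 + \<bar>\<mu>\<bar>)\<^sup>2" by simp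
  qed auto
  also have "\<dots> = (1 - m)\<^sup>2 * (\<integral>s. (s - A / K)\<^sup>2 \<partial>beta_distr a b) + var N * (\<integral>s. s\<^sup>2 \<partial>beta_distr a b)"
    unfolding inner using ib1 ib2 by simp
  also have "\<dots> \<le> (1 - m)\<^sup>2 * (1 / (4 * K)) + var N * (1 / (4 * K) + (A / K)\<^sup>2)"
    using beta_distr_variance_le[of a b] var_nonneg[of N]
    by (intro add_mono mult_left_mono) (auto simp: A_def K_def)
  also have "\<dots> = (var N + (m - 1)\<^sup>2) * (1 / (4 * K)) + (A / K)\<^sup>2 * var N"
    by (simp add: power2_eq_square algebra_simps add_divide_distrib)
  also have "\<dots> \<le> 1 * (1 / (4 * K)) + (A / K)\<^sup>2 * var N"
  \<comment> \<open>The collected coefficient of 1/(4 K) is the second moment of \<open>N\<close>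
    about 1, which is at most 1 on the unit interval; so no factor larger than 1 appears in the
    recursion.\<close>
  proof (intro add_right_mono mult_right_mono)
    have "var N + (m - 1)\<^sup>2 = integral\<^sup>L N (\<lambda>x. (x - 1)\<^sup>2)"
      unfolding m_def by (rule var_decomp[OF N, symmetric])
    also have "\<dots> \<le> integral\<^sup>L N (\<lambda>x. 1)"
    proof (rule unit_law_integral_mono[OF N integrable_var[OF N]])
      fix x :: real assume "x \<in> {0..1}"
      then have "\<bar>x - 1\<bar>\<^sup>2 \<le> 1\<^sup>2" by (intro power_mono) auto
      then show "(x - 1)\<^sup>2 \<le> 1" by simp
    qed simp
    finally show "var N + (m - 1)\<^sup>2 \<le> 1" by (simp add: N.prob_space)
  qed (use K in simp)
  finally show ?thesis by simp
qed

text \<open>If x \<le> y although the means differ by d in the other direction, the two deviations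
  add up to at least d, and the sum of their squares is at least d^2 / 2. The iterated integral
  makes the two points independent.\<close>

lemma chebyshev_pair:
  assumes M: "unit_law M" and N: "unit_law N" and d: "d > 0" "d \<le> mean M - mean N"
  shows "(\<integral>y. measure M {x. x \<le> y} \<partial>N) \<le> 2 * (var M + var N) / d\<^sup>2"
proof -
  interpret M: prob_space M by (rule unit_lawD(1)[OF M])
  interpret N: prob_space N by (rule unit_lawD(1)[OF N])
  note [simp] = unit_lawD(2)[OF M] unit_lawD(5)[OF M]
  have pM: "M.prob UNIV = 1" and pN: "N.prob UNIV = 1"
    using M.prob_space N.prob_space unit_lawD(5)[OF N] by simp_all
  have le: "measure M {x. x \<le> y} \<le> 2 / d\<^sup>2 * var M + 2 / d\<^sup>2 * (y - mean N)\<^sup>2" for y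
  proof -
    have "measure M {x. x \<le> y} = integral\<^sup>L M (indicator {x. x \<le> y})"
      by simp
    also have "\<dots> \<le> integral\<^sup>L M (\<lambda>x. 2 / d\<^sup>2 * (x - mean M)\<^sup>2 + 2 / d\<^sup>2 * (y - mean N)\<^sup>2)"
    proof (rule integral_mono)
      fix x
      show "indicator {x. x \<le> y} x \<le> 2 / d\<^sup>2 * (x - mean M)\<^sup>2 + 2 / d\<^sup>2 * (y - mean N)\<^sup>2"
      proof (cases "x \<le> y")
        case True
        define u where "u = mean M - x"
        define w where "w = y - mean N"
        have "d \<le> u + w" using True d by (simp add: u_def w_def)
        then have "d\<^sup>2 \<le> (u + w)\<^sup>2" using d by (intro power_mono) auto
        also have "\<dots> \<le> 2 * u\<^sup>2 + 2 * w\<^sup>2"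
          using zero_le_power2[of "u - w"] by (simp add: power2_eq_square algebra_simps)
        finally have "1 \<le> (2 * u\<^sup>2 + 2 * w\<^sup>2) / d\<^sup>2" using d by simp
        then show ?thesis using True by (simp add: u_def w_def add_divide_distrib power2_commute)
      qed simp
    qed (use integrable_var[OF M] in \<open>auto intro!: unit_law_integrable[OF M, of _ 1] simp: indicator_def\<close>)
    also have "\<dots> = 2 / d\<^sup>2 * var M + 2 / d\<^sup>2 * (y - mean N)\<^sup>2"
      using integrable_var[OF M] by (simp add: var_def pM)
    finally show ?thesis .
  qed
  have mm: "(\<lambda>y. measure M {x. x \<le> y}) \<in> borel_measurable borel"
    by (intro borel_measurable_mono monoI M.finite_measure_mono) auto
  have "(\<integral>y. measure M {x. x \<le> y} \<partial>N) \<le> (\<integral>y. 2 / d\<^sup>2 * var M + 2 / d\<^sup>2 * (y - mean N)\<^sup>2 \<partial>N)"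
    using integrable_var[OF N] le mm by (intro integral_mono) (auto intro!: unit_law_integrable[OF N, of _ 1])
  also have "\<dots> = 2 / d\<^sup>2 * var M + 2 / d\<^sup>2 * var N"
    using integrable_var[OF N] by (simp add: var_def unit_lawD(5)[OF N] pN)
  finally show ?thesis by (simp add: add_divide_distrib algebra_simps)
qed

text \<open>These are P(X < W) and P(X < W, Y < W) for independent points with one atomless law. The
  second comes from a relation with itself: by Fubini the integral of H^2 equals 2 (1/2 - integral
  of H^2).\<close>

lemma cdf_moments:
  assumes T: "unit_law T"
  defines "H \<equiv> \<lambda>w. measure T {x. x < w}"
  shows "integral\<^sup>L T H = 1 / 2" and "integral\<^sup>L T (\<lambda>w. (H w)\<^sup>2) = 1 / 3"
proof -
  interpret T: prob_space T by (rule unit_lawD(1)[OF T])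
  note [simp] = unit_lawD(2)[OF T] unit_lawD(5)[OF T]
  note [measurable_cong] = unit_lawD(2)[OF T]
  have mH [measurable]: "H \<in> borel_measurable borel"
    unfolding H_def by (intro borel_measurable_mono monoI T.finite_measure_mono) auto
  have H01: "0 \<le> H w" "H w \<le> 1" for w by (auto simp: H_def)
  have iH: "integrable T H" using H01 by (intro unit_law_integrable[OF T, of _ 1]) auto
  have iH2: "integrable T (\<lambda>w. (H w)\<^sup>2)"
    using H01 by (intro unit_law_integrable[OF T, of _ 1]) (auto intro: power_le_one)
  have Hi: "(\<integral>x. indicator {x. x < w} x \<partial>T) = H w" for w by (simp add: H_def)
  have Hc: "(\<integral>x. indicator {x. w < x} x \<partial>T) = 1 - H w" for w
  proof -
    have "AE x in T. x \<notin> {w}" using unit_lawD(4)[OF T, of w] by simp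
    then have "T.prob {w} = 0" by (subst T.prob_eq_0) auto
    moreover have "T.prob {x. x \<le> w} = H w + T.prob {w}"
      unfolding H_def by (subst T.finite_measure_Union[symmetric]) (auto intro!: arg_cong[of _ _ T.prob])
    moreover have "T.prob {x. w < x} = 1 - T.prob {x. x \<le> w}"
      by (subst T.prob_compl[symmetric]) (auto intro!: arg_cong[of _ _ T.prob])
    ultimately show ?thesis by simp
  qed
  have ind: "indicator {x. x < w} y = (indicator {x. y < x} w :: real)" for y w :: real
    by (simp add: indicator_def)
  have "integral\<^sup>L T H = (\<integral>w. (\<integral>x. indicator {x. x < w} x \<partial>T) \<partial>T)" by (simp only: Hi)
  also have "\<dots> = (\<integral>x. (\<integral>w. indicator {x. x < w} x \<partial>T) \<partial>T)"
    using T.prob_space_axioms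
  proof (intro Fubini_bounded[where B = 1])
    show "(\<lambda>(w, x). indicator {x. x < w} x) \<in> borel_measurable (T \<Otimes>\<^sub>M T)"
      by (simp add: indicator_def case_prod_beta')
  qed (auto simp: indicator_def)
  also have "\<dots> = (\<integral>x. 1 - H x \<partial>T)" by (simp only: ind Hc)
  also have "\<dots> = 1 - integral\<^sup>L T H" using iH T.prob_space by simp
  finally show I1: "integral\<^sup>L T H = 1 / 2" by simp
  \<comment> \<open>The square of pairs x, y below w is cut along its diagonal, which is null since
    there are no atoms; Fubini shows that the two triangles have the same mass.\<close>
  have sq: "(H w)\<^sup>2 = 2 * (\<integral>y. H y * indicator {y. y < w} y \<partial>T)" for w
  proof -
    let ?i = "\<lambda>a b. indicator {x. x < b} a :: real"
    have intx: "integrable T (\<lambda>x. ?i x y * ?i y w)" "integrable T (\<lambda>x. ?i y x * ?i x w)" for y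
      by (rule unit_law_integrable[OF T, of _ 1]; force simp: indicator_def)+
    have inty: "integrable T (\<lambda>y. H y * ?i y w)"
      using H01 by (intro unit_law_integrable[OF T, of _ 1]) (auto simp: indicator_def)
    have m2: "(\<lambda>(y, x). ?i y x * ?i x w) \<in> borel_measurable (T \<Otimes>\<^sub>M T)"
      by (simp add: indicator_def case_prod_beta')
    have inty2: "integrable T (\<lambda>y. \<integral>x. ?i y x * ?i x w \<partial>T)"
    proof (rule T.integrable_const_bound[of _ 1])
      show "(\<lambda>y. \<integral>x. ?i y x * ?i x w \<partial>T) \<in> borel_measurable T"
        using m2 by (intro T.borel_measurable_lebesgue_integral) auto
      have "\<bar>\<integral>x. ?i y x * ?i x w \<partial>T\<bar> \<le> (\<integral>x. 1 \<partial>T)" for y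
        by (rule order_trans[OF integral_abs_bound integral_mono]) (use intx in \<open>auto simp: indicator_def\<close>)
      then show "AE y in T. norm (\<integral>x. ?i y x * ?i x w \<partial>T) \<le> 1" using T.prob_space by simp
    qed
    have "(H w)\<^sup>2 = (\<integral>y. ?i y w * H w \<partial>T)"
      by (simp only: integral_mult_left_zero Hi power2_eq_square)
    also have "\<dots> = (\<integral>y. (\<integral>x. ?i y w * ?i x w \<partial>T) \<partial>T)"
      by (simp only: integral_mult_right_zero Hi)
    also have "\<dots> = (\<integral>y. (\<integral>x. ?i x y * ?i y w \<partial>T) + (\<integral>x. ?i y x * ?i x w \<partial>T) \<partial>T)"
    proof (rule Bochner_Integration.integral_cong[OF refl])
      fix y
      have "(\<integral>x. ?i y w * ?i x w \<partial>T) = (\<integral>x. ?i x y * ?i y w + ?i y x * ?i x w \<partial>T)"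
      proof (rule integral_cong_AE)
        show "AE x in T. ?i y w * ?i x w = ?i x y * ?i y w + ?i y x * ?i x w"
          using unit_lawD(4)[OF T, of y] by eventually_elim (auto simp: indicator_def)
      qed (auto simp: indicator_def)
      then show "(\<integral>x. ?i y w * ?i x w \<partial>T) = (\<integral>x. ?i x y * ?i y w \<partial>T) + (\<integral>x. ?i y x * ?i x w \<partial>T)"
        using intx by simp
    qed
    also have "\<dots> = (\<integral>y. H y * ?i y w + (\<integral>x. ?i y x * ?i x w \<partial>T) \<partial>T)"
      by (simp only: integral_mult_left_zero Hi)
    also have "\<dots> = (\<integral>y. H y * ?i y w \<partial>T) + (\<integral>y. (\<integral>x. ?i y x * ?i x w \<partial>T) \<partial>T)"
      using inty inty2 by simp
    also have "(\<integral>y. (\<integral>x. ?i y x * ?i x w \<partial>T) \<partial>T) = (\<integral>x. (\<integral>y. ?i y x * ?i x w \<partial>T) \<partial>T)"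
      using m2 T.prob_space_axioms by (intro Fubini_bounded[where B = 1]) (auto simp: indicator_def)
    also have "\<dots> = (\<integral>x. H x * ?i x w \<partial>T)" by (simp only: integral_mult_left_zero Hi)
    finally show ?thesis by simp
  qed
  have "integral\<^sup>L T (\<lambda>w. (H w)\<^sup>2) = 2 * (\<integral>w. (\<integral>y. H y * indicator {y. y < w} y \<partial>T) \<partial>T)"
    by (simp add: sq)
  also have "(\<integral>w. (\<integral>y. H y * indicator {y. y < w} y \<partial>T) \<partial>T) = (\<integral>y. (\<integral>w. H y * indicator {y. y < w} y \<partial>T) \<partial>T)"
    using T.prob_space_axioms
  proof (intro Fubini_bounded[where B = 1])
    show "(\<lambda>(w, y). H y * indicator {y. y < w} y) \<in> borel_measurable (T \<Otimes>\<^sub>M T)"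
      by (simp add: indicator_def case_prod_beta')
  qed (use H01 in \<open>auto simp: indicator_def\<close>)
  also have "\<dots> = (\<integral>y. H y * (1 - H y) \<partial>T)"
    by (simp only: integral_mult_right_zero ind Hc)
  also have "\<dots> = (\<integral>y. H y - (H y)\<^sup>2 \<partial>T)" by (simp add: power2_eq_square algebra_simps)
  also have "\<dots> = 1 / 2 - integral\<^sup>L T (\<lambda>w. (H w)\<^sup>2)" using iH iH2 I1 by simp
  finally show "integral\<^sup>L T (\<lambda>w. (H w)\<^sup>2) = 1 / 3" by simp
qed

section \<open>The gain from a shared factor\<close>

lemma (in prob_space) square_expectation_le:
  fixes X :: "'a \<Rightarrow> real"
  assumes "integrable M X" "integrable M (\<lambda>x. (X x)\<^sup>2)"
  shows "(expectation X)\<^sup>2 \<le> expectation (\<lambda>x. (X x)\<^sup>2)"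
proof -
  have "0 \<le> expectation (\<lambda>x. (X x - expectation X)\<^sup>2)"
    by (rule Bochner_Integration.integral_nonneg) simp
  then show ?thesis using variance_eq[OF assms] by simp
qed

lemma measurable_scaled_cdf:
  assumes N: "unit_law N" and T: "sets T = sets borel"
  shows "(\<lambda>(s, w). measure N {x. s * (1 - x) < w}) \<in> borel_measurable (beta_distr a b \<Otimes>\<^sub>M T)"
proof -
  note [measurable_cong] = unit_lawD(2)[OF N] T
  note [simp] = unit_lawD(2)[OF N] unit_lawD(5)[OF N]
  interpret N: prob_space N by (rule unit_lawD(1)[OF N])
  have "(\<lambda>(z, x). indicator {x. fst z * (1 - x) < snd z} x :: real)
      \<in> borel_measurable ((beta_distr a b \<Otimes>\<^sub>M T) \<Otimes>\<^sub>M N)"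
    by (simp add: indicator_def case_prod_beta')
  from N.borel_measurable_lebesgue_integral[OF this]
  show ?thesis by (simp add: case_prod_beta')
qed

text \<open>Given the shared factor \<open>s\<close>, two sites are conditionally independent, so the probability
  that both lie below an independent third site with the same law exceeds \<open>1/3\<close> by the mean variance
  of the conditional distribution function, hence by the variance of its mean.\<close>

lemma triple_variance:
  fixes a b :: nat
  assumes N: "unit_law N"
  defines "T \<equiv> step_law a b N"
    and "h \<equiv> \<lambda>s w. measure N {x. s * (1 - x) < w}"
  shows "(\<integral>w. (\<integral>s. (h s w)\<^sup>2 \<partial>beta_distr a b) \<partial>T) \<ge>
    1 / 3 + measure (beta_distr a b) {s. (\<integral>w. h s w \<partial>T) \<le> 1 / 4} / 16"
proof -
  let ?B = "beta_distr a b"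
  have T: "unit_law T" unfolding T_def by (rule unit_law_step[OF N])
  note [measurable_cong] = unit_lawD(2)[OF T] unit_lawD(2)[OF N]
  note [simp] = unit_lawD(2)[OF T] unit_lawD(5)[OF T] unit_lawD(2)[OF N] unit_lawD(5)[OF N]
  interpret B: prob_space ?B by (rule prob_space_beta_distr)
  interpret N: prob_space N by (rule unit_lawD(1)[OF N])
  interpret T: prob_space T by (rule unit_lawD(1)[OF T])
  have pT: "T.prob UNIV = 1" and pB: "B.prob UNIV = 1" using T.prob_space B.prob_space by simp_all
  define H where "H w = T.prob {x. x < w}" for w
  have h01: "0 \<le> h s w" "h s w \<le> 1" for s w by (auto simp: h_def)
  have H01: "0 \<le> H w" "H w \<le> 1" for w by (auto simp: H_def)
  have hi: "h s w = (\<integral>x. indicator {x. s * (1 - x) < w} x \<partial>N)" for s w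
    by (simp add: h_def)
  have mh: "case_prod h \<in> borel_measurable (?B \<Otimes>\<^sub>M T)"
    unfolding h_def by (rule measurable_scaled_cdf[OF N]) simp
  note [measurable] = mh
  have mh1 [measurable]: "(\<lambda>s. h s w) \<in> borel_measurable borel" for w
    using measurable_compose[OF measurable_Pair2'[of w T ?B] mh] by simp
  have mh2 [measurable]: "(\<lambda>w. h s w) \<in> borel_measurable borel" for s
    using measurable_compose[OF measurable_Pair1'[of s ?B T] mh] by simp
  have HB: "H w = (\<integral>s. h s w \<partial>?B)" for w
  proof -
    have "H w = (\<integral>x. indicator {x. x < w} x \<partial>T)" by (simp add: H_def)
    also have "\<dots> = (\<integral>s. (\<integral>x. indicator {x. x < w} (s * (1 - x)) \<partial>N) \<partial>?B)"
      unfolding T_def by (rule step_law_integral[OF N, of _ 1]) (auto simp: indicator_def)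
    also have "\<dots> = (\<integral>s. h s w \<partial>?B)" by (simp add: hi indicator_def)
    finally show ?thesis .
  qed
  have mH [measurable]: "H \<in> borel_measurable borel"
    unfolding H_def by (intro borel_measurable_mono monoI T.finite_measure_mono) auto
  note cm = cdf_moments[OF T, folded H_def]
  define D where "D s w = h s w - H w" for s w
  have D1: "\<bar>D s w\<bar> \<le> 1" for s w using h01[of s w] H01[of w] by (auto simp: D_def)
  then have D2: "(D s w)\<^sup>2 \<le> 1" for s w by (simp add: abs_square_le_1)
  have mD: "case_prod D \<in> borel_measurable (?B \<Otimes>\<^sub>M T)"
  proof -
    have "(\<lambda>z. h (fst z) (snd z) - H (snd z)) \<in> borel_measurable (?B \<Otimes>\<^sub>M T)"
      using mh by (simp add: case_prod_beta')
    then show ?thesis by (simp add: D_def case_prod_beta')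
  qed
  have mDs: "(\<lambda>s. D s w) \<in> borel_measurable borel" and mDw: "(\<lambda>w. D s w) \<in> borel_measurable borel" for s w
    unfolding D_def by measurable
  have iDs: "integrable ?B (\<lambda>s. D s w)" "integrable ?B (\<lambda>s. (D s w)\<^sup>2)" for w
    using mDs D1 D2 by (auto intro!: unit_law_integrable[OF unit_law_beta_distr, of _ 1])
  have iDw: "integrable T (\<lambda>w. D s w)" "integrable T (\<lambda>w. (D s w)\<^sup>2)" for s
    using mDw D1 D2 by (auto intro!: unit_law_integrable[OF T, of _ 1])
  have iH: "integrable T H" "integrable T (\<lambda>w. (H w)\<^sup>2)"
    using H01 by (auto intro!: unit_law_integrable[OF T, of _ 1] power_le_one)
  have ih: "integrable ?B (\<lambda>s. h s w)" "integrable T (\<lambda>w. h s w)" for s w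
    using h01 by (auto intro!: unit_law_integrable[OF unit_law_beta_distr, of _ 1] unit_law_integrable[OF T, of _ 1])
  have mDD: "(\<lambda>(s, w). (D s w)\<^sup>2) \<in> borel_measurable (?B \<Otimes>\<^sub>M T)"
    using mD by (simp add: case_prod_beta')
  have mDD': "(\<lambda>(w, s). (D s w)\<^sup>2) \<in> borel_measurable (T \<Otimes>\<^sub>M ?B)"
    using measurable_compose[OF measurable_pair_swap'[of T ?B] mDD] by (simp add: case_prod_beta')
  have inner: "(\<integral>s. (h s w)\<^sup>2 \<partial>?B) = (\<integral>s. (D s w)\<^sup>2 \<partial>?B) + (H w)\<^sup>2" for w
  proof -
    have "(\<integral>s. (h s w)\<^sup>2 \<partial>?B) = (\<integral>s. (D s w)\<^sup>2 + 2 * H w * D s w + (H w)\<^sup>2 \<partial>?B)"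
      by (intro Bochner_Integration.integral_cong) (auto simp: D_def power2_eq_square algebra_simps)
    also have "\<dots> = (\<integral>s. (D s w)\<^sup>2 \<partial>?B) + 2 * H w * (\<integral>s. D s w \<partial>?B) + (H w)\<^sup>2"
      using iDs pB by simp
    also have "(\<integral>s. D s w \<partial>?B) = 0" unfolding D_def using ih pB by (simp add: HB)
    finally show ?thesis by simp
  qed
  have iDD: "integrable T (\<lambda>w. \<integral>s. (D s w)\<^sup>2 \<partial>?B)"
  proof (rule T.integrable_const_bound[of _ 1])
    have "0 \<le> (\<integral>s. (D s w)\<^sup>2 \<partial>?B)" for w by (rule Bochner_Integration.integral_nonneg) simp
    moreover have "(\<integral>s. (D s w)\<^sup>2 \<partial>?B) \<le> (\<integral>s. 1 \<partial>?B)" for w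
      by (rule integral_mono) (use iDs D2 in auto)
    ultimately have "0 \<le> (\<integral>s. (D s w)\<^sup>2 \<partial>?B)" "(\<integral>s. (D s w)\<^sup>2 \<partial>?B) \<le> (\<integral>s. 1 \<partial>?B)" for w
      by blast+
    then show "AE w in T. norm (\<integral>s. (D s w)\<^sup>2 \<partial>?B) \<le> 1" using pB by simp
    show "(\<lambda>w. \<integral>s. (D s w)\<^sup>2 \<partial>?B) \<in> borel_measurable T"
      using mDD' by (intro B.borel_measurable_lebesgue_integral)
  qed
  define G where "G s = (\<integral>w. h s w \<partial>T)" for s
  have mG [measurable]: "G \<in> borel_measurable borel"
  proof -
    have "(\<lambda>s. \<integral>w. h s w \<partial>T) \<in> borel_measurable ?B"
      using mh by (intro T.borel_measurable_lebesgue_integral)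
    then show ?thesis by (simp add: G_def[abs_def])
  qed
  have "B.prob {s. G s \<le> 1 / 4} / 16 = (\<integral>s. 1 / 16 * indicator {s. G s \<le> 1 / 4} s \<partial>?B)"
    by simp
  also have "\<dots> \<le> (\<integral>s. (\<integral>w. (D s w)\<^sup>2 \<partial>T) \<partial>?B)"
  proof (rule integral_mono)
    show "integrable ?B (\<lambda>s. 1 / 16 * (indicator {s. G s \<le> 1 / 4} s :: real))"
      by (rule unit_law_integrable[OF unit_law_beta_distr, of _ 1]) (auto simp: indicator_def)
    show "integrable ?B (\<lambda>s. \<integral>w. (D s w)\<^sup>2 \<partial>T)"
    proof (rule B.integrable_const_bound[of _ 1])
      have "0 \<le> (\<integral>w. (D s w)\<^sup>2 \<partial>T)" for s by (rule Bochner_Integration.integral_nonneg) simp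
      moreover have "(\<integral>w. (D s w)\<^sup>2 \<partial>T) \<le> (\<integral>w. 1 \<partial>T)" for s
        by (rule integral_mono) (use iDw D2 in auto)
      ultimately have "0 \<le> (\<integral>w. (D s w)\<^sup>2 \<partial>T)" "(\<integral>w. (D s w)\<^sup>2 \<partial>T) \<le> (\<integral>w. 1 \<partial>T)" for s
        by blast+
      then show "AE s in ?B. norm (\<integral>w. (D s w)\<^sup>2 \<partial>T) \<le> 1" using pT by simp
      show "(\<lambda>s. \<integral>w. (D s w)\<^sup>2 \<partial>T) \<in> borel_measurable ?B"
        using mDD by (intro T.borel_measurable_lebesgue_integral)
    qed
    fix s
    \<comment> \<open>Since \<open>H\<close> has mean 1/2, the mean deviation over \<open>w\<close>
      is \<open>G s - 1 / 2\<close>. Squaring inside the integral can only increase it, and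
      \<open>G s \<le> 1 / 4\<close> yields at least 1/16.\<close>
    have DG: "(\<integral>w. D s w \<partial>T) = G s - 1 / 2"
      unfolding D_def G_def using ih iH cm by simp
    have "(\<integral>w. D s w \<partial>T)\<^sup>2 \<le> (\<integral>w. (D s w)\<^sup>2 \<partial>T)"
      using iDw by (rule T.square_expectation_le)
    moreover have "(1 / 4)\<^sup>2 \<le> (1 / 2 - G s)\<^sup>2" if "G s \<le> 1 / 4"
      using that by (intro power_mono) auto
    ultimately show "1 / 16 * indicator {s. G s \<le> 1 / 4} s \<le> (\<integral>w. (D s w)\<^sup>2 \<partial>T)"
      unfolding DG by (auto simp: indicator_def power2_commute power_divide)
  qed
  also have "\<dots> = (\<integral>w. (\<integral>s. (D s w)\<^sup>2 \<partial>?B) \<partial>T)"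
    using mDD D2 B.prob_space_axioms T.prob_space_axioms by (intro Fubini_bounded[where B = 1]) auto
  finally have "B.prob {s. G s \<le> 1 / 4} / 16 \<le> (\<integral>w. (\<integral>s. (D s w)\<^sup>2 \<partial>?B) \<partial>T)" .
  moreover have "(\<integral>w. (\<integral>s. (h s w)\<^sup>2 \<partial>?B) \<partial>T) = (\<integral>w. (\<integral>s. (D s w)\<^sup>2 \<partial>?B) \<partial>T) + 1 / 3"
    unfolding inner using iDD iH cm by simp
  ultimately show ?thesis by (simp add: G_def)
qed

text \<open>For fixed \<open>s\<close> this is the conditional law of a site given its newest shared
  factor. It is stated as a law of its own so that \<open>chebyshev_pair\<close> can compare it with
  the unconditional law.\<close>

lemma unit_law_reflect_scale:
  assumes N: "unit_law N" and s: "0 < s" "s \<le> 1"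
  defines "M \<equiv> distr N borel (\<lambda>x. s * (1 - x))"
  shows "unit_law M" "mean M = s * (1 - mean N)" "var M = s\<^sup>2 * var N"
    "measure M {x. x \<le> w} = measure N {x. s * (1 - x) \<le> w}"
proof -
  note [measurable_cong] = unit_lawD(2)[OF N]
  interpret N: prob_space N by (rule unit_lawD(1)[OF N])
  have m: "(\<lambda>x. s * (1 - x)) \<in> borel_measurable N" by measurable
  have i: "integrable N (\<lambda>x. x)" by (rule unit_law_integrable[OF N, of _ 1]) auto
  have "AE x in M. 0 \<le> x \<and> x \<le> 1"
    unfolding M_def
  proof (subst AE_distr_iff[OF m])
    show "AE x in N. 0 \<le> s * (1 - x) \<and> s * (1 - x) \<le> 1"
      using unit_lawD(3)[OF N] by eventually_elim (use s in \<open>auto intro: mult_le_one\<close>)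
  qed auto
  moreover have "AE x in M. x \<noteq> c" for c
    unfolding M_def
  proof (subst AE_distr_iff[OF m])
    show "AE x in N. s * (1 - x) \<noteq> c"
      using unit_lawD(4)[OF N, of "1 - c / s"] by eventually_elim (use s in auto)
  qed auto
  moreover have "prob_space M" unfolding M_def by (rule N.prob_space_distr[OF m])
  moreover have "sets M = sets borel" by (simp add: M_def)
  ultimately show "unit_law M" by (simp add: unit_law_def)
  have "mean M = (\<integral>x. s * (1 - x) \<partial>N)"
    unfolding mean_def M_def by (rule integral_distr[OF m]) simp
  also have "\<dots> = s * (1 - mean N)"
    using i by (simp add: mean_def N.prob_space right_diff_distrib)
  finally show mm: "mean M = s * (1 - mean N)" .
  have "var M = (\<integral>x. (s * (1 - x) - s * (1 - mean N))\<^sup>2 \<partial>N)"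
    unfolding var_def mm unfolding M_def by (rule integral_distr[OF m]) simp
  also have "\<dots> = (\<integral>x. s\<^sup>2 * (x - mean N)\<^sup>2 \<partial>N)"
    by (intro Bochner_Integration.integral_cong) (auto simp: power2_eq_square algebra_simps)
  finally show "var M = s\<^sup>2 * var N" by (simp add: var_def)
  show "measure M {x. x \<le> w} = measure N {x. s * (1 - x) \<le> w}"
    unfolding M_def using m
    by (subst measure_distr) (auto simp: unit_lawD(5)[OF N] vimage_def)
qed

text \<open>The tail bound for Beta distributions at \<open>C = 8 * (p + 1)\<close>, divided by 16 for the variance of
  the conditional probability and by 4 for the number of orders that share the loss.\<close>

definition gain :: "real \<Rightarrow> real" where
  "gain p = 3 / 512 * exp (- 64 * (8 * (p + 1) + 2)\<^sup>2)"

lemma gain_pos: "gain p > 0"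
  by (simp add: gain_def)

lemma gain_le: "gain p \<le> 1 / 12"
proof -
  have "gain p \<le> 3 / 512 * exp 0" unfolding gain_def by (intro mult_left_mono) auto
  then show ?thesis by simp
qed

text \<open>If the factor exceeds its mean A/K by C/sqrt A with C = 8 (p + 1), the conditional mean
  of a site exceeds the unconditional one by at least d = C/(2 sqrt A), because 1 - mean N is at
  least 1/2. The two variances add up to at most 2 (p + 1)/A, so \<open>chebyshev_pair\<close> gives
  16 (p + 1)/C^2 = 1/(4 (p + 1)), which is at most 1/4. The event of \<open>triple_variance\<close>
  thus contains the tail event of \<open>beta_distr_tail\<close>.\<close>

lemma triple_bound:
  fixes a b :: nat and p :: real
  defines "A \<equiv> real a + 1" and "K \<equiv> real a + real b + 2"
  assumes N: "unit_law N" and p: "p \<ge> 0" and AK: "2 * A \<le> K" "K \<le> 4 * A"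
    and big: "16 * (8 * (p + 1) + 1)\<^sup>2 \<le> A"
    and mean: "mean N \<le> 1 / 2" and var: "var N \<le> (p + 1 / 2) / A"
  shows "(\<integral>w. (\<integral>s. (measure N {x. s * (1 - x) < w})\<^sup>2 \<partial>beta_distr a b) \<partial>step_law a b N) \<ge> 1 / 3 + 4 * gain p"
proof -
  let ?B = "beta_distr a b"
  let ?T = "step_law a b N"
  define C where "C = 8 * (p + 1)"
  have C0: "C \<ge> 8" using p by (simp add: C_def)
  have A0: "A \<ge> 1" by (simp add: A_def)
  have T: "unit_law ?T" by (rule unit_law_step[OF N])
  interpret B: prob_space ?B by (rule prob_space_beta_distr)
  interpret N: prob_space N by (rule unit_lawD(1)[OF N])
  interpret T: prob_space ?T by (rule unit_lawD(1)[OF T])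
  note [simp] = unit_lawD(2)[OF T] unit_lawD(5)[OF T] unit_lawD(2)[OF N] unit_lawD(5)[OF N]
  have sq: "sqrt A > 0" using A0 by simp
  have small: "(\<integral>w. measure N {x. s * (1 - x) < w} \<partial>?T) \<le> 1 / 4"
    if s: "A / K + C / sqrt A \<le> s" "0 < s" "s < 1" for s
  proof -
    let ?M = "distr N borel (\<lambda>x. s * (1 - x))"
    note M = unit_law_reflect_scale[OF N, of s]
    have M1: "unit_law ?M" using M s by simp
    interpret M: prob_space ?M by (rule unit_lawD(1)[OF M1])
    define d where "d = C / (2 * sqrt A)"
    have d0: "d > 0" using C0 sq by (simp add: d_def)
    have "d = C / sqrt A * (1 / 2)" by (simp add: d_def)
    also have "\<dots> \<le> (s - A / K) * (1 - mean N)"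
    proof (rule mult_mono)
      have "0 \<le> C / sqrt A" using C0 sq by simp
      then show "C / sqrt A \<le> s - A / K" "0 \<le> s - A / K" using s by linarith+
    qed (use mean in auto)
    also have "\<dots> = mean ?M - mean ?T"
      using M s by (simp add: mean_step_law[OF N] A_def K_def left_diff_distrib)
    finally have d1: "d \<le> mean ?M - mean ?T" .
    have vM: "var ?M \<le> (p + 1 / 2) / A"
    proof -
      have "var ?M = s\<^sup>2 * var N" using M s by simp
      also have "\<dots> \<le> 1 * var N" using s var_nonneg[of N] by (intro mult_right_mono power_le_one) auto
      finally show ?thesis using var by simp
    qed
    have vT: "var ?T \<le> 1 / A + (p + 1 / 2) / A"
    proof -
      have "var ?T \<le> 1 / (4 * K) + (A / K)\<^sup>2 * var N"
        using var_step_law_le[OF N, of a b] by (simp add: A_def K_def)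
      also have "\<dots> \<le> 1 / A + 1 * var N"
      proof (intro add_mono mult_right_mono)
        show "1 / (4 * K) \<le> 1 / A" using AK A0 by (intro frac_le) auto
        show "(A / K)\<^sup>2 \<le> 1" using AK A0 by (intro power_le_one) auto
      qed (use var_nonneg[of N] in auto)
      finally show ?thesis using var by simp
    qed
    have "(\<integral>w. measure N {x. s * (1 - x) < w} \<partial>?T) \<le> (\<integral>w. measure ?M {x. x \<le> w} \<partial>?T)"
    proof (rule integral_mono)
      show "integrable ?T (\<lambda>w. measure N {x. s * (1 - x) < w})"
        by (rule unit_law_integrable[OF T, of _ 1])
          (auto intro!: borel_measurable_mono monoI N.finite_measure_mono)
      show "integrable ?T (\<lambda>w. measure ?M {x. x \<le> w})"
        by (rule unit_law_integrable[OF T, of _ 1])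
          (auto intro!: borel_measurable_mono monoI M.finite_measure_mono)
      fix w
      show "measure N {x. s * (1 - x) < w} \<le> measure ?M {x. x \<le> w}"
        using M s by (auto intro!: N.finite_measure_mono)
    qed
    also have "\<dots> \<le> 2 * (var ?M + var ?T) / d\<^sup>2"
      by (rule chebyshev_pair[OF M1 T d0 d1])
    also have "\<dots> \<le> 2 * (2 * (p + 1) / A) / d\<^sup>2"
      using vM vT by (intro divide_right_mono mult_left_mono) (auto simp: add_divide_distrib)
    also have "\<dots> = 16 * (p + 1) / C\<^sup>2"
      using A0 by (simp add: d_def power_divide power_mult_distrib)
    also have "\<dots> = 1 / (4 * (p + 1))"
    proof -
      have "C\<^sup>2 = 16 * (p + 1) * (4 * (p + 1))" by (simp add: C_def power2_eq_square algebra_simps)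
      then show ?thesis using p by simp
    qed
    also have "\<dots> \<le> 1 / 4" using p by simp
    finally show ?thesis .
  qed
  have mg: "(\<lambda>s. \<integral>w. measure N {x. s * (1 - x) < w} \<partial>?T) \<in> borel_measurable borel"
  proof -
    have "(\<lambda>(s, w). measure N {x. s * (1 - x) < w}) \<in> borel_measurable (?B \<Otimes>\<^sub>M ?T)"
      by (rule measurable_scaled_cdf[OF N]) simp
    then have "(\<lambda>s. \<integral>w. measure N {x. s * (1 - x) < w} \<partial>?T) \<in> borel_measurable ?B"
      by (rule T.borel_measurable_lebesgue_integral)
    then show ?thesis by simp
  qed
  have "3 / 8 * exp (- 64 * (C + 2)\<^sup>2) \<le> B.prob {s. A / K + C / sqrt A \<le> s}"
    using beta_distr_tail[of C a b] C0 AK big by (simp add: A_def K_def C_def)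
  also have "\<dots> \<le> B.prob {s. (\<integral>w. measure N {x. s * (1 - x) < w} \<partial>?T) \<le> 1 / 4}"
  proof (rule B.finite_measure_mono_AE)
    show "AE s in ?B. s \<in> {s. A / K + C / sqrt A \<le> s} \<longrightarrow>
      s \<in> {s. (\<integral>w. measure N {x. s * (1 - x) < w} \<partial>?T) \<le> 1 / 4}"
      using AE_beta_distr by eventually_elim (use small in auto)
    show "{s. (\<integral>w. measure N {x. s * (1 - x) < w} \<partial>?T) \<le> 1 / 4} \<in> B.events"
      using mg by simp
  qed
  finally have "3 / 8 * exp (- 64 * (C + 2)\<^sup>2) / 16 \<le>
    B.prob {s. (\<integral>w. measure N {x. s * (1 - x) < w} \<partial>?T) \<le> 1 / 4} / 16" by simp
  then show ?thesis
    using triple_variance[OF N, of a b] by (simp add: gain_def C_def)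
qed

section \<open>Laws of single coordinates\<close>

lemma measurable_section_measure:
  assumes "prob_space M" and R: "{z \<in> space (N \<Otimes>\<^sub>M M). R (fst z) (snd z)} \<in> sets (N \<Otimes>\<^sub>M M)"
  shows "(\<lambda>s. measure M {x \<in> space M. R s x}) \<in> borel_measurable N"
proof -
  interpret prob_space M by fact
  let ?S = "{z \<in> space (N \<Otimes>\<^sub>M M). R (fst z) (snd z)}"
  have sec: "Pair s -` ?S = {x \<in> space M. R s x}" if "s \<in> space N" for s
    using that by (auto simp: space_pair_measure)
  have "(\<lambda>s. emeasure M (Pair s -` ?S)) \<in> borel_measurable N"
    by (rule measurable_emeasure_Pair[OF R])
  then have "(\<lambda>s. measure M (Pair s -` ?S)) \<in> borel_measurable N"
    unfolding measure_def by measurable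
  then show ?thesis by (rule measurable_cong[THEN iffD1, rotated]) (simp only: sec)
qed

definition law :: "'a set \<Rightarrow> 'a rel \<Rightarrow> 'a \<Rightarrow> real measure" where
  "law V r x = distr (random_point V r) borel (\<lambda>F. F x)"

lemma sets_law [simp]: "sets (law V r x) = sets borel"
  by (simp add: law_def)

lemma measurable_coord [measurable]: "x \<in> V \<Longrightarrow> (\<lambda>F. F x) \<in> borel_measurable (random_point V r)"
  by (simp add: measurable_cong_sets[OF sets_random_point refl])

lemma measure_law:
  assumes "x \<in> V" "S \<in> sets borel"
  shows "measure (law V r x) S = measure (random_point V r) {F \<in> space (lebP V). F x \<in> S}"
  unfolding law_def using assms
  by (subst measure_distr) (auto intro!: arg_cong[of _ _ "measure (random_point V r)"])

lemma unit_law_law: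
  assumes V: "finite_poset V r" and x: "x \<in> V"
  shows "unit_law (law V r x)"
proof -
  interpret prob_space "random_point V r" by (rule prob_space_random_point[OF V])
  note m = measurable_coord[OF x, of r]
  have "prob_space (law V r x)" unfolding law_def by (rule prob_space_distr[OF m])
  moreover have "AE t in law V r x. 0 \<le> t \<and> t \<le> 1"
    unfolding law_def
  proof (subst AE_distr_iff[OF m])
    show "AE F in random_point V r. 0 \<le> F x \<and> F x \<le> 1"
      using AE_random_point_in[OF V] by eventually_elim (use x in \<open>auto simp: order_polytope_def PiE_iff\<close>)
  qed auto
  moreover have "AE t in law V r x. t \<noteq> c" for c
    unfolding law_def
  proof (subst AE_distr_iff[OF m])
    show "AE F in random_point V r. F x \<noteq> c"
      by (rule AE_random_point_lebP[OF V AE_lebP_neq_const[OF finite_poset_finite[OF V] x]])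
  qed auto
  ultimately show ?thesis by (simp add: unit_law_def)
qed

lemma measure_osum:
  assumes V: "finite_poset V r" and D: "finite_poset D d"
    and dj: "V \<inter> D = {}" "e \<notin> V" "e \<notin> D"
    and Q: "{z \<in> space (lebP (insert e (V \<union> D))). Q z} \<in> sets (lebP (insert e (V \<union> D)))"
  shows "measure (random_point (insert e (V \<union> D)) (osum V r e D d)) {z \<in> space (lebP (insert e (V \<union> D))). Q z} =
    (\<integral>s. measure (random_point V r \<Otimes>\<^sub>M random_point D d)
      {y \<in> space (lebP V \<Otimes>\<^sub>M lebP D). Q (osum_map V e D (s, y))} \<partial>beta_distr (card V) (card D))"
    and "{y \<in> space (lebP V \<Otimes>\<^sub>M lebP D). Q (osum_map V e D (s, y))} \<in> sets (random_point V r \<Otimes>\<^sub>M random_point D d)"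
proof -
  let ?P = "insert e (V \<union> D)"
  let ?B = "beta_distr (card V) (card D)"
  let ?VD = "random_point V r \<Otimes>\<^sub>M random_point D d"
  interpret B: prob_space ?B by (rule prob_space_beta_distr)
  interpret mV: prob_space "random_point V r" by (rule prob_space_random_point[OF V])
  interpret mD: prob_space "random_point D d" by (rule prob_space_random_point[OF D])
  interpret VD: pair_prob_space "random_point V r" "random_point D d" ..
  interpret BVD: pair_prob_space ?B ?VD ..
  define S where "S = osum_map V e D -` {z \<in> space (lebP ?P). Q z} \<inter> space (?B \<Otimes>\<^sub>M ?VD)"
  have om: "osum_map V e D \<in> ?B \<Otimes>\<^sub>M ?VD \<rightarrow>\<^sub>M lebP ?P"
    by (rule osum_map_measurable) auto
  have S: "S \<in> sets (?B \<Otimes>\<^sub>M ?VD)" unfolding S_def using om Q by (rule measurable_sets)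
  have spVD: "space ?VD = space (lebP V \<Otimes>\<^sub>M lebP D)" by (simp add: space_pair_measure)
  have sec: "Pair s -` S = {y \<in> space (lebP V \<Otimes>\<^sub>M lebP D). Q (osum_map V e D (s, y))}" for s
    using measurable_space[OF om] by (auto simp: S_def spVD[symmetric] space_pair_measure)
  show sets: "{y \<in> space (lebP V \<Otimes>\<^sub>M lebP D). Q (osum_map V e D (s, y))} \<in> sets ?VD" for s
    using sets_Pair1[OF S, of s] by (simp only: sec)
  have "measure (random_point ?P (osum V r e D d)) {z \<in> space (lebP ?P). Q z} = measure (?B \<Otimes>\<^sub>M ?VD) S"
    unfolding random_point_osum(1)[OF V D dj] S_def using om Q by (intro measure_distr)
  also have "\<dots> = (\<integral>z. indicator S z \<partial>(?B \<Otimes>\<^sub>M ?VD))"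
    using sets.sets_into_space[OF S] by (simp add: Int_absorb2)
  also have "\<dots> = (\<integral>s. (\<integral>y. indicator S (s, y) \<partial>?VD) \<partial>?B)"
    using S by (intro BVD.integral_fst'[symmetric] integrable_real_indicator) (simp_all add: BVD.emeasure_eq_measure)
  also have "\<dots> = (\<integral>s. measure ?VD (Pair s -` S) \<partial>?B)"
  proof (rule Bochner_Integration.integral_cong[OF refl])
    fix s
    have "(\<integral>y. indicator S (s, y) \<partial>?VD) = (\<integral>y. indicator (Pair s -` S) y \<partial>?VD)"
      by (intro Bochner_Integration.integral_cong) (auto simp: indicator_def)
    also have "\<dots> = measure ?VD (Pair s -` S)" using sets_Pair1[OF S, of s] by simp
    finally show "(\<integral>y. indicator S (s, y) \<partial>?VD) = measure ?VD (Pair s -` S)" .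
  qed
  finally show "measure (random_point ?P (osum V r e D d)) {z \<in> space (lebP ?P). Q z} =
    (\<integral>s. measure ?VD {y \<in> space (lebP V \<Otimes>\<^sub>M lebP D). Q (osum_map V e D (s, y))} \<partial>?B)"
    by (simp only: sec)
qed

lemma measure_pair_fst:
  assumes M: "prob_space M" and N: "prob_space N" and R: "{x \<in> space M. R x} \<in> sets M"
  shows "measure (M \<Otimes>\<^sub>M N) {z \<in> space (M \<Otimes>\<^sub>M N). R (fst z)} = measure M {x \<in> space M. R x}"
proof -
  interpret N: prob_space N by fact
  have "measure M {x \<in> space M. R x} = measure (distr (M \<Otimes>\<^sub>M N) M fst) {x \<in> space M. R x}"
    by (simp add: N.distr_pair_fst)
  also have "\<dots> = measure (M \<Otimes>\<^sub>M N) {z \<in> space (M \<Otimes>\<^sub>M N). R (fst z)}"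
    using R by (subst measure_distr) (auto intro!: arg_cong[of _ _ "measure (M \<Otimes>\<^sub>M N)"] simp: space_pair_measure)
  finally show ?thesis ..
qed

text \<open>All sites lie in the lower part of an ordinal sum, so this is the form in which the
  splitting rule is applied to them: the upper part integrates out and is felt only through the law
  of \<open>s\<close>.\<close>

lemma measure_osum_lower:
  assumes V: "finite_poset V r" and D: "finite_poset D d"
    and dj: "V \<inter> D = {}" "e \<notin> V" "e \<notin> D"
    and Q: "{z \<in> space (lebP (insert e (V \<union> D))). Q z} \<in> sets (lebP (insert e (V \<union> D)))"
    and QR: "\<And>s F G. F \<in> space (lebP V) \<Longrightarrow> Q (osum_map V e D (s, F, G)) \<longleftrightarrow> R s F"
    and R: "\<And>s. {F \<in> space (lebP V). R s F} \<in> sets (lebP V)"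
  shows "measure (random_point (insert e (V \<union> D)) (osum V r e D d)) {z \<in> space (lebP (insert e (V \<union> D))). Q z} =
    (\<integral>s. measure (random_point V r) {F \<in> space (lebP V). R s F} \<partial>beta_distr (card V) (card D))"
proof -
  have "measure (random_point V r \<Otimes>\<^sub>M random_point D d)
      {y \<in> space (lebP V \<Otimes>\<^sub>M lebP D). Q (osum_map V e D (s, y))} =
    measure (random_point V r) {F \<in> space (lebP V). R s F}" for s
  proof -
    have "{y \<in> space (lebP V \<Otimes>\<^sub>M lebP D). Q (osum_map V e D (s, y))} =
      {y \<in> space (random_point V r \<Otimes>\<^sub>M random_point D d). R s (fst y)}"
      using QR by (auto simp: space_pair_measure)
    then show ?thesis
      using measure_pair_fst[OF prob_space_random_point[OF V] prob_space_random_point[OF D], of "R s"] R by simp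
  qed
  then show ?thesis using measure_osum(1)[OF V D dj Q] by simp
qed

lemma measure_converse:
  assumes V: "finite_poset V r" and Q: "{F \<in> space (lebP V). Q F} \<in> sets (lebP V)"
  shows "measure (random_point V (r\<inverse>)) {F \<in> space (lebP V). Q F} =
    measure (random_point V r) {F \<in> space (lebP V). Q (\<lambda>i\<in>V. 1 - F i)}"
proof -
  let ?T = "\<lambda>F. \<lambda>i\<in>V. (1::real) - F i"
  have "?T \<in> lebP V \<rightarrow>\<^sub>M lebP V" by measurable
  then have T: "?T \<in> random_point V r \<rightarrow>\<^sub>M lebP V"
    by (simp add: measurable_cong_sets[OF sets_random_point refl])
  then show ?thesis
    unfolding random_point_converse[OF V] using Q measurable_space[OF T]
    by (subst measure_distr) (auto intro!: arg_cong[of _ _ "measure (random_point V r)"])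
qed

lemma measure_Un:
  assumes V: "finite_poset V r" and D: "finite_poset D d" and dj: "V \<inter> D = {}"
    and Q: "{z \<in> space (lebP (V \<union> D)). Q z} \<in> sets (lebP (V \<union> D))"
  shows "measure (random_point (V \<union> D) (r \<union> d)) {z \<in> space (lebP (V \<union> D)). Q z} =
      (\<integral>G. measure (random_point V r) {F \<in> space (lebP V). Q (merge V D (F, G))} \<partial>random_point D d)"
    (is ?th)
    and "G \<in> space (lebP D) \<Longrightarrow> {F \<in> space (lebP V). Q (merge V D (F, G))} \<in> sets (lebP V)"
    (is "_ \<Longrightarrow> ?sets G")
proof -
  let ?VD = "random_point V r \<Otimes>\<^sub>M random_point D d"
  interpret mV: prob_space "random_point V r" by (rule prob_space_random_point[OF V])
  interpret mD: prob_space "random_point D d" by (rule prob_space_random_point[OF D])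
  interpret VD: pair_prob_space "random_point V r" "random_point D d" ..
  define S where "S = merge V D -` {z \<in> space (lebP (V \<union> D)). Q z} \<inter> space ?VD"
  have mg: "merge V D \<in> ?VD \<rightarrow>\<^sub>M lebP (V \<union> D)" by measurable
  have S: "S \<in> sets ?VD" unfolding S_def using mg Q by (rule measurable_sets)
  have sec: "(\<lambda>F. (F, G)) -` S = {F \<in> space (lebP V). Q (merge V D (F, G))}" if "G \<in> space (lebP D)" for G
    using measurable_space[OF mg] that by (auto simp: S_def space_pair_measure)
  show sets: "?sets G" if "G \<in> space (lebP D)" for G
    using sets_Pair2[OF S, of G] by (simp only: sec[OF that] sets_random_point)
  have "measure (random_point (V \<union> D) (r \<union> d)) {z \<in> space (lebP (V \<union> D)). Q z} = measure ?VD S"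
    unfolding random_point_Un[OF V D dj] S_def using mg Q by (intro measure_distr)
  also have "\<dots> = (\<integral>z. indicator S z \<partial>?VD)"
    using sets.sets_into_space[OF S] by (simp add: Int_absorb2)
  also have "\<dots> = (\<integral>z. (\<lambda>(F, G). indicator S (F, G)) z \<partial>?VD)" by (simp add: case_prod_beta')
  also have "\<dots> = (\<integral>G. (\<integral>F. indicator S (F, G) \<partial>random_point V r) \<partial>random_point D d)"
    using S by (intro VD.integral_snd[symmetric]) (simp add: VD.emeasure_eq_measure)
  also have "\<dots> = (\<integral>G. measure (random_point V r) {F \<in> space (lebP V). Q (merge V D (F, G))} \<partial>random_point D d)"
  proof (rule Bochner_Integration.integral_cong[OF refl])
    fix G assume "G \<in> space (random_point D d)"
    then have G: "G \<in> space (lebP D)" by simp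
    have "(\<integral>F. indicator S (F, G) \<partial>random_point V r) =
      (\<integral>F. indicator {F \<in> space (lebP V). Q (merge V D (F, G))} F \<partial>random_point V r)"
      unfolding sec[OF G, symmetric]
      by (intro Bochner_Integration.integral_cong) (auto simp: indicator_def)
    also have "\<dots> = measure (random_point V r) {F \<in> space (lebP V). Q (merge V D (F, G))}"
      using sets[OF G] by simp
    finally show "(\<integral>F. indicator S (F, G) \<partial>random_point V r) =
      measure (random_point V r) {F \<in> space (lebP V). Q (merge V D (F, G))}" .
  qed
  finally show ?th .
qed

lemma measure_Un_lower:
  assumes V: "finite_poset V r" and D: "finite_poset D d" and dj: "V \<inter> D = {}"
    and Q: "{z \<in> space (lebP (V \<union> D)). Q z} \<in> sets (lebP (V \<union> D))"
    and QR: "\<And>F G. F \<in> space (lebP V) \<Longrightarrow> Q (merge V D (F, G)) \<longleftrightarrow> R F"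
  shows "measure (random_point (V \<union> D) (r \<union> d)) {z \<in> space (lebP (V \<union> D)). Q z} =
    measure (random_point V r) {F \<in> space (lebP V). R F}"
proof -
  interpret mD: prob_space "random_point D d" by (rule prob_space_random_point[OF D])
  have "{F \<in> space (lebP V). Q (merge V D (F, G))} = {F \<in> space (lebP V). R F}" for G
    using QR by auto
  then show ?thesis using measure_Un(1)[OF V D dj Q] mD.prob_space by simp
qed

lemma measure_step_law:
  assumes L: "unit_law N" and A: "A \<in> sets borel"
  shows "measure (step_law a b N) A = (\<integral>s. measure N {t. s * (1 - t) \<in> A} \<partial>beta_distr a b)"
proof -
  note S = unit_law_step[OF L, of a b]
  have "measure (step_law a b N) A = (\<integral>t. indicator A t \<partial>step_law a b N)"
    using unit_lawD(2,5)[OF S] by simp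
  also have "\<dots> = (\<integral>s. (\<integral>t. indicator A (s * (1 - t)) \<partial>N) \<partial>beta_distr a b)"
    using A by (intro step_law_integral[OF L, of _ 1]) (auto simp: indicator_def)
  also have "\<dots> = (\<integral>s. measure N {t. s * (1 - t) \<in> A} \<partial>beta_distr a b)"
  proof (rule Bochner_Integration.integral_cong[OF refl])
    fix s :: real
    have m: "{t. s * (1 - t) \<in> A} \<in> sets borel"
      using A measurable_sets[of "\<lambda>t. s * (1 - t)" borel borel A] by (simp add: vimage_def)
    have "(\<integral>t. indicator A (s * (1 - t)) \<partial>N) = (\<integral>t. (indicator :: _ \<Rightarrow> _ \<Rightarrow> real) {t. s * (1 - t) \<in> A} t \<partial>N)"
      by (simp add: indicator_def)
    then show "(\<integral>t. indicator A (s * (1 - t)) \<partial>N) = measure N {t. s * (1 - t) \<in> A}"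
      using m unit_lawD(2,5)[OF L] by simp
  qed
  finally show ?thesis .
qed

text \<open>This is where \<open>step_law\<close> comes from: given the value \<open>s\<close> of
  \<open>e\<close>, the reversed lower part is scaled by \<open>s\<close>, and reversal replaces the
  position of the site by its distance from 1.\<close>

lemma law_osum_converse:
  assumes V: "finite_poset V r" and D: "finite_poset D d"
    and dj: "V \<inter> D = {}" "e \<notin> V" "e \<notin> D" and x: "x \<in> V"
  shows "law (insert e (V \<union> D)) (osum V (r\<inverse>) e D d) x = step_law (card V) (card D) (law V r x)"
proof -
  let ?P = "insert e (V \<union> D)"
  let ?R = "osum V (r\<inverse>) e D d"
  have V': "finite_poset V (r\<inverse>)" by (rule finite_poset_converse[OF V])
  have P: "finite_poset ?P ?R" by (rule finite_poset_osum[OF V' D dj])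
  have xP: "x \<in> ?P" using x by simp
  have L: "unit_law (law V r x)" by (rule unit_law_law[OF V x])
  have S: "unit_law (step_law (card V) (card D) (law V r x))" by (rule unit_law_step[OF L])
  have PL: "unit_law (law ?P ?R x)" by (rule unit_law_law[OF P xP])
  interpret S: prob_space "step_law (card V) (card D) (law V r x)" by (rule unit_lawD(1)[OF S])
  interpret PL: prob_space "law ?P ?R x" by (rule unit_lawD(1)[OF PL])
  interpret L: prob_space "law V r x" by (rule unit_lawD(1)[OF L])
  show ?thesis
  proof (rule measure_eqI)
    show "sets (law ?P ?R x) = sets (step_law (card V) (card D) (law V r x))"
      using unit_lawD(2)[OF PL] by simp
    fix A assume "A \<in> sets (law ?P ?R x)"
    then have A [measurable]: "A \<in> sets borel" using unit_lawD(2)[OF PL] by simp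
    have mA: "{F \<in> space (lebP V). s * F x \<in> A} \<in> sets (lebP V)"
      "{F \<in> space (lebP V). s * (1 - F x) \<in> A} \<in> sets (lebP V)" for s
      using x by measurable
    have "measure (law ?P ?R x) A = measure (random_point ?P ?R) {z \<in> space (lebP ?P). z x \<in> A}"
      by (rule measure_law[OF xP A])
    also have "\<dots> = (\<integral>s. measure (random_point V (r\<inverse>)) {F \<in> space (lebP V). s * F x \<in> A} \<partial>beta_distr (card V) (card D))"
    proof (rule measure_osum_lower[OF V' D dj])
      show "{z \<in> space (lebP ?P). z x \<in> A} \<in> sets (lebP ?P)" using xP by measurable
    qed (use x mA in \<open>auto simp: osum_map_def\<close>)
    also have "\<dots> = (\<integral>s. measure (random_point V r) {F \<in> space (lebP V). s * (1 - F x) \<in> A} \<partial>beta_distr (card V) (card D))"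
      using x mA by (simp add: measure_converse[OF V])
    also have "\<dots> = (\<integral>s. measure (law V r x) {t. s * (1 - t) \<in> A} \<partial>beta_distr (card V) (card D))"
    proof (rule Bochner_Integration.integral_cong[OF refl])
      fix s :: real
      have "{t. s * (1 - t) \<in> A} \<in> sets borel"
        using measurable_sets[of "\<lambda>t. s * (1 - t)" borel borel A] by (simp add: vimage_def)
      then show "measure (random_point V r) {F \<in> space (lebP V). s * (1 - F x) \<in> A} =
        measure (law V r x) {t. s * (1 - t) \<in> A}" using measure_law[OF x] by simp
    qed
    also have "\<dots> = measure (step_law (card V) (card D) (law V r x)) A"
      by (rule measure_step_law[OF L A, symmetric])
    finally show "emeasure (law ?P ?R x) A = emeasure (step_law (card V) (card D) (law V r x)) A"
      by (simp add: PL.emeasure_eq_measure S.emeasure_eq_measure)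
  qed
qed

lemma law_Un:
  assumes V: "finite_poset V r" and D: "finite_poset D d" and dj: "V \<inter> D = {}" and x: "x \<in> V"
  shows "law (V \<union> D) (r \<union> d) x = law V r x"
proof -
  have U: "finite_poset (V \<union> D) (r \<union> d)" by (rule finite_poset_Un[OF V D dj])
  have xU: "x \<in> V \<union> D" using x by simp
  interpret L: prob_space "law V r x" by (rule unit_lawD(1)[OF unit_law_law[OF V x]])
  interpret LU: prob_space "law (V \<union> D) (r \<union> d) x" by (rule unit_lawD(1)[OF unit_law_law[OF U xU]])
  show ?thesis
  proof (rule measure_eqI)
    show "sets (law (V \<union> D) (r \<union> d) x) = sets (law V r x)" by (simp add: law_def)
    fix A assume "A \<in> sets (law (V \<union> D) (r \<union> d) x)"
    then have A [measurable]: "A \<in> sets borel" by (simp add: law_def)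
    have "measure (law (V \<union> D) (r \<union> d) x) A = measure (random_point (V \<union> D) (r \<union> d)) {z \<in> space (lebP (V \<union> D)). z x \<in> A}"
      by (rule measure_law[OF xU A])
    also have "\<dots> = measure (random_point V r) {F \<in> space (lebP V). F x \<in> A}"
    proof (rule measure_Un_lower[OF V D dj])
      show "{z \<in> space (lebP (V \<union> D)). z x \<in> A} \<in> sets (lebP (V \<union> D))" using xU by measurable
    qed (use x in \<open>simp add: merge_def\<close>)
    also have "\<dots> = measure (law V r x) A" by (rule measure_law[OF x A, symmetric])
    finally show "emeasure (law (V \<union> D) (r \<union> d) x) A = emeasure (law V r x) A"
      by (simp add: L.emeasure_eq_measure LU.emeasure_eq_measure)
  qed
qed

section \<open>Order probabilities under composition\<close>

lemma sorted_wrt_cong_set: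
  assumes "\<And>x y. x \<in> set xs \<Longrightarrow> y \<in> set xs \<Longrightarrow> P x y \<longleftrightarrow> Q x y"
  shows "sorted_wrt P xs \<longleftrightarrow> sorted_wrt Q xs"
  using assms by (induction xs) auto

lemma order_prob_converse:
  assumes V: "finite_poset V r" and xs: "set xs \<subseteq> V"
  shows "order_prob V (r\<inverse>) xs = order_prob V r (rev xs)"
proof -
  have "order_prob V (r\<inverse>) xs = measure (random_point V r)
    {F \<in> space (lebP V). sorted_wrt (\<lambda>x y. (\<lambda>i\<in>V. 1 - F i) x < (\<lambda>i\<in>V. 1 - F i) y) xs}"
    using order_prob_eq[OF finite_poset_converse[OF V] xs] measure_converse[OF V sets_sorted_wrt_less[OF xs]]
    by simp
  also have "{F \<in> space (lebP V). sorted_wrt (\<lambda>x y. (\<lambda>i\<in>V. 1 - F i) x < (\<lambda>i\<in>V. 1 - F i) y) xs} =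
    {F \<in> space (lebP V). sorted_wrt (\<lambda>x y. F x < F y) (rev xs)}"
  proof -
    have "sorted_wrt (\<lambda>x y. (\<lambda>i\<in>V. 1 - F i) x < (\<lambda>i\<in>V. 1 - F i) y) xs \<longleftrightarrow> sorted_wrt (\<lambda>x y. F y < F x) xs"
      for F :: "'a \<Rightarrow> real"
      using xs by (intro sorted_wrt_cong_set) auto
    then show ?thesis by (simp add: sorted_wrt_rev)
  qed
  finally show ?thesis using order_prob_eq[OF V, of "rev xs"] xs by simp
qed

text \<open>Scaling by a positive factor preserves the order of the coordinates, so the conditional
  probability given \<open>s\<close> is almost surely constant.\<close>

lemma order_prob_osum:
  assumes V: "finite_poset V r" and D: "finite_poset D d"
    and dj: "V \<inter> D = {}" "e \<notin> V" "e \<notin> D" and xs: "set xs \<subseteq> V"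
  shows "order_prob (insert e (V \<union> D)) (osum V r e D d) xs = order_prob V r xs"
proof -
  let ?P = "insert e (V \<union> D)"
  let ?B = "beta_distr (card V) (card D)"
  interpret B: prob_space ?B by (rule prob_space_beta_distr)
  have P: "finite_poset ?P (osum V r e D d)" by (rule finite_poset_osum[OF V D dj])
  have xsP: "set xs \<subseteq> ?P" using xs by auto
  let ?R = "\<lambda>s F. sorted_wrt (\<lambda>x y. s * F x < s * F y) xs"
  \<comment> \<open>Measurability is demanded for every real \<open>s\<close>, hence also off the
    support of the Beta law; the sign of \<open>s\<close> decides whether the order is kept,
    collapsed or reversed.\<close>
  have m: "{F \<in> space (lebP V). ?R s F} \<in> sets (lebP V)" for s :: real
  proof -
    consider "s > 0" | "s = 0" | "s < 0" by linarith
    then show ?thesis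
    proof cases
      case 1
      then show ?thesis using sets_sorted_wrt_less[OF xs] by simp
    next
      case 2
      then show ?thesis by simp
    next
      case 3
      have "set (rev xs) \<subseteq> V" using xs by simp
      from sets_sorted_wrt_less[OF this] show ?thesis using 3 by (simp add: sorted_wrt_rev)
    qed
  qed
  have "order_prob ?P (osum V r e D d) xs =
    measure (random_point ?P (osum V r e D d)) {z \<in> space (lebP ?P). sorted_wrt (\<lambda>x y. z x < z y) xs}"
    by (rule order_prob_eq[OF P xsP])
  also have "\<dots> = (\<integral>s. measure (random_point V r) {F \<in> space (lebP V). ?R s F} \<partial>?B)"
  proof (rule measure_osum_lower[OF V D dj sets_sorted_wrt_less[OF xsP] _ m])
    fix s :: real and F G :: "'a \<Rightarrow> real"
    have "osum_map V e D (s, F, G) x = s * F x" if "x \<in> set xs" for x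
      using that xs by (auto simp: osum_map_def)
    then show "sorted_wrt (\<lambda>x y. osum_map V e D (s, F, G) x < osum_map V e D (s, F, G) y) xs \<longleftrightarrow> ?R s F"
      by (intro sorted_wrt_cong_set) simp
  qed
  also have "\<dots> = (\<integral>s. order_prob V r xs \<partial>?B)"
  proof (rule integral_cong_AE)
    have "{z \<in> space (?B \<Otimes>\<^sub>M random_point V r). ?R (fst z) (snd z)} \<in> sets (?B \<Otimes>\<^sub>M random_point V r)"
      using xs
    proof (induction xs)
      case (Cons x xs)
      have "{z \<in> space (?B \<Otimes>\<^sub>M random_point V r). fst z * snd z x < fst z * snd z y} \<in> sets (?B \<Otimes>\<^sub>M random_point V r)"
        if "y \<in> set xs" for y
      proof -
        have "x \<in> V" "y \<in> V" using Cons.prems that by auto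
        then show ?thesis by measurable
      qed
      then have "{z \<in> space (?B \<Otimes>\<^sub>M random_point V r). \<forall>y\<in>set xs. fst z * snd z x < fst z * snd z y} \<in> sets (?B \<Otimes>\<^sub>M random_point V r)"
        by (intro sets.sets_Collect_finite_All) auto
      moreover have "{z \<in> space (?B \<Otimes>\<^sub>M random_point V r). sorted_wrt (\<lambda>x y. fst z * snd z x < fst z * snd z y) xs}
          \<in> sets (?B \<Otimes>\<^sub>M random_point V r)" using Cons by auto
      ultimately show ?case by (simp only: sorted_wrt.simps) (intro sets.sets_Collect_conj)
    next
      case Nil
      show ?case by (simp only: sorted_wrt.simps) (rule sets.sets_Collect_const)
    qed
    from measurable_section_measure[OF prob_space_random_point[OF V] this]
    show "(\<lambda>s. measure (random_point V r) {F \<in> space (lebP V). ?R s F}) \<in> borel_measurable ?B" by (simp only: space_random_point)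
    show "AE s in ?B. measure (random_point V r) {F \<in> space (lebP V). ?R s F} = order_prob V r xs"
      using AE_beta_distr
    proof eventually_elim
      case (elim s)
      then have "s * F x < s * F y \<longleftrightarrow> F x < F y" for F :: "'a \<Rightarrow> real" and x y by simp
      then show ?case by (simp only: order_prob_eq[OF V xs])
    qed
  qed simp
  also have "\<dots> = order_prob V r xs" using B.prob_space by simp
  finally show ?thesis .
qed

lemma order_prob_Un:
  assumes V: "finite_poset V r" and D: "finite_poset D d" and dj: "V \<inter> D = {}" and xs: "set xs \<subseteq> V"
  shows "order_prob (V \<union> D) (r \<union> d) xs = order_prob V r xs"
proof -
  have U: "finite_poset (V \<union> D) (r \<union> d)" by (rule finite_poset_Un[OF V D dj])
  have xsU: "set xs \<subseteq> V \<union> D" using xs by auto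
  have "measure (random_point (V \<union> D) (r \<union> d)) {z \<in> space (lebP (V \<union> D)). sorted_wrt (\<lambda>x y. z x < z y) xs} =
    measure (random_point V r) {F \<in> space (lebP V). sorted_wrt (\<lambda>x y. F x < F y) xs}"
  proof (rule measure_Un_lower[OF V D dj sets_sorted_wrt_less[OF xsU]])
    fix F G :: "'a \<Rightarrow> real"
    have "merge V D (F, G) x = F x" if "x \<in> set xs" for x
      using that xs by (auto simp: merge_def)
    then show "sorted_wrt (\<lambda>x y. merge V D (F, G) x < merge V D (F, G) y) xs \<longleftrightarrow> sorted_wrt (\<lambda>x y. F x < F y) xs"
      by (intro sorted_wrt_cong_set) simp
  qed
  then show ?thesis using order_prob_eq[OF V xs] order_prob_eq[OF U xsU] by simp
qed

section \<open>Antichains in composed posets\<close>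

lemma antichain_osum_cases:
  assumes "antichain (insert e (V \<union> D)) (osum V r e D d) I"
  shows "antichain V r I \<or> antichain D d I \<or> I \<subseteq> {e}"
proof -
  have I: "I \<subseteq> insert e (V \<union> D)" and
    ac: "\<And>x y. x \<in> I \<Longrightarrow> y \<in> I \<Longrightarrow> x \<noteq> y \<Longrightarrow> (x, y) \<notin> osum V r e D d"
    using assms by (auto simp: antichain_def)
  consider "I \<subseteq> V" | "I \<subseteq> D" | "I \<subseteq> {e}"
  proof (cases "\<exists>v\<in>I. v \<in> V")
    case True
    then obtain v where v: "v \<in> I" "v \<in> V" by blast
    have "u \<in> V" if "u \<in> I" for u
    proof (rule ccontr)
      assume "u \<notin> V"
      then have "(v, u) \<in> osum V r e D d" "v \<noteq> u" using that I v by (auto simp: osum_def)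
      then show False using ac v that by blast
    qed
    then show ?thesis using that(1) by blast
  next
    case no: False
    show ?thesis
    proof (cases "e \<in> I")
      case True
      have "u = e" if "u \<in> I" for u
      proof (rule ccontr)
        assume "u \<noteq> e"
        then have "(e, u) \<in> osum V r e D d" using that I no by (auto simp: osum_def)
        then show False using ac True that \<open>u \<noteq> e\<close> by blast
      qed
      then show ?thesis using that(3) by blast
    next
      case False
      then have "I \<subseteq> D" using I no by auto
      then show ?thesis by (rule that(2))
    qed
  qed
  then show ?thesis
  proof cases
    case 1
    then have "antichain V r I" using ac by (auto simp: antichain_def osum_def)
    then show ?thesis ..
  next
    case 2
    then have "antichain D d I" using ac by (auto simp: antichain_def osum_def)
    then show ?thesis by blast
  qed auto
qed

lemma antichain_osum_lower:
  assumes "antichain V r I" "finite_poset V r" "finite_poset D d" "V \<inter> D = {}" "e \<notin> V" "e \<notin> D"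
  shows "antichain (insert e (V \<union> D)) (osum V r e D d) I"
proof -
  have I: "I \<subseteq> V" "\<And>x y. x \<in> I \<Longrightarrow> y \<in> I \<Longrightarrow> x \<noteq> y \<Longrightarrow> (x, y) \<notin> r"
    using assms(1) by (auto simp: antichain_def)
  have "(x, y) \<notin> osum V r e D d" if "x \<in> I" "y \<in> I" "x \<noteq> y" for x y
    using I that finite_poset_subset[OF assms(3)] assms(4-6) by (auto simp: osum_def)
  then show ?thesis using I(1) by (auto simp: antichain_def)
qed

lemma antichain_converse: "antichain V (r\<inverse>) I \<longleftrightarrow> antichain V r I"
  by (auto simp: antichain_def)

lemma antichain_UnD:
  assumes "antichain (V \<union> D) (r \<union> d) I"
  shows "antichain V r (I \<inter> V)" "antichain D d (I \<inter> D)" "I = (I \<inter> V) \<union> (I \<inter> D)"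
  using assms by (auto simp: antichain_def)

lemma antichain_UnI:
  assumes "antichain V r I" "antichain D d J" "r \<subseteq> V \<times> V" "d \<subseteq> D \<times> D" "V \<inter> D = {}"
  shows "antichain (V \<union> D) (r \<union> d) (I \<union> J)"
  unfolding antichain_def
proof (intro conjI ballI impI)
  show "I \<union> J \<subseteq> V \<union> D" using assms by (auto simp: antichain_def)
  fix x y assume xy: "x \<in> I \<union> J" "y \<in> I \<union> J" "x \<noteq> y"
  have IJ: "I \<subseteq> V" "J \<subseteq> D" using assms by (auto simp: antichain_def)
  have "(x, y) \<notin> r"
  proof
    assume r: "(x, y) \<in> r"
    then have "x \<in> I" "y \<in> I" using assms(3,5) xy IJ by auto
    then show False using r xy(3) assms(1) by (auto simp: antichain_def)
  qed
  moreover have "(x, y) \<notin> d"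
  proof
    assume d: "(x, y) \<in> d"
    then have "x \<in> J" "y \<in> J" using assms(4,5) xy IJ by auto
    then show False using d xy(3) assms(2) by (auto simp: antichain_def)
  qed
  ultimately show "(x, y) \<notin> r \<union> d" by blast
qed

lemma antichain_chain:
  assumes "antichain D d I" "\<And>x y. x \<in> D \<Longrightarrow> y \<in> D \<Longrightarrow> (x, y) \<in> d \<or> (y, x) \<in> d"
  shows "card I \<le> 1"
proof -
  have "x = y" if xy: "x \<in> I" "y \<in> I" for x y
  proof -
    have "x \<in> D" "y \<in> D" using assms(1) xy by (auto simp: antichain_def)
    from assms(2)[OF this] show ?thesis using assms(1) xy by (auto simp: antichain_def)
  qed
  then show ?thesis by (cases "finite I") (auto simp: card_le_Suc0_iff_eq)
qed

section \<open>Unbalanced triples\<close>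

text \<open>The multiset makes the notion symmetric in the three elements, so a triple may be
  reordered freely before an improbable order is exhibited. \<open>delta_3_le\<close> turns the list
  back into a permutation of the given tuple.\<close>

definition unbalanced :: "real \<Rightarrow> 'a set \<Rightarrow> 'a rel \<Rightarrow> 'a \<Rightarrow> 'a \<Rightarrow> 'a \<Rightarrow> bool" where
  "unbalanced \<eta> V r x y z \<longleftrightarrow> (\<exists>xs. mset xs = {#x, y, z#} \<and> order_prob V r xs \<le> 1 / 6 - \<eta>)"

definition triples_unbalanced :: "real \<Rightarrow> 'a set \<Rightarrow> 'a rel \<Rightarrow> 'a set \<Rightarrow> bool" where
  "triples_unbalanced \<eta> V r A \<longleftrightarrow>
     (\<forall>x\<in>A. \<forall>y\<in>A. \<forall>z\<in>A. distinct [x, y, z] \<longrightarrow> unbalanced \<eta> V r x y z)"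

lemma unbalanced_swap:
  "unbalanced \<eta> V r x y z \<Longrightarrow> unbalanced \<eta> V r y x z"
  "unbalanced \<eta> V r x y z \<Longrightarrow> unbalanced \<eta> V r x z y"
  by (simp_all add: unbalanced_def add_mset_commute)

lemma set_of_mset_3: "mset xs = {#x, y, z#} \<Longrightarrow> set xs = {x, y, z}"
  by (metis set_mset_mset set_mset_add_mset_insert set_mset_empty)

lemma triples_unbalanced_converse:
  assumes V: "finite_poset V r" and A: "A \<subseteq> V" and T: "triples_unbalanced \<eta> V r A"
  shows "triples_unbalanced \<eta> V (r\<inverse>) A"
  unfolding triples_unbalanced_def
proof (intro ballI impI)
  fix x y z assume xyz: "x \<in> A" "y \<in> A" "z \<in> A" "distinct [x, y, z]"
  then obtain xs where xs: "mset xs = {#x, y, z#}" "order_prob V r xs \<le> 1 / 6 - \<eta>"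
    using T by (force simp: triples_unbalanced_def unbalanced_def)
  have "set (rev xs) \<subseteq> V" using set_of_mset_3[OF xs(1)] xyz A by auto
  then have "order_prob V (r\<inverse>) (rev xs) = order_prob V r xs"
    using order_prob_converse[OF V, of "rev xs"] by simp
  then show "unbalanced \<eta> V (r\<inverse>) x y z"
    using xs unfolding unbalanced_def by (intro exI[of _ "rev xs"]) simp
qed

lemma triples_unbalanced_osum:
  assumes V: "finite_poset V r" and D: "finite_poset D d"
    and dj: "V \<inter> D = {}" "e \<notin> V" "e \<notin> D" and A: "A \<subseteq> V" and T: "triples_unbalanced \<eta> V r A"
  shows "triples_unbalanced \<eta> (insert e (V \<union> D)) (osum V r e D d) A"
  unfolding triples_unbalanced_def
proof (intro ballI impI)
  fix x y z assume xyz: "x \<in> A" "y \<in> A" "z \<in> A" "distinct [x, y, z]"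
  then obtain xs where xs: "mset xs = {#x, y, z#}" "order_prob V r xs \<le> 1 / 6 - \<eta>"
    using T by (force simp: triples_unbalanced_def unbalanced_def)
  have "set xs \<subseteq> V" using set_of_mset_3[OF xs(1)] xyz A by auto
  then show "unbalanced \<eta> (insert e (V \<union> D)) (osum V r e D d) x y z"
    using xs order_prob_osum[OF V D dj] unfolding unbalanced_def by auto
qed

lemma unbalanced_Un:
  assumes V: "finite_poset V r" and D: "finite_poset D d" and dj: "V \<inter> D = {}"
    and xyz: "x \<in> V" "y \<in> V" "z \<in> V" and u: "unbalanced \<eta> V r x y z"
  shows "unbalanced \<eta> (V \<union> D) (r \<union> d) x y z"
proof -
  obtain xs where xs: "mset xs = {#x, y, z#}" "order_prob V r xs \<le> 1 / 6 - \<eta>"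
    using u by (auto simp: unbalanced_def)
  have "set xs \<subseteq> V" using set_of_mset_3[OF xs(1)] xyz by auto
  then show ?thesis
    using xs order_prob_Un[OF V D dj] unfolding unbalanced_def by auto
qed

lemma sets_less_coord:
  "x \<in> V \<Longrightarrow> y \<in> V \<Longrightarrow> {F \<in> space (lebP V). F x < F y} \<in> sets (lebP V)"
  by measurable

text \<open>The four orders in which \<open>z\<close> is not last share a probability of at most 2/3
  - 4 \<eta>, so one of them has at most 1/6 - \<eta>. This is the reason for the factor 4 in front
  of the gain.\<close>

lemma unbalanced_of_joint:
  assumes V: "finite_poset V r" and xyz: "x \<in> V" "y \<in> V" "z \<in> V" "distinct [x, y, z]"
    and J: "measure (random_point V r) {F \<in> space (lebP V). F x < F z \<and> F y < F z} \<ge> 1 / 3 + 4 * \<eta>"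
  shows "unbalanced \<eta> V r x y z"
proof (rule ccontr)
  assume "\<not> unbalanced \<eta> V r x y z"
  then have no: "order_prob V r xs > 1 / 6 - \<eta>" if "mset xs = {#x, y, z#}" for xs
    using that by (auto simp: unbalanced_def not_le)
  interpret prob_space "random_point V r" by (rule prob_space_random_point[OF V])
  let ?E = "\<lambda>xs. {F \<in> space (lebP V). sorted_wrt (\<lambda>x y. F x < F y) xs}"
  let ?J = "{F \<in> space (lebP V). F x < F z \<and> F y < F z}"
  have sE [simp]: "?E xs \<in> sets (lebP V)" if "mset xs = {#x, y, z#}" for xs
    using set_of_mset_3[OF that] xyz by (intro sets_sorted_wrt_less) auto
  have sE0 [simp]: "?J \<in> sets (lebP V)"
    using xyz(1-3) by (intro sets.sets_Collect_conj sets_less_coord)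
  have pE: "prob (?E xs) > 1 / 6 - \<eta>" if "mset xs = {#x, y, z#}" for xs
    using no[OF that] order_prob_eq[OF V, of xs] set_of_mset_3[OF that] xyz by auto
  let ?L = "{[x, z, y], [z, x, y], [y, z, x], [z, y, x]}"
  have L: "mset xs = {#x, y, z#}" if "xs \<in> ?L" for xs
    using that by (auto simp: add_mset_commute)
  have "(\<Sum>xs\<in>?L. prob (?E xs)) = prob (\<Union>xs\<in>?L. ?E xs)"
  proof (rule finite_measure_finite_Union[symmetric])
    show "disjoint_family_on ?E ?L" by (auto simp: disjoint_family_on_def)
    show "?E ` ?L \<subseteq> events" unfolding sets_random_point using sE L by blast
  qed simp
  also have "\<dots> \<le> prob (space (random_point V r) - ?J)"
  proof (rule finite_measure_mono)
    show "(\<Union>xs\<in>?L. ?E xs) \<subseteq> space (random_point V r) - ?J" by auto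
    show "space (random_point V r) - ?J \<in> events"
      by (intro sets.compl_sets) (simp only: sets_random_point sE0)
  qed
  also have "\<dots> = 1 - prob ?J" by (rule prob_compl) (simp only: sets_random_point sE0)
  finally have "(\<Sum>xs\<in>?L. prob (?E xs)) \<le> 1 - prob ?J" .
  moreover have "(\<Sum>xs\<in>?L. prob (?E xs)) =
      prob (?E [x, z, y]) + prob (?E [z, x, y]) + prob (?E [y, z, x]) + prob (?E [z, y, x])"
    using xyz(4) by (simp del: sorted_wrt.simps)
  moreover have "prob (?E xs) > 1 / 6 - \<eta>" if "xs \<in> ?L" for xs
    using pE[OF L[OF that]] .
  then have "prob (?E [x, z, y]) > 1 / 6 - \<eta>" "prob (?E [z, x, y]) > 1 / 6 - \<eta>"
    "prob (?E [y, z, x]) > 1 / 6 - \<eta>" "prob (?E [z, y, x]) > 1 / 6 - \<eta>"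
    by blast+
  ultimately show False using J by linarith
qed

text \<open>The order x, z, y already requires \<open>x\<close> below \<open>z\<close>, whatever
  \<open>y\<close> is, and 1/12 is at most 1/6 - \<eta>.\<close>

lemma unbalanced_of_pair:
  assumes V: "finite_poset V r" and xyz: "x \<in> V" "y \<in> V" "z \<in> V"
    and J: "measure (random_point V r) {F \<in> space (lebP V). F x < F z} \<le> 1 / 12" and \<eta>: "\<eta> \<le> 1 / 12"
  shows "unbalanced \<eta> V r x y z"
proof -
  interpret prob_space "random_point V r" by (rule prob_space_random_point[OF V])
  have "order_prob V r [x, z, y] \<le> prob {F \<in> space (lebP V). F x < F z}"
    using xyz sets_less_coord[of x V z] by (subst order_prob_eq[OF V]) (auto intro!: finite_measure_mono)
  then have "order_prob V r [x, z, y] \<le> 1 / 6 - \<eta>" using J \<eta> by simp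
  then show ?thesis unfolding unbalanced_def by (intro exI[of _ "[x, z, y]"]) (simp add: add_mset_commute)
qed

section \<open>Sites with a common law\<close>

definition half_lines :: "real set set" where
  "half_lines = range lessThan \<union> range greaterThan"

text \<open>Positive quadrant dependence, restricted to quadrants with the same threshold in both
  coordinates. With \<open>H\<close> chosen as a half-line of either kind, the condition can be
  passed through the map t to s (1 - t).\<close>

definition pqd :: "'a set \<Rightarrow> 'a rel \<Rightarrow> 'a \<Rightarrow> 'a \<Rightarrow> bool" where
  "pqd V r x y \<longleftrightarrow> (\<forall>H\<in>half_lines. measure (law V r x) H * measure (law V r y) H \<le>
     measure (random_point V r) {F \<in> space (lebP V). F x \<in> H \<and> F y \<in> H})"

text \<open>The induction invariant of the towers. The common law allows the moments 1/2 and 1/3 to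
  be used for sites of different copies, and \<open>pqd\<close> replaces conditional independence
  within one copy. Maximality is expressed through \<open>card I\<close>, a form that passes
  directly through unions and ordinal sums.\<close>

definition site_poset :: "'a set \<Rightarrow> 'a rel \<Rightarrow> 'a set \<Rightarrow> real measure \<Rightarrow> bool" where
  "site_poset V r A N \<longleftrightarrow> finite_poset V r \<and> antichain V r A \<and> A \<noteq> {} \<and>
     (\<forall>I. antichain V r I \<longrightarrow> card I \<le> card A) \<and>
     (\<forall>x\<in>A. law V r x = N) \<and> (\<forall>x\<in>A. \<forall>y\<in>A. pqd V r x y)"

text \<open>The probability that \<open>x\<close> and \<open>y\<close> both lie below a third point
  that is independent of them and has law \<open>N\<close>; the third point stands for a site of the
  other copy.\<close>

definition mean_joint :: "'a set \<Rightarrow> 'a rel \<Rightarrow> real measure \<Rightarrow> 'a \<Rightarrow> 'a \<Rightarrow> real" where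
  "mean_joint V r N x y =
     (\<integral>w. measure (random_point V r) {F \<in> space (lebP V). F x < w \<and> F y < w} \<partial>N)"

lemma half_lines_borel: "H \<in> half_lines \<Longrightarrow> H \<in> sets borel"
  by (auto simp: half_lines_def)

lemma half_lines_reflect_scale:
  assumes "H \<in> half_lines" "s > 0"
  shows "{t. s * (1 - t) \<in> H} \<in> half_lines"
proof -
  have "{t. s * (1 - t) \<in> {..<w}} = {1 - w / s<..}" for w using assms(2) by (auto simp: field_simps)
  moreover have "{t. s * (1 - t) \<in> {w<..}} = {..<1 - w / s}" for w using assms(2) by (auto simp: field_simps)
  ultimately show ?thesis using assms(1) by (auto simp: half_lines_def)
qed

lemma sets_coord_pair:
    assumes "x \<in> V" "y \<in> V" and H: "H \<in> sets borel"
  shows "{F \<in> space (lebP V). F x \<in> H \<and> F y \<in> H} \<in> sets (lebP V)"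
proof -
  have 1: "{F \<in> space (lebP V). F i \<in> H} \<in> sets (lebP V)" if "i \<in> V" for i
    using measurable_sets[OF measurable_component_singleton[OF that], of H "\<lambda>_. lborel"] H
    by (simp add: vimage_def Int_def conj_commute)
  show ?thesis using assms by (intro sets.sets_Collect_conj 1)
qed

lemma sets_less_const:
  "x \<in> V \<Longrightarrow> y \<in> V \<Longrightarrow> {F \<in> space (lebP V). F x < w \<and> F y < w} \<in> sets (lebP V)"
  by measurable

lemma pqd_sym: "pqd V r x y \<Longrightarrow> pqd V r y x"
  by (simp add: pqd_def mult.commute conj_commute)

text \<open>Given \<open>s\<close>, the event says that two sites of the old poset lie in the
  half-line {t. s (1 - t) \<in> H}. So \<open>pqd\<close> one level below bounds its conditional
  probability from below by the square of the common conditional marginal.\<close>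

lemma joint_osum_ge:
  assumes V: "finite_poset V r" and D: "finite_poset D d"
    and dj: "V \<inter> D = {}" "e \<notin> V" "e \<notin> D" and xy: "x \<in> V" "y \<in> V"
    and N: "law V r x = N" "law V r y = N" and pq: "pqd V r x y" and H: "H \<in> half_lines"
  shows "measure (random_point (insert e (V \<union> D)) (osum V (r\<inverse>) e D d))
      {z \<in> space (lebP (insert e (V \<union> D))). z x \<in> H \<and> z y \<in> H} \<ge>
    (\<integral>s. (measure N {t. s * (1 - t) \<in> H})\<^sup>2 \<partial>beta_distr (card V) (card D))"
    and "integrable (beta_distr (card V) (card D)) (\<lambda>s. measure N {t. s * (1 - t) \<in> H})"
    and "integrable (beta_distr (card V) (card D)) (\<lambda>s. (measure N {t. s * (1 - t) \<in> H})\<^sup>2)"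
proof -
  let ?B = "beta_distr (card V) (card D)"
  let ?P = "insert e (V \<union> D)"
  have Nu: "unit_law N" using unit_law_law[OF V xy(1)] N by simp
  note [measurable_cong] = unit_lawD(2)[OF Nu]
  interpret B: prob_space ?B by (rule prob_space_beta_distr)
  interpret mV: prob_space "random_point V r" by (rule prob_space_random_point[OF V])
  interpret N: prob_space N by (rule unit_lawD(1)[OF Nu])
  have Hb [measurable]: "H \<in> sets borel" by (rule half_lines_borel[OF H])
  have V': "finite_poset V (r\<inverse>)" by (rule finite_poset_converse[OF V])
  let ?J = "\<lambda>s. measure (random_point V r) {F \<in> space (lebP V). s * (1 - F x) \<in> H \<and> s * (1 - F y) \<in> H}"
  let ?h = "\<lambda>s. measure N {t. s * (1 - t) \<in> H}"
  have R: "{F \<in> space (lebP V). s * F x \<in> H \<and> s * F y \<in> H} \<in> sets (lebP V)" for s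
    using xy by measurable
  have "measure (random_point ?P (osum V (r\<inverse>) e D d)) {z \<in> space (lebP ?P). z x \<in> H \<and> z y \<in> H} =
    (\<integral>s. measure (random_point V (r\<inverse>)) {F \<in> space (lebP V). s * F x \<in> H \<and> s * F y \<in> H} \<partial>?B)"
    using xy R
    by (intro measure_osum_lower[OF V' D dj sets_coord_pair]) (auto simp: osum_map_def Hb)
  also have "\<dots> = (\<integral>s. ?J s \<partial>?B)"
    using xy R by (simp add: measure_converse[OF V])
  finally have eq: "measure (random_point ?P (osum V (r\<inverse>) e D d)) {z \<in> space (lebP ?P). z x \<in> H \<and> z y \<in> H} =
    (\<integral>s. ?J s \<partial>?B)" .
  have "{z \<in> space (?B \<Otimes>\<^sub>M random_point V r). fst z * (1 - snd z x) \<in> H \<and> fst z * (1 - snd z y) \<in> H}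
      \<in> sets (?B \<Otimes>\<^sub>M random_point V r)"
    using xy by measurable
  from measurable_section_measure[OF prob_space_random_point[OF V] this]
  have mJ: "?J \<in> borel_measurable ?B" by (simp only: space_random_point)
  have "{z \<in> space (?B \<Otimes>\<^sub>M N). fst z * (1 - snd z) \<in> H} \<in> sets (?B \<Otimes>\<^sub>M N)"
    by measurable
  from measurable_section_measure[OF unit_lawD(1)[OF Nu] this]
  have mh: "?h \<in> borel_measurable ?B" by (simp only: unit_lawD(5)[OF Nu] UNIV_I simp_thms)
  have h1: "norm (?h s) \<le> 1" for s using N.prob_le_1 by simp
  have h2: "norm ((?h s)\<^sup>2) \<le> 1" for s using h1[of s] by (simp add: abs_square_le_1)
  have J1: "norm (?J s) \<le> 1" for s using mV.prob_le_1 by simp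
  show ih: "integrable ?B ?h" by (rule B.integrable_const_bound[OF AE_I2[OF h1] mh])
  show ih2: "integrable ?B (\<lambda>s. (?h s)\<^sup>2)"
    by (rule B.integrable_const_bound[OF AE_I2[OF h2] borel_measurable_power[OF mh]])
  have iJ: "integrable ?B ?J" by (rule B.integrable_const_bound[OF AE_I2[OF J1] mJ])
  have "(\<integral>s. (?h s)\<^sup>2 \<partial>?B) \<le> (\<integral>s. ?J s \<partial>?B)"
  proof (rule integral_mono_AE[OF ih2 iJ])
    show "AE s in ?B. (?h s)\<^sup>2 \<le> ?J s"
      using AE_beta_distr
    proof eventually_elim
      case (elim s)
      then have "{t. s * (1 - t) \<in> H} \<in> half_lines" using H half_lines_reflect_scale by blast
      then have "measure N {t. s * (1 - t) \<in> H} * measure N {t. s * (1 - t) \<in> H} \<le>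
        measure (random_point V r) {F \<in> space (lebP V). F x \<in> {t. s * (1 - t) \<in> H} \<and> F y \<in> {t. s * (1 - t) \<in> H}}"
        using pq N by (auto simp: pqd_def)
      then show ?case by (simp add: power2_eq_square)
    qed
  qed
  then show "measure (random_point ?P (osum V (r\<inverse>) e D d)) {z \<in> space (lebP ?P). z x \<in> H \<and> z y \<in> H} \<ge>
    (\<integral>s. (?h s)\<^sup>2 \<partial>?B)" unfolding eq .
qed

text \<open>Dependence survives the step because the mean of the squared conditional marginal is at
  least the square of its mean, which is the product of the new marginals. The chain and
  \<open>e\<close> contribute only antichains of size at most 1.\<close>

lemma site_poset_step:
  assumes S: "site_poset V r A N" and D: "finite_poset D d"
    and chain: "\<And>x y. x \<in> D \<Longrightarrow> y \<in> D \<Longrightarrow> (x, y) \<in> d \<or> (y, x) \<in> d"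
    and dj: "V \<inter> D = {}" "e \<notin> V" "e \<notin> D"
  shows "site_poset (insert e (V \<union> D)) (osum V (r\<inverse>) e D d) A (step_law (card V) (card D) N)"
proof -
  let ?P = "insert e (V \<union> D)"
  let ?R = "osum V (r\<inverse>) e D d"
  have V: "finite_poset V r" and A: "antichain V r A" "A \<noteq> {}" and
    w: "\<And>I. antichain V r I \<Longrightarrow> card I \<le> card A" and
    N: "\<And>x. x \<in> A \<Longrightarrow> law V r x = N" and pq: "\<And>x y. x \<in> A \<Longrightarrow> y \<in> A \<Longrightarrow> pqd V r x y"
    using S by (auto simp: site_poset_def)
  have AV: "A \<subseteq> V" using A by (simp add: antichain_def)
  have V': "finite_poset V (r\<inverse>)" by (rule finite_poset_converse[OF V])
  have finA: "finite A" using AV finite_poset_finite[OF V] by (rule finite_subset)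
  have A1: "1 \<le> card A" using finA A(2) by (simp add: Suc_le_eq card_gt_0_iff)
  have Nu: "unit_law N" using unit_law_law[OF V] N A(2) AV by (metis ex_in_conv subsetD)
  have lawP: "law ?P ?R x = step_law (card V) (card D) N" if "x \<in> A" for x
    using law_osum_converse[OF V D dj, of x] N[OF that] that AV by auto
  have "card I \<le> card A" if I: "antichain ?P ?R I" for I
  proof -
    have "antichain V r I \<or> antichain D d I \<or> I \<subseteq> {e}"
      using antichain_osum_cases[OF I] by (simp add: antichain_converse)
    then have "card I \<le> card A \<or> card I \<le> 1"
      using w antichain_chain[OF _ chain] card_mono[of "{e}" I] by auto
    then show ?thesis using A1 by linarith
  qed
  moreover have "pqd ?P ?R x y" if xy: "x \<in> A" "y \<in> A" for x y
    unfolding pqd_def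
  proof
    fix H assume H: "H \<in> half_lines"
    interpret B: prob_space "beta_distr (card V) (card D)" by (rule prob_space_beta_distr)
    have xyV: "x \<in> V" "y \<in> V" using xy AV by auto
    note j = joint_osum_ge[OF V D dj xyV N[OF xy(1)] N[OF xy(2)] pq[OF xy] H]
    have "measure (law ?P ?R x) H * measure (law ?P ?R y) H = (measure (step_law (card V) (card D) N) H)\<^sup>2"
      using lawP xy by (simp add: power2_eq_square)
    also have "\<dots> = (\<integral>s. measure N {t. s * (1 - t) \<in> H} \<partial>beta_distr (card V) (card D))\<^sup>2"
      by (simp add: measure_step_law[OF Nu half_lines_borel[OF H]])
    also have "\<dots> \<le> (\<integral>s. (measure N {t. s * (1 - t) \<in> H})\<^sup>2 \<partial>beta_distr (card V) (card D))"
      using j(2,3) by (rule B.square_expectation_le)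
    also note j(1)
    finally show "measure (law ?P ?R x) H * measure (law ?P ?R y) H \<le>
      measure (random_point ?P ?R) {F \<in> space (lebP ?P). F x \<in> H \<and> F y \<in> H}" .
  qed
  ultimately show ?thesis
    using finite_poset_osum[OF V' D dj] antichain_osum_lower[of V "r\<inverse>" A D d e] A V' D dj lawP
    by (auto simp: site_poset_def antichain_converse)
qed

lemma mean_joint_step:
  assumes S: "site_poset V r A N" and D: "finite_poset D d"
    and dj: "V \<inter> D = {}" "e \<notin> V" "e \<notin> D" and xy: "x \<in> A" "y \<in> A"
  shows "mean_joint (insert e (V \<union> D)) (osum V (r\<inverse>) e D d) (step_law (card V) (card D) N) x y \<ge>
    (\<integral>w. (\<integral>s. (measure N {t. s * (1 - t) < w})\<^sup>2 \<partial>beta_distr (card V) (card D)) \<partial>step_law (card V) (card D) N)"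
  unfolding mean_joint_def
proof (rule integral_mono)
  let ?P = "insert e (V \<union> D)"
  let ?R = "osum V (r\<inverse>) e D d"
  let ?B = "beta_distr (card V) (card D)"
  let ?T = "step_law (card V) (card D) N"
  have V: "finite_poset V r" and A: "antichain V r A" "A \<noteq> {}" and
    N: "\<And>x. x \<in> A \<Longrightarrow> law V r x = N" and pq: "\<And>x y. x \<in> A \<Longrightarrow> y \<in> A \<Longrightarrow> pqd V r x y"
    using S by (auto simp: site_poset_def)
  have AV: "A \<subseteq> V" using A by (simp add: antichain_def)
  have xyV: "x \<in> V" "y \<in> V" using xy AV by auto
  have Nu: "unit_law N" using unit_law_law[OF V xyV(1)] N[OF xy(1)] by simp
  have T: "unit_law ?T" by (rule unit_law_step[OF Nu])
  have P: "finite_poset ?P ?R" by (rule finite_poset_osum[OF finite_poset_converse[OF V] D dj])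
  interpret B: prob_space ?B by (rule prob_space_beta_distr)
  interpret mP: prob_space "random_point ?P ?R" by (rule prob_space_random_point[OF P])
  interpret N: prob_space N by (rule unit_lawD(1)[OF Nu])
  have lt: "{..<w} \<in> half_lines" for w by (simp add: half_lines_def)
  note j = joint_osum_ge[OF V D dj xyV N[OF xy(1)] N[OF xy(2)] pq[OF xy] lt]
  \<comment> \<open>Monotone functions are Borel measurable; this settles integrability in the
    threshold \<open>w\<close> without a joint measurability argument.\<close>
  have mono: "mono (\<lambda>w. \<integral>s. (measure N {t. s * (1 - t) < w})\<^sup>2 \<partial>?B)"
  proof (intro monoI integral_mono)
    fix w w' s :: real assume "w \<le> w'"
    have "measure N {t. s * (1 - t) < w} \<le> measure N {t. s * (1 - t) < w'}"
      using \<open>w \<le> w'\<close> unit_lawD(2)[OF Nu] by (intro N.finite_measure_mono) auto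
    then show "(measure N {t. s * (1 - t) < w})\<^sup>2 \<le> (measure N {t. s * (1 - t) < w'})\<^sup>2"
      by (intro power_mono) auto
  qed (use j(3) in simp_all)
  have bd: "\<bar>\<integral>s. (measure N {t. s * (1 - t) < w})\<^sup>2 \<partial>?B\<bar> \<le> 1" for w
  proof -
    have "0 \<le> (\<integral>s. (measure N {t. s * (1 - t) < w})\<^sup>2 \<partial>?B)"
      by (rule Bochner_Integration.integral_nonneg) simp
    moreover have "(\<integral>s. (measure N {t. s * (1 - t) < w})\<^sup>2 \<partial>?B) \<le> (\<integral>s. 1 \<partial>?B)"
      using j(3)[of w] by (intro integral_mono) (auto simp: power_le_one)
    ultimately show ?thesis using B.prob_space by simp
  qed
  show "integrable ?T (\<lambda>w. \<integral>s. (measure N {t. s * (1 - t) < w})\<^sup>2 \<partial>?B)"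
    by (rule unit_law_integrable[OF T borel_measurable_mono[OF mono] bd])
  have xyP: "x \<in> ?P" "y \<in> ?P" using xyV by auto
  note sE = sets_less_const[OF xyP]
  have monoP: "mono (\<lambda>w. measure (random_point ?P ?R) {F \<in> space (lebP ?P). F x < w \<and> F y < w})"
  proof (intro monoI mP.finite_measure_mono)
    fix w w' :: real assume "w \<le> w'"
    then show "{F \<in> space (lebP ?P). F x < w \<and> F y < w} \<subseteq> {F \<in> space (lebP ?P). F x < w' \<and> F y < w'}"
      by auto
  next
    fix w' :: real
    show "{F \<in> space (lebP ?P). F x < w' \<and> F y < w'} \<in> mP.events"
      unfolding sets_random_point by (rule sE)
  qed
  have bdP: "\<bar>measure (random_point ?P ?R) S\<bar> \<le> 1" for S using mP.prob_le_1 by simp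
  show "integrable ?T (\<lambda>w. measure (random_point ?P ?R) {F \<in> space (lebP ?P). F x < w \<and> F y < w})"
    by (rule unit_law_integrable[OF T borel_measurable_mono[OF monoP] bdP])
  fix w
  show "(\<integral>s. (measure N {t. s * (1 - t) < w})\<^sup>2 \<partial>?B) \<le>
    measure (random_point ?P ?R) {F \<in> space (lebP ?P). F x < w \<and> F y < w}"
    using j(1)[of w] by simp
qed

lemma measure_Un_cross:
  assumes V: "finite_poset V r" and D: "finite_poset D d" and dj: "V \<inter> D = {}"
    and x: "x \<in> V" "y \<in> V" and z: "z \<in> D"
  shows "measure (random_point (V \<union> D) (r \<union> d)) {F \<in> space (lebP (V \<union> D)). F x < F z \<and> F y < F z} =
      mean_joint V r (law D d z) x y"
proof -
  interpret mV: prob_space "random_point V r" by (rule prob_space_random_point[OF V])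
  have "x \<in> V \<union> D" "y \<in> V \<union> D" "z \<in> V \<union> D" using x z by auto
  then have Q: "{F \<in> space (lebP (V \<union> D)). F x < F z \<and> F y < F z} \<in> sets (lebP (V \<union> D))"
    by (intro sets.sets_Collect_conj sets_less_coord)
  note sE = sets_less_const[OF x]
  have mono: "mono (\<lambda>w. measure (random_point V r) {F \<in> space (lebP V). F x < w \<and> F y < w})"
  proof (intro monoI mV.finite_measure_mono)
    fix w w' :: real assume "w \<le> w'"
    then show "{F \<in> space (lebP V). F x < w \<and> F y < w} \<subseteq> {F \<in> space (lebP V). F x < w' \<and> F y < w'}"
      by auto
  next
    fix w' :: real
    show "{F \<in> space (lebP V). F x < w' \<and> F y < w'} \<in> mV.events"
      unfolding sets_random_point by (rule sE)
  qed
  have "z \<notin> V" using z dj by auto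
  then have "measure (random_point (V \<union> D) (r \<union> d)) {F \<in> space (lebP (V \<union> D)). F x < F z \<and> F y < F z} =
    (\<integral>G. measure (random_point V r) {F \<in> space (lebP V). F x < G z \<and> F y < G z} \<partial>random_point D d)"
    using measure_Un(1)[OF V D dj Q] x z by (simp add: merge_def)
  also have "\<dots> = mean_joint V r (law D d z) x y"
    unfolding mean_joint_def law_def
    by (rule integral_distr[OF measurable_coord[OF z] borel_measurable_mono[OF mono], symmetric])
  finally show ?thesis .
qed

lemma measure_Un_pair:
  assumes V: "finite_poset V r" and D: "finite_poset D d" and dj: "V \<inter> D = {}"
    and x: "x \<in> V" and z: "z \<in> D"
  shows "measure (random_point (V \<union> D) (r \<union> d)) {F \<in> space (lebP (V \<union> D)). F x < F z} =
      (\<integral>w. measure (law V r x) {t. t < w} \<partial>law D d z)"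
proof -
  have "measure (law V r x) {t. t < w} = measure (random_point V r) {F \<in> space (lebP V). F x < w}" for w
    using measure_law[OF x, of "{t. t < w}"] by simp
  then show ?thesis
    using measure_Un_cross[OF V D dj x x z] by (simp add: mean_joint_def)
qed

lemma pqd_Un:
  assumes V: "finite_poset V r" and D: "finite_poset D d" and dj: "V \<inter> D = {}"
    and x: "x \<in> V" "y \<in> V" and pq: "pqd V r x y"
  shows "pqd (V \<union> D) (r \<union> d) x y"
  unfolding pqd_def
proof
  fix H assume H: "H \<in> half_lines"
  have "measure (random_point (V \<union> D) (r \<union> d)) {z \<in> space (lebP (V \<union> D)). z x \<in> H \<and> z y \<in> H} =
    measure (random_point V r) {F \<in> space (lebP V). F x \<in> H \<and> F y \<in> H}"
    using x half_lines_borel[OF H]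
    by (intro measure_Un_lower[OF V D dj sets_coord_pair]) (auto simp: merge_def)
  then show "measure (law (V \<union> D) (r \<union> d) x) H * measure (law (V \<union> D) (r \<union> d) y) H \<le>
    measure (random_point (V \<union> D) (r \<union> d)) {z \<in> space (lebP (V \<union> D)). z x \<in> H \<and> z y \<in> H}"
    using pq H x law_Un[OF V D dj] by (simp add: pqd_def)
qed

text \<open>Points of different components are independent, so the inequality holds with
  equality.\<close>

lemma pqd_Un_cross:
  assumes V: "finite_poset V r" and D: "finite_poset D d" and dj: "V \<inter> D = {}"
    and x: "x \<in> V" and y: "y \<in> D"
  shows "pqd (V \<union> D) (r \<union> d) x y"
  unfolding pqd_def
proof
  fix H assume H: "H \<in> half_lines"
  interpret mV: prob_space "random_point V r" by (rule prob_space_random_point[OF V])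
  interpret mD: prob_space "random_point D d" by (rule prob_space_random_point[OF D])
  note Hb = half_lines_borel[OF H]
  have xyU: "x \<in> V \<union> D" "y \<in> V \<union> D" and yV: "y \<notin> V" using x y dj by auto
  have dj': "D \<inter> V = {}" using dj by auto
  have l: "law (V \<union> D) (r \<union> d) x = law V r x" "law (V \<union> D) (r \<union> d) y = law D d y"
    using law_Un[OF V D dj x] law_Un[OF D V dj' y] by (simp_all add: Un_commute)
  have sy: "{G \<in> space (lebP D). G y \<in> H} \<in> sets (lebP D)" using y Hb by measurable
  have "measure (random_point (V \<union> D) (r \<union> d)) {z \<in> space (lebP (V \<union> D)). z x \<in> H \<and> z y \<in> H} =
    (\<integral>G. measure (random_point V r) {F \<in> space (lebP V). F x \<in> H \<and> G y \<in> H} \<partial>random_point D d)"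
    using measure_Un(1)[OF V D dj sets_coord_pair[OF xyU Hb]] x y yV by (simp add: merge_def)
  also have "\<dots> = (\<integral>G. measure (law V r x) H * indicator {G \<in> space (lebP D). G y \<in> H} G \<partial>random_point D d)"
    using measure_law[OF x Hb, of r]
    by (intro Bochner_Integration.integral_cong) (auto simp: indicator_def)
  also have "\<dots> = measure (law V r x) H * measure (law D d y) H"
    using measure_law[OF y Hb, of d] sy by (simp add: Int_absorb2)
  finally show "measure (law (V \<union> D) (r \<union> d) x) H * measure (law (V \<union> D) (r \<union> d) y) H \<le>
    measure (random_point (V \<union> D) (r \<union> d)) {z \<in> space (lebP (V \<union> D)). z x \<in> H \<and> z y \<in> H}"
    by (simp add: l)
qed

lemma card_antichain_Un_le:
  assumes I: "antichain (V \<union> D) (r \<union> d) I" and dj: "A \<inter> B = {}" "finite A" "finite B"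
    and w: "\<And>I. antichain V r I \<Longrightarrow> card I \<le> card A" "\<And>I. antichain D d I \<Longrightarrow> card I \<le> card B"
  shows "card I \<le> card (A \<union> B)"
proof -
  have "card I \<le> card (I \<inter> V) + card (I \<inter> D)"
    using antichain_UnD(3)[OF I] card_Un_le by metis
  also have "\<dots> \<le> card A + card B"
    using antichain_UnD(1,2)[OF I] w by (meson add_mono)
  finally show ?thesis using dj by (simp add: card_Un_disjoint)
qed

lemma site_poset_Un:
  assumes S: "site_poset V r A N" and S': "site_poset V' r' A' N" and dj: "V \<inter> V' = {}"
  shows "site_poset (V \<union> V') (r \<union> r') (A \<union> A') N"
proof -
  have V: "finite_poset V r" and A: "antichain V r A" "A \<noteq> {}" and
    w: "\<And>I. antichain V r I \<Longrightarrow> card I \<le> card A" and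
    N: "\<And>x. x \<in> A \<Longrightarrow> law V r x = N" and pq: "\<And>x y. x \<in> A \<Longrightarrow> y \<in> A \<Longrightarrow> pqd V r x y"
    using S by (auto simp: site_poset_def)
  have V': "finite_poset V' r'" and A': "antichain V' r' A'" "A' \<noteq> {}" and
    w': "\<And>I. antichain V' r' I \<Longrightarrow> card I \<le> card A'" and
    N': "\<And>x. x \<in> A' \<Longrightarrow> law V' r' x = N" and pq': "\<And>x y. x \<in> A' \<Longrightarrow> y \<in> A' \<Longrightarrow> pqd V' r' x y"
    using S' by (auto simp: site_poset_def)
  have dj': "V' \<inter> V = {}" using dj by auto
  have AV: "A \<subseteq> V" "A' \<subseteq> V'" using A A' by (auto simp: antichain_def)
  have fin: "finite A" "finite A'"
    using AV finite_poset_finite[OF V] finite_poset_finite[OF V'] by (auto intro: finite_subset)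
  have djA: "A \<inter> A' = {}" using AV dj by auto
  have "law (V \<union> V') (r \<union> r') x = N" if "x \<in> A \<union> A'" for x
    using that law_Un[OF V V' dj, of x] law_Un[OF V' V dj', of x] N N' AV
    by (auto simp: Un_commute)
  moreover have "pqd (V \<union> V') (r \<union> r') x y" if "x \<in> A \<union> A'" "y \<in> A \<union> A'" for x y
  proof -
    have 1: "pqd (V \<union> V') (r \<union> r') x y" if "x \<in> A" "y \<in> A" for x y
      using that AV by (intro pqd_Un[OF V V' dj] pq) auto
    have 2: "pqd (V \<union> V') (r \<union> r') x y" if "x \<in> A'" "y \<in> A'" for x y
      using pqd_Un[OF V' V dj', of x y] that AV pq'[of x y] by (auto simp: Un_commute)
    have 3: "pqd (V \<union> V') (r \<union> r') x y" if "x \<in> A" "y \<in> A'" for x y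
      using that AV by (intro pqd_Un_cross[OF V V' dj]) auto
    show ?thesis using that 1 2 3 pqd_sym[OF 3] by blast
  qed
  moreover have "antichain (V \<union> V') (r \<union> r') (A \<union> A')"
    using A A' finite_poset_subset[OF V] finite_poset_subset[OF V'] dj by (intro antichain_UnI) auto
  moreover have "card I \<le> card (A \<union> A')" if "antichain (V \<union> V') (r \<union> r') I" for I
    using card_antichain_Un_le[OF that djA fin] w w' by blast
  ultimately show ?thesis
    using finite_poset_Un[OF V V' dj] A(2) by (auto simp: site_poset_def)
qed

text \<open>Among three sites two lie in the same component. By symmetry of
  \<open>unbalanced\<close> these can be taken as the first two, which leaves the two cross
  cases.\<close>

lemma triples_unbalanced_Un:
  assumes V: "finite_poset V r" and V': "finite_poset V' r'" and dj: "V \<inter> V' = {}"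
    and AV: "A \<subseteq> V" "A' \<subseteq> V'"
    and T: "triples_unbalanced \<eta> V r A" "triples_unbalanced \<eta> V' r' A'"
    and cross: "\<And>x y z. x \<in> A \<Longrightarrow> y \<in> A \<Longrightarrow> z \<in> A' \<Longrightarrow> x \<noteq> y \<Longrightarrow> unbalanced \<eta> (V \<union> V') (r \<union> r') x y z"
      "\<And>x y z. x \<in> A' \<Longrightarrow> y \<in> A' \<Longrightarrow> z \<in> A \<Longrightarrow> x \<noteq> y \<Longrightarrow> unbalanced \<eta> (V \<union> V') (r \<union> r') x y z"
  shows "triples_unbalanced \<eta> (V \<union> V') (r \<union> r') (A \<union> A')"
  unfolding triples_unbalanced_def
proof (intro ballI impI)
  fix x y z assume xyz: "x \<in> A \<union> A'" "y \<in> A \<union> A'" "z \<in> A \<union> A'" "distinct [x, y, z]"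
  have dj': "V' \<inter> V = {}" using dj by auto
  let ?U = "unbalanced \<eta> (V \<union> V') (r \<union> r')"
  have 1: "?U x y z" if "x \<in> A" "y \<in> A" "z \<in> A"
    using that xyz(4) T(1) AV by (intro unbalanced_Un[OF V V' dj]) (auto simp: triples_unbalanced_def)
  have 2: "?U x y z" if "x \<in> A'" "y \<in> A'" "z \<in> A'"
  proof -
    have "x \<in> V'" "y \<in> V'" "z \<in> V'" using that AV by auto
    moreover have "unbalanced \<eta> V' r' x y z" using that xyz(4) T(2) by (auto simp: triples_unbalanced_def)
    ultimately show ?thesis using unbalanced_Un[OF V' V dj'] by (simp add: Un_commute)
  qed
  have d: "x \<noteq> y" "x \<noteq> z" "y \<noteq> z" using xyz(4) by auto
  have 3: "?U x y z" if "?U x z y" using unbalanced_swap(2)[OF that] .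
  have 4: "?U x y z" if "?U y z x"
    using unbalanced_swap(1)[OF unbalanced_swap(2)[OF that]] .
  show "?U x y z"
    using xyz(1-3) 1 2 3 4 cross d by blast
qed

section \<open>Towers\<close>

definition chain_rel :: "nat set \<Rightarrow> nat rel" where
  "chain_rel D = {(x, y). x \<in> D \<and> y \<in> D \<and> x \<le> y}"

lemma finite_poset_chain_rel: "finite D \<Longrightarrow> finite_poset D (chain_rel D)"
  by (auto simp: finite_poset_def order_on_defs chain_rel_def refl_on_def trans_def antisym_def)

lemma chain_rel_total: "x \<in> D \<Longrightarrow> y \<in> D \<Longrightarrow> (x, y) \<in> chain_rel D \<or> (y, x) \<in> chain_rel D"
  by (auto simp: chain_rel_def)

lemma finite_poset_Id_on: "finite D \<Longrightarrow> finite_poset D (Id_on D)"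
  by (auto simp: finite_poset_def order_on_defs refl_on_def trans_def antisym_def)

text \<open>A point is the ordinal sum of two empty posets around it, so the splitting rule gives
  the Beta law with both indices 0, the uniform law on the unit interval.\<close>

lemma site_poset_singleton: "site_poset {a} {(a, a)} {a} (beta_distr 0 0)"
proof -
  let ?r = "{(a, a)}"
  have E: "finite_poset ({} :: 'a set) {}" by (rule finite_poset_empty)
  have ins: "insert a ({} \<union> {}) = {a}" by simp
  have os: "osum {} {} a {} {} = ?r" by (auto simp: osum_def)
  have V: "finite_poset {a} ?r"
    using finite_poset_osum[OF E E, of a] by (simp add: os)
  interpret L: prob_space "law {a} ?r a" by (rule unit_lawD(1)[OF unit_law_law[OF V]]) simp
  interpret B: prob_space "beta_distr 0 0" by (rule prob_space_beta_distr)
  interpret E2: prob_space "random_point ({} :: 'a set) {} \<Otimes>\<^sub>M random_point ({} :: 'a set) {}"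
  proof -
    interpret E1: prob_space "random_point ({} :: 'a set) {}" by (rule prob_space_random_point[OF E])
    interpret EE: pair_prob_space "random_point ({} :: 'a set) {}" "random_point ({} :: 'a set) {}" ..
    show "prob_space (random_point ({} :: 'a set) {} \<Otimes>\<^sub>M random_point ({} :: 'a set) {})" by (rule EE.prob_space_axioms)
  qed
  have "law {a} ?r a = beta_distr 0 0"
  proof (rule measure_eqI)
    fix A assume "A \<in> sets (law {a} ?r a)"
    then have A: "A \<in> sets borel" by simp
    have "measure (law {a} ?r a) A = measure (random_point {a} ?r) {z \<in> space (lebP {a}). z a \<in> A}"
      using A by (intro measure_law) auto
    also have "\<dots> = (\<integral>s. measure (random_point ({} :: 'a set) {} \<Otimes>\<^sub>M random_point ({} :: 'a set) {})
        {y \<in> space (lebP {} \<Otimes>\<^sub>M lebP {}). osum_map {} a {} (s, y) a \<in> A} \<partial>beta_distr 0 0)"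
      using measure_osum(1)[OF E E, of a "\<lambda>z. z a \<in> A"] sets_coord_pair[of a "{a}" a A] A by (simp add: os)
    also have "\<dots> = (\<integral>s. indicator A s \<partial>beta_distr 0 0)"
    proof (rule Bochner_Integration.integral_cong[OF refl])
      fix s :: real
      have "osum_map {} a {} (s, y) a = s" for y by (cases y) (simp add: osum_map_def)
      then show "measure (random_point ({} :: 'a set) {} \<Otimes>\<^sub>M random_point ({} :: 'a set) {})
        {y \<in> space (lebP {} \<Otimes>\<^sub>M lebP {}). osum_map {} a {} (s, y) a \<in> A} = indicator A s"
        using E2.prob_space by (auto simp: indicator_def space_pair_measure)
    qed
    also have "\<dots> = measure (beta_distr 0 0) A" using A by simp
    finally show "emeasure (law {a} ?r a) A = emeasure (beta_distr 0 0) A"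
      by (simp add: L.emeasure_eq_measure B.emeasure_eq_measure)
  qed simp
  moreover have "pqd {a} ?r a a"
    unfolding pqd_def
  proof
    fix H assume H: "H \<in> half_lines"
    have "measure (law {a} ?r a) H * measure (law {a} ?r a) H \<le> measure (law {a} ?r a) H"
      using L.prob_le_1 by (intro mult_left_le) auto
    then show "measure (law {a} ?r a) H * measure (law {a} ?r a) H \<le>
      measure (random_point {a} ?r) {F \<in> space (lebP {a}). F a \<in> H \<and> F a \<in> H}"
      using measure_law[of a "{a}" H ?r] half_lines_borel[OF H] by simp
  qed
  moreover have "card I \<le> card {a}" if "antichain {a} ?r I" for I
    using that by (intro card_mono) (auto simp: antichain_def)
  ultimately show ?thesis using V by (auto simp: site_poset_def antichain_def)
qed

text \<open>With a chain of this length on top of \<open>n\<close> points the factor of a step has mean at most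
  \<open>p / (2 * p + 1)\<close>, slightly less than \<open>1 / 2\<close>. That makes the recursion for variance times size
  contract, while the size grows by a factor of only about \<open>4 + 2 / p\<close> per level.\<close>

definition cap_len :: "nat \<Rightarrow> nat \<Rightarrow> nat" where
  "cap_len p n = n + (n + 1) div p + 1"

text \<open>Over the single point of level 0 the chain has the free length \<open>M\<close>. By
  \<open>tower_size_Suc_ge\<close> all later levels then have more than \<open>M\<close> points, so
  that the tail bound for Beta laws applies to all of them.\<close>

primrec tower_size :: "nat \<Rightarrow> nat \<Rightarrow> nat \<Rightarrow> nat" where
  "tower_size p M 0 = 1"
| "tower_size p M (Suc k) =
    2 * (tower_size p M k + (if k = 0 then M else cap_len p (tower_size p M k)) + 1)"

definition tower_cap :: "nat \<Rightarrow> nat \<Rightarrow> nat \<Rightarrow> nat" where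
  "tower_cap p M k = (if k = 0 then M else cap_len p (tower_size p M k))"

lemma tower_size_Suc: "tower_size p M (Suc k) = 2 * (tower_size p M k + tower_cap p M k + 1)"
  by (simp add: tower_cap_def)

primrec tower_law :: "nat \<Rightarrow> nat \<Rightarrow> nat \<Rightarrow> real measure" where
  "tower_law p M 0 = beta_distr 0 0"
| "tower_law p M (Suc k) = step_law (tower_size p M k) (tower_cap p M k) (tower_law p M k)"

lemma tower_size_Suc_ge: "tower_size p M (Suc k) \<ge> 2 * (M + 2)"
proof (induction k)
  case (Suc k)
  then show ?case unfolding tower_size_Suc[of p M "Suc k"]
    by (rule order_trans) (simp del: tower_size.simps)
qed simp

text \<open>In terms of A = n + 1 and K = n + cap + 2 for the Beta law of a step: the lower bound
  makes the variance recursion contract, the first upper bound controls the growth of the tower, and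
  the last one is the hypothesis K \<le> 4 A of the tail bound.\<close>

lemma cap_len_bounds:
  assumes "p \<ge> 1"
  shows "(2 + 1 / real p) * (real n + 1) \<le> real n + real (cap_len p n) + 2"
    "real n + real (cap_len p n) + 2 \<le> (2 + 1 / real p) * (real n + 1) + 1"
    "real n + real (cap_len p n) + 2 \<le> 4 * (real n + 1)"
proof -
  define q where "q = (n + 1) div p"
  have q1: "real q \<le> (real n + 1) / real p"
    using of_nat_div_le_of_nat[of "n + 1" p, where 'a = real] by (simp add: q_def add.commute)
  have "n + 1 < p * (q + 1)"
    unfolding q_def using assms dividend_less_times_div[of p "n + 1"] by (simp add: algebra_simps)
  then have "real (n + 1) < real (p * (q + 1))" by (simp only: of_nat_less_iff)
  then have q2: "(real n + 1) / real p < real q + 1"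
    using assms by (simp add: field_simps)
  have q3: "real q \<le> real n + 1"
    using q1 assms by (smt (verit) div_by_1 frac_le of_nat_0_le_iff of_nat_1 of_nat_le_iff)
  have e: "real n + real (cap_len p n) + 2 = 2 * (real n + 1) + real q + 1"
    by (simp add: cap_len_def q_def)
  show "(2 + 1 / real p) * (real n + 1) \<le> real n + real (cap_len p n) + 2"
    using q2 unfolding e by (simp add: distrib_right)
  show "real n + real (cap_len p n) + 2 \<le> (2 + 1 / real p) * (real n + 1) + 1"
    using q1 unfolding e by (simp add: distrib_right)
  show "real n + real (cap_len p n) + 2 \<le> 4 * (real n + 1)"
    using q3 unfolding e by simp
qed

lemma tower_cap_lower:
  assumes "p \<ge> 1" "M \<ge> 3"
  shows "(2 + 1 / real p) * (real (tower_size p M k) + 1) \<le>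
    real (tower_size p M k) + real (tower_cap p M k) + 2"
proof (cases "k = 0")
  case True
  \<comment> \<open>At level 0 the right-hand side of the goal is M + 3, so 6 \<le> M + 3 is where
    \<open>M \<ge> 3\<close> enters.\<close>
  have "(2 + 1 / real p) * 2 \<le> (2 + 1) * 2" using assms by (intro mult_right_mono add_left_mono) auto
  then show ?thesis using True assms by (simp add: tower_cap_def)
next
  case False
  then show ?thesis using cap_len_bounds(1)[OF assms(1)] by (simp add: tower_cap_def)
qed

lemma tower_law_unit: "unit_law (tower_law p M k)"
  by (induction k) (auto intro: unit_law_beta_distr unit_law_step)

text \<open>It keeps 1 - mean at least 1/2, so that a fluctuation of the next factor moves the
  conditional mean of a site by at least half its size. The factor itself has mean A/K at most
  1/2.\<close>

lemma tower_law_mean: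
  assumes "p \<ge> 1" "M \<ge> 3"
  shows "mean (tower_law p M k) \<le> 1 / 2"
proof (cases k)
  case 0
  then show ?thesis by (simp add: mean_beta_distr)
next
  case (Suc j)
  define A where "A = real (tower_size p M j) + 1"
  define K where "K = real (tower_size p M j) + real (tower_cap p M j) + 2"
  have A: "A \<ge> 1" by (simp add: A_def)
  have "(2 + 1 / real p) * A \<le> K" using tower_cap_lower[OF assms] by (simp add: A_def K_def)
  moreover have "2 * A \<le> (2 + 1 / real p) * A" using A by (intro mult_right_mono) auto
  ultimately have "2 * A \<le> K" by linarith
  then have "A / K \<le> 1 / 2" using A by (simp add: divide_le_eq)
  have "mean (tower_law p M k) = A / K * (1 - mean (tower_law p M j))"
    using mean_step_law[OF tower_law_unit] by (simp add: Suc A_def K_def)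
  moreover have "A / K * (1 - mean (tower_law p M j)) \<le> 1 / 2 * 1"
    using mean_bounds[OF tower_law_unit, of p M j] \<open>A / K \<le> 1 / 2\<close> A
    by (intro mult_mono) auto
  ultimately show ?thesis by simp
qed

text \<open>The constant s = p + 1/2 is a fixed point of the recursion: A/K is at most p/(2 p + 1),
  so s A/K is at most p/2, and 1/4 + p/2 = s/2. The next size plus 1 is 2 K - 1, which absorbs the
  factor 1/2.\<close>

lemma tower_law_var:
  assumes "p \<ge> 1" "M \<ge> 3"
  shows "var (tower_law p M k) \<le> (real p + 1 / 2) / (real (tower_size p M k) + 1)"
proof (induction k)
  case 0
  have "var (beta_distr 0 0) \<le> 1 / 8" using var_beta_distr[of 0 0] by simp
  also have "1 / 8 \<le> (real p + 1 / 2) / 2" using assms by simp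
  finally show ?case by simp
next
  case (Suc k)
  define A where "A = real (tower_size p M k) + 1"
  define K where "K = real (tower_size p M k) + real (tower_cap p M k) + 2"
  define s where "s = real p + 1 / 2"
  have A: "A \<ge> 1" by (simp add: A_def)
  have p: "real p \<ge> 1" using assms by simp
  have AK: "(2 + 1 / real p) * A \<le> K" using tower_cap_lower[OF assms] by (simp add: A_def K_def)
  have "1 * A \<le> (2 + 1 / real p) * A" using A by (intro mult_right_mono) auto
  then have K: "K \<ge> 1" using AK A by linarith
  have "s * (A / K) \<le> real p / 2"
  proof -
    have "2 * s * A = real p * ((2 + 1 / real p) * A)" using p by (simp add: s_def field_simps)
    also have "\<dots> \<le> real p * K" using AK p by (intro mult_left_mono) auto
    finally show ?thesis using K by (simp add: field_simps)
  qed
  then have 1: "1 / 4 + s * (A / K) \<le> s / 2" by (simp add: s_def)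
  have "var (tower_law p M (Suc k)) \<le> 1 / (4 * K) + (A / K)\<^sup>2 * var (tower_law p M k)"
    using var_step_law_le[OF tower_law_unit] by (simp add: A_def K_def)
  also have "\<dots> \<le> 1 / (4 * K) + (A / K)\<^sup>2 * (s / A)"
    using Suc by (intro add_left_mono mult_left_mono) (auto simp: A_def s_def)
  also have "\<dots> = (1 / 4 + s * (A / K)) / K"
    using A K by (simp add: field_simps power2_eq_square)
  also have "\<dots> \<le> (s / 2) / K" using 1 K by (intro divide_right_mono) auto
  also have "\<dots> = s / (2 * K)" by simp
  also have "\<dots> \<le> s / (real (tower_size p M (Suc k)) + 1)"
    using K p by (intro divide_left_mono) (auto simp: tower_size_Suc K_def s_def simp del: tower_size.simps)
  finally show ?case by (simp add: s_def)
qed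

text \<open>Carriers are intervals of natural numbers with a free start, so that a disjoint copy is
  a shifted interval. The reversed poset keeps its place, \<open>s + n\<close> becomes the
  separating point, and the next \<open>b\<close> numbers form the chain.\<close>

lemma site_poset_capped:
  assumes S: "site_poset {s..<s + n} r A N" and T: "triples_unbalanced \<eta> {s..<s + n} r A"
  obtains R where "site_poset {s..<s + (n + b + 1)} R A (step_law n b N)"
    "triples_unbalanced \<eta> {s..<s + (n + b + 1)} R A"
    "\<And>x y. x \<in> A \<Longrightarrow> y \<in> A \<Longrightarrow> mean_joint {s..<s + (n + b + 1)} R (step_law n b N) x y \<ge>
      (\<integral>w. (\<integral>s. (measure N {t. s * (1 - t) < w})\<^sup>2 \<partial>beta_distr n b) \<partial>step_law n b N)"
proof -
  let ?V = "{s..<s + n}"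
  let ?D = "{s + n + 1..<s + (n + b + 1)}"
  let ?d = "chain_rel ?D"
  let ?R = "osum ?V (r\<inverse>) (s + n) ?D ?d"
  have D: "finite_poset ?D ?d" by (intro finite_poset_chain_rel) simp
  have P: "insert (s + n) (?V \<union> ?D) = {s..<s + (n + b + 1)}" by auto
  have dj: "?V \<inter> ?D = {}" "s + n \<notin> ?V" "s + n \<notin> ?D" by auto
  have c: "card ?V = n" "card ?D = b" by auto
  have V: "finite_poset ?V r" and AV: "A \<subseteq> ?V" using S by (auto simp: site_poset_def antichain_def)
  have 1: "site_poset {s..<s + (n + b + 1)} ?R A (step_law n b N)"
    using site_poset_step[OF S D chain_rel_total dj] unfolding P c .
  have 2: "triples_unbalanced \<eta> {s..<s + (n + b + 1)} ?R A"
    using triples_unbalanced_osum[OF finite_poset_converse[OF V] D dj AV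
        triples_unbalanced_converse[OF V AV T]] unfolding P .
  have 3: "mean_joint {s..<s + (n + b + 1)} ?R (step_law n b N) x y \<ge>
      (\<integral>w. (\<integral>s. (measure N {t. s * (1 - t) < w})\<^sup>2 \<partial>beta_distr n b) \<partial>step_law n b N)"
    if "x \<in> A" "y \<in> A" for x y
    using mean_joint_step[OF S D dj that] unfolding P c .
  show thesis using that 1 2 3 by blast
qed

text \<open>The start \<open>s\<close> is arbitrary because the induction step builds two copies on
  adjacent intervals. They need not be isomorphic as relations; the equality of the site laws and of
  the bounds is what matters for the cross triples.\<close>

lemma tower_exists:
  assumes p: "p \<ge> 1" and M: "M \<ge> 3" "16 * (8 * (real p + 1) + 1)\<^sup>2 \<le> real M"
  shows "\<exists>r A. site_poset {s..<s + tower_size p M k} r A (tower_law p M k) \<and> card A = 2 ^ k \<and>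
    triples_unbalanced (gain (real p)) {s..<s + tower_size p M k} r A"
proof (induction k arbitrary: s)
  case 0
  have "{s..<s + 1} = {s}" by auto
  then show ?case using site_poset_singleton[of s]
    by (intro exI[of _ "{(s, s)}"] exI[of _ "{s}"]) (auto simp: triples_unbalanced_def)
next
  case (Suc k)
  define n where "n = tower_size p M k"
  define b where "b = tower_cap p M k"
  define N where "N = tower_law p M k"
  define T where "T = step_law n b N"
  define m where "m = n + b + 1"
  let ?\<eta> = "gain (real p)"
  obtain r A where A: "site_poset {s..<s + n} r A N" "card A = 2 ^ k" "triples_unbalanced ?\<eta> {s..<s + n} r A"
    using Suc[of s] by (auto simp: n_def N_def)
  obtain r' A' where A': "site_poset {s + m..<(s + m) + n} r' A' N" "card A' = 2 ^ k"
      "triples_unbalanced ?\<eta> {s + m..<(s + m) + n} r' A'"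
    using Suc[of "s + m"] by (auto simp: n_def N_def)
  obtain R where R: "site_poset {s..<s + m} R A T" "triples_unbalanced ?\<eta> {s..<s + m} R A"
    "\<And>x y. x \<in> A \<Longrightarrow> y \<in> A \<Longrightarrow> mean_joint {s..<s + m} R T x y \<ge>
      (\<integral>w. (\<integral>s. (measure N {t. s * (1 - t) < w})\<^sup>2 \<partial>beta_distr n b) \<partial>T)"
    using site_poset_capped[OF A(1,3), of b] unfolding m_def T_def by blast
  obtain R' where R': "site_poset {s + m..<(s + m) + m} R' A' T" "triples_unbalanced ?\<eta> {s + m..<(s + m) + m} R' A'"
    "\<And>x y. x \<in> A' \<Longrightarrow> y \<in> A' \<Longrightarrow> mean_joint {s + m..<(s + m) + m} R' T x y \<ge>
      (\<integral>w. (\<integral>s. (measure N {t. s * (1 - t) < w})\<^sup>2 \<partial>beta_distr n b) \<partial>T)"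
    using site_poset_capped[OF A'(1,3), of b] unfolding m_def T_def by blast
  let ?V = "{s..<s + m}"
  let ?V' = "{s + m..<(s + m) + m}"
  have dj: "?V \<inter> ?V' = {}" "?V' \<inter> ?V = {}" by auto
  have U: "?V \<union> ?V' = {s..<s + tower_size p M (Suc k)}"
    unfolding tower_size_Suc m_def n_def b_def by auto
  have V: "finite_poset ?V R" "finite_poset ?V' R'" and AV: "A \<subseteq> ?V" "A' \<subseteq> ?V'"
    and lw: "\<And>x. x \<in> A \<Longrightarrow> law ?V R x = T" "\<And>x. x \<in> A' \<Longrightarrow> law ?V' R' x = T"
    using R(1) R'(1) by (auto simp: site_poset_def antichain_def)
  have fin: "finite A" "finite A'" using AV finite_subset by blast+
  \<comment> \<open>At \<open>k = 0\<close> each copy has a single site, so there is no pair to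
    treat. For larger \<open>k\<close> the poset under the chain has more than \<open>M\<close>
    points, as the tail bound requires.\<close>
  have bound: "(\<integral>w. (\<integral>s. (measure N {t. s * (1 - t) < w})\<^sup>2 \<partial>beta_distr n b) \<partial>T) \<ge> 1 / 3 + 4 * ?\<eta>" if k: "k \<noteq> 0"
  proof -
    obtain j where j: "k = Suc j" using k not0_implies_Suc by blast
    have b: "b = cap_len p n" using k by (simp add: b_def tower_cap_def n_def)
    have "2 * (M + 2) \<le> n" unfolding n_def j by (rule tower_size_Suc_ge)
    then have "real M \<le> real n + 1" by simp
    then have big: "16 * (8 * (real p + 1) + 1)\<^sup>2 \<le> real n + 1" using M(2) by simp
    have "2 * (real n + 1) \<le> (2 + 1 / real p) * (real n + 1)" by (intro mult_right_mono) auto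
    then have "2 * (real n + 1) \<le> real n + real b + 2" using cap_len_bounds(1)[OF p, of n] b by simp
    then show ?thesis
      unfolding T_def N_def using cap_len_bounds(3)[OF p, of n] b big
        tower_law_mean[OF p M(1), of k] tower_law_var[OF p M(1), of k] p
      by (intro triple_bound[OF tower_law_unit]) (auto simp: n_def)
  qed
  have k0: "k \<noteq> 0" if "x \<in> A" "y \<in> A" "x \<noteq> y" for x y
  proof
    assume "k = 0"
    then have "card A = 1" using A(2) by simp
    then show False using that by (auto simp: card_1_singleton_iff)
  qed
  have k0': "k \<noteq> 0" if "x \<in> A'" "y \<in> A'" "x \<noteq> y" for x y
  proof
    assume "k = 0"
    then have "card A' = 1" using A'(2) by simp
    then show False using that by (auto simp: card_1_singleton_iff)
  qed
  have "triples_unbalanced ?\<eta> (?V \<union> ?V') (R \<union> R') (A \<union> A')"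
  proof (rule triples_unbalanced_Un[OF V dj(1) AV R(2) R'(2)])
    fix x y z assume xyz: "x \<in> A" "y \<in> A" "z \<in> A'" "x \<noteq> y"
    have xV: "x \<in> ?V" "y \<in> ?V" "z \<in> ?V'" using xyz AV by blast+
    have "1 / 3 + 4 * ?\<eta> \<le> mean_joint ?V R T x y"
      using R(3)[OF xyz(1,2)] bound[OF k0[OF xyz(1,2,4)]] by linarith
    also have "\<dots> = measure (random_point (?V \<union> ?V') (R \<union> R')) {F \<in> space (lebP (?V \<union> ?V')). F x < F z \<and> F y < F z}"
      using measure_Un_cross[OF V dj(1) xV] unfolding lw(2)[OF xyz(3)] by (rule sym)
    finally show "unbalanced ?\<eta> (?V \<union> ?V') (R \<union> R') x y z"
      using xyz(4) xV dj by (intro unbalanced_of_joint[OF finite_poset_Un[OF V dj(1)]]) auto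
  next
    fix x y z assume xyz: "x \<in> A'" "y \<in> A'" "z \<in> A" "x \<noteq> y"
    have xV: "x \<in> ?V'" "y \<in> ?V'" "z \<in> ?V" using xyz AV by blast+
    have "1 / 3 + 4 * ?\<eta> \<le> mean_joint ?V' R' T x y"
      using R'(3)[OF xyz(1,2)] bound[OF k0'[OF xyz(1,2,4)]] by linarith
    also have "\<dots> = measure (random_point (?V' \<union> ?V) (R' \<union> R)) {F \<in> space (lebP (?V' \<union> ?V)). F x < F z \<and> F y < F z}"
      using measure_Un_cross[OF V(2,1) dj(2) xV] unfolding lw(1)[OF xyz(3)] by (rule sym)
    finally have "unbalanced ?\<eta> (?V' \<union> ?V) (R' \<union> R) x y z"
      using xyz(4) xV dj by (intro unbalanced_of_joint[OF finite_poset_Un[OF V(2,1) dj(2)]]) auto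
    then show "unbalanced ?\<eta> (?V \<union> ?V') (R \<union> R') x y z" by (simp only: Un_commute)
  qed
  moreover have "site_poset (?V \<union> ?V') (R \<union> R') (A \<union> A') T"
    by (rule site_poset_Un[OF R(1) R'(1) dj(1)])
  moreover have "card (A \<union> A') = 2 ^ Suc k"
  proof -
    have "A \<inter> A' = {}" using AV dj by blast
    then show ?thesis using fin A(2) A'(2) by (simp add: card_Un_disjoint)
  qed
  ultimately show ?case
    unfolding U by (intro exI[of _ "R \<union> R'"] exI[of _ "A \<union> A'"]) (simp add: T_def n_def b_def N_def)
qed

section \<open>Families of towers\<close>

text \<open>A triple that meets two towers contains \<open>x\<close> from an earlier and
  \<open>z\<close> from a later one, and the order x, z, y has probability at most 1/12 wherever the
  third site lies. Triples inside one tower keep their imbalance under the capping and the union.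
  The law of each site is recorded so that the next tower can be compared with all previous
  ones.\<close>

lemma tower_family_exists:
  fixes b :: "nat \<Rightarrow> nat"
  assumes tower: "\<And>s. \<exists>r A. site_poset {s..<s + n} r A N \<and> card A = m \<and> triples_unbalanced \<eta> {s..<s + n} r A"
    and sep: "\<And>i j. i < j \<Longrightarrow> j < J \<Longrightarrow>
      (\<integral>w. measure (step_law n (b i) N) {t. t < w} \<partial>step_law n (b j) N) \<le> 1 / 12"
    and \<eta>: "\<eta> \<le> 1 / 12"
  shows "\<exists>r A. finite_poset {s..<s + (\<Sum>i<J. n + b i + 1)} r \<and> antichain {s..<s + (\<Sum>i<J. n + b i + 1)} r A \<and>
    card A = J * m \<and> (\<forall>I. antichain {s..<s + (\<Sum>i<J. n + b i + 1)} r I \<longrightarrow> card I \<le> card A) \<and>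
    triples_unbalanced \<eta> {s..<s + (\<Sum>i<J. n + b i + 1)} r A \<and>
    (\<forall>x\<in>A. \<exists>i<J. law {s..<s + (\<Sum>i<J. n + b i + 1)} r x = step_law n (b i) N)"
  using sep
proof (induction J)
  case 0
  show ?case
    by (intro exI[of _ "{}"]) (auto simp: finite_poset_empty antichain_def triples_unbalanced_def)
next
  case (Suc J)
  define q where "q = (\<Sum>i<J. n + b i + 1)"
  define c where "c = n + b J + 1"
  let ?V = "{s..<s + q}"
  let ?V' = "{s + q..<(s + q) + c}"
  have U: "{s..<s + (\<Sum>i<Suc J. n + b i + 1)} = ?V \<union> ?V'"
    by (auto simp: q_def c_def)
  have sepJ: "(\<integral>w. measure (step_law n (b i) N) {t. t < w} \<partial>step_law n (b j) N) \<le> 1 / 12" if "i < j" "j < J" for i j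
    using Suc.prems that by simp
  obtain r A where A: "finite_poset ?V r" "antichain ?V r A" "card A = J * m"
    "\<And>I. antichain ?V r I \<Longrightarrow> card I \<le> card A" "triples_unbalanced \<eta> ?V r A"
    "\<And>x. x \<in> A \<Longrightarrow> \<exists>i<J. law ?V r x = step_law n (b i) N"
    using Suc.IH[OF sepJ] unfolding q_def[symmetric] by blast
  obtain r0 A' where A0: "site_poset {s + q..<(s + q) + n} r0 A' N" "card A' = m"
    "triples_unbalanced \<eta> {s + q..<(s + q) + n} r0 A'"
    using tower[of "s + q"] by blast
  obtain r' where R': "site_poset ?V' r' A' (step_law n (b J) N)" "triples_unbalanced \<eta> ?V' r' A'"
    by (rule site_poset_capped[OF A0(1,3), of "b J", folded c_def]) (erule (1) that)
  have A': "finite_poset ?V' r'" "antichain ?V' r' A'" "\<And>I. antichain ?V' r' I \<Longrightarrow> card I \<le> card A'"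
    "\<And>x. x \<in> A' \<Longrightarrow> law ?V' r' x = step_law n (b J) N"
    using R'(1) by (auto simp: site_poset_def)
  have AV: "A \<subseteq> ?V" "A' \<subseteq> ?V'" using A(2) A'(2) by (auto simp: antichain_def)
  have dj: "?V \<inter> ?V' = {}" "?V' \<inter> ?V = {}" by auto
  have fin: "finite A" "finite A'" using AV finite_subset by blast+
  have djA: "A \<inter> A' = {}" using AV dj by blast
  have P: "finite_poset (?V \<union> ?V') (r \<union> r')" by (rule finite_poset_Un[OF A(1) A'(1) dj(1)])
  have pair: "unbalanced \<eta> (?V \<union> ?V') (r \<union> r') x y z" if xz: "x \<in> A" "z \<in> A'" and y: "y \<in> ?V \<union> ?V'" for x y z
  proof (rule unbalanced_of_pair[OF P _ y])
    obtain i where i: "i < J" "law ?V r x = step_law n (b i) N" using A(6) xz by blast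
    have xV: "x \<in> ?V" "z \<in> ?V'" using xz AV by auto
    have "measure (random_point (?V \<union> ?V') (r \<union> r')) {F \<in> space (lebP (?V \<union> ?V')). F x < F z} =
      (\<integral>w. measure (step_law n (b i) N) {t. t < w} \<partial>step_law n (b J) N)"
      using measure_Un_pair[OF A(1) A'(1) dj(1) xV] i(2) A'(4)[OF xz(2)] by simp
    also have "\<dots> \<le> 1 / 12" using Suc.prems[of i J] i by simp
    finally show "measure (random_point (?V \<union> ?V') (r \<union> r')) {F \<in> space (lebP (?V \<union> ?V')). F x < F z} \<le> 1 / 12" .
  qed (use xz AV \<eta> in auto)
  have "triples_unbalanced \<eta> (?V \<union> ?V') (r \<union> r') (A \<union> A')"
  proof (rule triples_unbalanced_Un[OF A(1) A'(1) dj(1) AV A(5) R'(2)])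
    fix x y z assume "x \<in> A" "y \<in> A" "z \<in> A'"
    then show "unbalanced \<eta> (?V \<union> ?V') (r \<union> r') x y z" using AV by (intro pair) auto
  next
    fix x y z assume "x \<in> A'" "y \<in> A'" "z \<in> A"
    then have "unbalanced \<eta> (?V \<union> ?V') (r \<union> r') z y x" using AV by (intro pair) auto
    then show "unbalanced \<eta> (?V \<union> ?V') (r \<union> r') x y z" by (blast intro: unbalanced_swap)
  qed
  moreover have "antichain (?V \<union> ?V') (r \<union> r') (A \<union> A')"
    by (rule antichain_UnI[OF A(2) A'(2) finite_poset_subset[OF A(1)] finite_poset_subset[OF A'(1)] dj(1)])
  moreover have "card (A \<union> A') = Suc J * m" using A(3) A0(2) djA fin by (simp add: card_Un_disjoint)
  moreover have "card I \<le> card (A \<union> A')" if "antichain (?V \<union> ?V') (r \<union> r') I" for I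
    using card_antichain_Un_le[OF that djA fin] A(4) A'(3) by blast
  moreover have "\<exists>i<Suc J. law (?V \<union> ?V') (r \<union> r') x = step_law n (b i) N" if "x \<in> A \<union> A'" for x
    using that
  proof
    assume x: "x \<in> A"
    then have "law (?V \<union> ?V') (r \<union> r') x = law ?V r x"
      using AV by (intro law_Un[OF A(1) A'(1) dj(1)]) auto
    then show ?thesis using A(6)[OF x] less_Suc_eq by auto
  next
    assume x: "x \<in> A'"
    then have "law (?V' \<union> ?V) (r' \<union> r) x = law ?V' r' x"
      using AV by (intro law_Un[OF A'(1) A(1) dj(2)]) auto
    then show ?thesis using A'(4)[OF x] by (auto simp: Un_commute)
  qed
  ultimately show ?case unfolding U using P by blast
qed

text \<open>Longer chains push sites down: the means are A/K_i (1 - mean N) with K_i = 2 A + i d. As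
  \<open>j * d \<le> n\<close> keeps K_i and K_j at most 3 A, the means differ by at least d/(18 A),
  while each variance is at most (p + 1)/A. Then \<open>chebyshev_pair\<close> gives 1296 (p + 1)
  A/d^2, and 15552 is 12 times 1296.\<close>

lemma step_laws_separated:
  assumes N: "unit_law N" "mean N \<le> 1 / 2" "var N \<le> (real p + 1 / 2) / (real n + 1)"
    and d: "15552 * (real p + 1) * (real n + 1) \<le> (real d)\<^sup>2" and ij: "i < j" and jd: "j * d \<le> n"
  shows "(\<integral>w. measure (step_law n (n + i * d) N) {t. t < w} \<partial>step_law n (n + j * d) N) \<le> 1 / 12"
proof -
  define A where "A = real n + 1"
  define K where "K i = 2 * A + real i * real d" for i :: nat
  let ?L = "\<lambda>i. step_law n (n + i * d) N"
  have A: "A \<ge> 1" by (simp add: A_def)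
  have Kn: "real n + real (n + i * d) + 2 = K i" for i by (simp add: K_def A_def)
  have L: "unit_law (?L i)" for i by (rule unit_law_step[OF N(1)])
  interpret Li: prob_space "?L i" by (rule unit_lawD(1)[OF L])
  have d0: "d > 0"
  proof (rule ccontr)
    assume "\<not> d > 0"
    then have "15552 * (real p + 1) * (real n + 1) \<le> 0" using d by simp
    moreover have "15552 * (real p + 1) * (real n + 1) > 0" by simp
    ultimately show False by linarith
  qed
  have K: "2 * A \<le> K i" for i by (simp add: K_def)
  have "i * d \<le> j * d" using ij by simp
  then have "real (i * d) \<le> real n" "real (j * d) \<le> real n"
    using jd by (simp_all only: of_nat_le_iff)
  then have K3: "K i \<le> 3 * A" "K j \<le> 3 * A"
    by (simp_all add: K_def A_def)
  have "Suc i * d \<le> j * d" using ij by (intro mult_right_mono) auto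
  then have "real (Suc i * d) \<le> real (j * d)" by (simp only: of_nat_le_iff)
  then have Kd: "real d \<le> K j - K i" by (simp add: K_def algebra_simps)
  have v: "var (?L i) \<le> (real p + 1) / A" for i
  proof -
    have "var (?L i) \<le> 1 / (4 * K i) + (A / K i)\<^sup>2 * var N"
      using var_step_law_le[OF N(1), of n "n + i * d"] unfolding Kn A_def[symmetric] .
    also have "\<dots> \<le> 1 / (8 * A) + 1 * var N"
    proof (intro add_mono mult_right_mono)
      show "1 / (4 * K i) \<le> 1 / (8 * A)" using K[of i] A by (intro frac_le) auto
      show "(A / K i)\<^sup>2 \<le> 1" using K[of i] A by (intro power_le_one) (auto simp: divide_le_eq)
    qed (rule var_nonneg)
    also have "\<dots> \<le> 1 / (8 * A) + (real p + 1 / 2) / A" using N(3) by (simp add: A_def)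
    also have "\<dots> \<le> (real p + 1) / A" using A by (simp add: field_simps)
    finally show ?thesis .
  qed
  define \<Delta> where "\<Delta> = real d / (18 * A)"
  have \<Delta>0: "\<Delta> > 0" using d0 A by (simp add: \<Delta>_def)
  have "\<Delta> = (A * real d / (3 * A * (3 * A))) * (1 / 2)" using A by (simp add: \<Delta>_def)
  also have "\<dots> \<le> (A * (K j - K i) / (K i * K j)) * (1 - mean N)"
  proof (rule mult_mono)
    show "A * real d / (3 * A * (3 * A)) \<le> A * (K j - K i) / (K i * K j)"
      using K3 K[of i] K[of j] A Kd by (intro frac_le mult_mono mult_left_mono) auto
    show "0 \<le> A * (K j - K i) / (K i * K j)"
      using K[of i] K[of j] A Kd by (intro divide_nonneg_nonneg mult_nonneg_nonneg) auto
  qed (use N(2) in auto)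
  also have "A * (K j - K i) / (K i * K j) = A / K i - A / K j"
    using K[of i] K[of j] A by (simp add: field_simps)
  also have "(A / K i - A / K j) * (1 - mean N) = mean (?L i) - mean (?L j)"
    using mean_step_law[OF N(1), of n "n + i * d"] mean_step_law[OF N(1), of n "n + j * d"] Kn[of i] Kn[of j]
    by (simp add: A_def left_diff_distrib)
  finally have \<Delta>: "\<Delta> \<le> mean (?L i) - mean (?L j)" .
  have "(\<integral>w. measure (?L i) {t. t < w} \<partial>?L j) \<le> (\<integral>w. measure (?L i) {t. t \<le> w} \<partial>?L j)"
  proof (rule integral_mono)
    have b: "\<bar>measure (?L i) S\<bar> \<le> 1" for S using Li.prob_le_1 by simp
    have m: "mono (\<lambda>w. measure (?L i) {t. t < w})" "mono (\<lambda>w. measure (?L i) {t. t \<le> w})"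
      by (intro monoI Li.finite_measure_mono; auto)+
    show "integrable (?L j) (\<lambda>w. measure (?L i) {t. t < w})"
      "integrable (?L j) (\<lambda>w. measure (?L i) {t. t \<le> w})"
      using unit_law_integrable[OF L borel_measurable_mono[OF m(1)] b]
        unit_law_integrable[OF L borel_measurable_mono[OF m(2)] b] by blast+
    show "measure (?L i) {t. t < w} \<le> measure (?L i) {t. t \<le> w}" for w
      by (intro Li.finite_measure_mono) auto
  qed
  also have "\<dots> \<le> 2 * (var (?L i) + var (?L j)) / \<Delta>\<^sup>2"
    by (rule chebyshev_pair[OF L L \<Delta>0 \<Delta>])
  also have "\<dots> \<le> 2 * ((real p + 1) / A + (real p + 1) / A) / \<Delta>\<^sup>2"
    using v[of i] v[of j] by (intro divide_right_mono mult_left_mono add_mono) auto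
  also have "\<dots> = 1296 * (real p + 1) * A / (real d)\<^sup>2"
    using A d0 by (simp add: \<Delta>_def power_divide power_mult_distrib power2_eq_square field_simps)
  also have "\<dots> \<le> 1 / 12" using d d0 by (simp add: A_def divide_le_eq algebra_simps)
  finally show ?thesis .
qed

section \<open>The gap sum\<close>

definition below :: "'a set \<Rightarrow> 'a rel \<Rightarrow> 'a \<Rightarrow> 'a set" where
  "below V r x = {y \<in> V. (y, x) \<in> r \<and> y \<noteq> x}"

lemma max_below_eq: "max_below V r F x = (if below V r x = {} then 0 else Max (F ` below V r x))"
  by (simp only: max_below_def below_def Let_def)

lemma finite_below: "finite V \<Longrightarrow> finite (below V r x)"
  by (simp add: below_def)

lemma below_subset: "below V r x \<subseteq> V"
  by (auto simp: below_def)

lemma max_below_measurable [measurable]: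
  assumes "finite V"
  shows "(\<lambda>F. max_below V r F x) \<in> borel_measurable (lebP V)"
proof (cases "below V r x = {}")
  case False
  have "(\<lambda>F. Max ((\<lambda>i. F i) ` below V r x)) \<in> borel_measurable (lebP V)"
  proof (rule borel_measurable_Max)
    fix i assume "i \<in> below V r x"
    then have "i \<in> V" by (simp add: below_def)
    then show "(\<lambda>F. F i) \<in> borel_measurable (lebP V)" by measurable
  qed (rule finite_below[OF assms])
  then show ?thesis by (simp only: max_below_eq False if_False)
qed (simp add: max_below_eq)

lemma gap_bounds:
  assumes V: "finite V" and F: "F \<in> order_polytope V r" and x: "x \<in> V"
  shows "0 \<le> max_below V r F x" "max_below V r F x \<le> F x" "F x \<le> 1"
proof -
  have F1: "0 \<le> F y \<and> F y \<le> 1" if "y \<in> V" for y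
    using F that by (auto simp: order_polytope_def PiE_iff)
  have F2: "F y \<le> F x" if "y \<in> below V r x" for y
    using F that x by (auto simp: order_polytope_def below_def)
  note fb = finite_below[OF V, of r x]
  show "F x \<le> 1" using F1 x by simp
  show "max_below V r F x \<le> F x"
    using F1[OF x] F2 fb by (auto simp: max_below_eq)
  show "0 \<le> max_below V r F x"
  proof (cases "below V r x = {}")
    case False
    then obtain y where y: "y \<in> below V r x" by blast
    then have "0 \<le> F y" using F1[of y] by (simp add: below_def)
    then show ?thesis using y fb False by (auto simp: max_below_eq Max_ge_iff)
  qed (simp add: max_below_eq)
qed

lemma integrable_gap:
  assumes V: "finite_poset V r" and x: "x \<in> V"
  shows "integrable (random_point V r) (\<lambda>F. F x - max_below V r F x)"
proof -
  interpret prob_space "random_point V r" by (rule prob_space_random_point[OF V])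
  note fin = finite_poset_finite[OF V]
  have "AE F in random_point V r. norm (F x - max_below V r F x) \<le> 1"
    using AE_random_point_in[OF V]
  proof eventually_elim
    case (elim F)
    then show ?case using gap_bounds[OF fin elim x] by simp
  qed
  moreover have "(\<lambda>F. F x - max_below V r F x) \<in> borel_measurable (random_point V r)"
    using x max_below_measurable[OF fin, of r x]
    by (intro borel_measurable_diff measurable_coord)
      (simp_all add: measurable_cong_sets[OF sets_random_point refl])
  ultimately show ?thesis by (rule integrable_const_bound)
qed

lemma mean_gap_nonneg:
  assumes V: "finite_poset V r" and x: "x \<in> V"
  shows "0 \<le> mean_gap V r x"
  unfolding mean_gap_def
proof (rule integral_nonneg_AE)
  show "AE F in random_point V r. 0 \<le> F x - max_below V r F x"
    using AE_random_point_in[OF V]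
  proof eventually_elim
    case (elim F)
    then show ?case using gap_bounds[OF finite_poset_finite[OF V] elim x] by simp
  qed
qed

lemma
  fixes f :: "'a \<Rightarrow> real" and g :: "'b \<Rightarrow> real"
  assumes M: "prob_space M" and N: "prob_space N" and f: "integrable M f" and g: "integrable N g"
  shows integrable_pair_product: "integrable (M \<Otimes>\<^sub>M N) (\<lambda>z. f (fst z) * g (snd z))"
    and integral_pair_product:
      "(\<integral>z. f (fst z) * g (snd z) \<partial>(M \<Otimes>\<^sub>M N)) = integral\<^sup>L M f * integral\<^sup>L N g"
proof -
  interpret M: prob_space M by fact
  interpret N: prob_space N by fact
  interpret MN: pair_prob_space M N ..
  note mf = borel_measurable_integrable[OF f]
  note mg = borel_measurable_integrable[OF g]
  show int: "integrable (M \<Otimes>\<^sub>M N) (\<lambda>z. f (fst z) * g (snd z))"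
  proof (rule MN.Fubini_integrable)
    show "(\<lambda>z. f (fst z) * g (snd z)) \<in> borel_measurable (M \<Otimes>\<^sub>M N)"
      by (rule borel_measurable_times[OF measurable_compose[OF measurable_fst mf] measurable_compose[OF measurable_snd mg]])
    have "integrable M (\<lambda>x. \<bar>f x\<bar> * (\<integral>y. \<bar>g y\<bar> \<partial>N))" using f by simp
    then show "integrable M (\<lambda>x. \<integral>y. norm (f (fst (x, y)) * g (snd (x, y))) \<partial>N)"
      by (simp add: abs_mult)
    show "AE x in M. integrable N (\<lambda>y. f (fst (x, y)) * g (snd (x, y)))" using g by simp
  qed
  have "(\<integral>z. f (fst z) * g (snd z) \<partial>(M \<Otimes>\<^sub>M N)) = (\<integral>x. (\<integral>y. f (fst (x, y)) * g (snd (x, y)) \<partial>N) \<partial>M)"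
    by (rule MN.integral_fst'[OF int, symmetric])
  also have "\<dots> = integral\<^sup>L M f * integral\<^sup>L N g" by simp
  finally show "(\<integral>z. f (fst z) * g (snd z) \<partial>(M \<Otimes>\<^sub>M N)) = integral\<^sup>L M f * integral\<^sup>L N g" .
qed

lemma Max_affine_image:
  fixes c t :: real
  assumes "finite B" "B \<noteq> {}" "c \<ge> 0"
  shows "Max ((\<lambda>y. t + c * F y) ` B) = t + c * Max (F ` B)"
proof -
  have "mono (\<lambda>u. t + c * u)" using assms(3) by (intro monoI) (simp add: mult_left_mono)
  from mono_Max_commute[OF this, of "F ` B"] show ?thesis
    using assms by (simp add: image_image)
qed

text \<open>Below an element of \<open>V\<close> nothing changes, so its gap is scaled by
  \<open>s\<close>. For an element of \<open>D\<close> the values on \<open>V\<close> are dominated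
  by that of \<open>e\<close>, so the gap is the one in \<open>D\<close> scaled by
  \<open>1 - s\<close>. As \<open>s\<close> is independent of both parts, means multiply.\<close>

lemma mean_gap_osum:
  assumes V: "finite_poset V r" and D: "finite_poset D d"
    and dj: "V \<inter> D = {}" "e \<notin> V" "e \<notin> D"
  defines "P \<equiv> insert e (V \<union> D)" and "R \<equiv> osum V r e D d"
    and "\<beta> \<equiv> (real (card V) + 1) / (real (card V) + real (card D) + 2)"
  shows "x \<in> V \<Longrightarrow> mean_gap P R x = \<beta> * mean_gap V r x"
    and "x \<in> D \<Longrightarrow> mean_gap P R x = (1 - \<beta>) * mean_gap D d x"
proof -
  let ?B = "beta_distr (card V) (card D)"
  let ?VD = "random_point V r \<Otimes>\<^sub>M random_point D d"
  note sub = finite_poset_subset[OF V] finite_poset_subset[OF D]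
  have P: "finite_poset P R" unfolding P_def R_def by (rule finite_poset_osum[OF V D dj])
  have fin: "finite V" "finite D" "finite P" using V D P by (auto simp: finite_poset_def)
  interpret B: prob_space ?B by (rule prob_space_beta_distr)
  interpret mV: prob_space "random_point V r" by (rule prob_space_random_point[OF V])
  interpret mD: prob_space "random_point D d" by (rule prob_space_random_point[OF D])
  interpret VD: pair_prob_space "random_point V r" "random_point D d" ..
  interpret BVD: pair_prob_space ?B ?VD ..
  have om: "osum_map V e D \<in> ?B \<Otimes>\<^sub>M ?VD \<rightarrow>\<^sub>M lebP P"
    unfolding P_def by (rule osum_map_measurable) auto
  have rp: "random_point P R = distr (?B \<Otimes>\<^sub>M ?VD) (lebP P) (osum_map V e D)"
    unfolding P_def R_def by (rule random_point_osum(1)[OF V D dj])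
  have inP: "AE z in ?B \<Otimes>\<^sub>M ?VD. osum_map V e D z \<in> order_polytope P R"
    using AE_random_point_in[OF P] unfolding rp by (rule AE_distrD[OF om])
  have intB: "integrable ?B (\<lambda>s. s)" "integrable ?B (\<lambda>s. 1 - s)"
    by (rule integrable_beta_distr[of _ 1]; simp)+
  have Es: "(\<integral>s. s \<partial>?B) = \<beta>" "(\<integral>s. 1 - s \<partial>?B) = 1 - \<beta>"
    using intB B.prob_space by (simp_all add: beta_distr_mean \<beta>_def)
  have mg: "mean_gap P R x = (\<integral>z. osum_map V e D z x - max_below P R (osum_map V e D z) x \<partial>(?B \<Otimes>\<^sub>M ?VD))"
    if "x \<in> P" for x
    unfolding mean_gap_def rp
  proof (rule integral_distr[OF om])
    have "(\<lambda>F. F x) \<in> borel_measurable (lebP P)" using that by measurable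
    then show "(\<lambda>F. F x - max_below P R F x) \<in> borel_measurable (lebP P)"
      using max_below_measurable[OF fin(3), of R x] by (rule borel_measurable_diff)
  qed
  have mgm: "(\<lambda>z. osum_map V e D z x - max_below P R (osum_map V e D z) x) \<in> borel_measurable (?B \<Otimes>\<^sub>M ?VD)"
    if "x \<in> P" for x
  proof -
    have "(\<lambda>F. F x) \<in> borel_measurable (lebP P)" using that by measurable
    then have "(\<lambda>F. F x - max_below P R F x) \<in> borel_measurable (lebP P)"
      using max_below_measurable[OF fin(3), of R x] by (rule borel_measurable_diff)
    from measurable_compose[OF om this] show ?thesis .
  qed
  show "mean_gap P R x = \<beta> * mean_gap V r x" if x: "x \<in> V"
  proof -
    let ?g = "\<lambda>F. F x - max_below V r F x"
    have xP: "x \<in> P" using x by (simp add: P_def)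
    have bel: "below P R x = below V r x"
      using x sub dj by (auto simp: below_def P_def R_def osum_def)
    have ig: "integrable ?VD (\<lambda>y. ?g (fst y))"
      using integrable_pair_product[OF mV.prob_space_axioms mD.prob_space_axioms integrable_gap[OF V x], of "\<lambda>_. 1"]
      by simp
    have Eg: "(\<integral>y. ?g (fst y) \<partial>?VD) = mean_gap V r x"
      using integral_pair_product[OF mV.prob_space_axioms mD.prob_space_axioms integrable_gap[OF V x], of "\<lambda>_. 1"]
        mD.prob_space by (simp add: mean_gap_def)
    have "mean_gap P R x = (\<integral>z. fst z * ?g (fst (snd z)) \<partial>(?B \<Otimes>\<^sub>M ?VD))"
      unfolding mg[OF xP]
    proof (rule integral_cong_AE)
      show "(\<lambda>z. osum_map V e D z x - max_below P R (osum_map V e D z) x) \<in> borel_measurable (?B \<Otimes>\<^sub>M ?VD)"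
        by (rule mgm[OF xP])
      have "(\<lambda>y. ?g (fst y)) \<in> borel_measurable ?VD" using ig by (rule borel_measurable_integrable)
      from measurable_compose[OF measurable_snd this, of ?B]
      show "(\<lambda>z. fst z * ?g (fst (snd z))) \<in> borel_measurable (?B \<Otimes>\<^sub>M ?VD)"
        by (rule borel_measurable_times[rotated]) simp
      show "AE z in ?B \<Otimes>\<^sub>M ?VD. osum_map V e D z x - max_below P R (osum_map V e D z) x =
          fst z * ?g (fst (snd z))"
        using inP
      proof eventually_elim
        case (elim z)
        obtain s F G where z: "z = (s, F, G)" by (cases z) auto
        have "osum_map V e D z e = s" using dj by (simp add: z osum_map_def)
        moreover have "0 \<le> osum_map V e D z e" using elim by (auto simp: order_polytope_def PiE_iff P_def)
        ultimately have s: "0 \<le> s" by simp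
        have val: "osum_map V e D z y = 0 + s * F y" if "y \<in> V" for y
          using that by (simp add: z osum_map_def)
        then have "osum_map V e D z ` below V r x = (\<lambda>y. 0 + s * F y) ` below V r x"
          using below_subset[of V r x] by (intro image_cong) auto
        then show ?case
          using Max_affine_image[OF finite_below[OF fin(1)], of r x s 0 F] s val[OF x]
          by (auto simp: max_below_eq bel z right_diff_distrib)
      qed
    qed
    also have "\<dots> = \<beta> * mean_gap V r x"
      using integral_pair_product[OF B.prob_space_axioms VD.prob_space_axioms intB(1) ig] Es Eg by simp
    finally show ?thesis .
  qed
  show "mean_gap P R x = (1 - \<beta>) * mean_gap D d x" if x: "x \<in> D"
  proof -
    let ?g = "\<lambda>F. F x - max_below D d F x"
    have xP: "x \<in> P" using x by (simp add: P_def)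
    have bel: "below P R x = V \<union> insert e (below D d x)"
      using x sub dj by (auto simp: below_def P_def R_def osum_def)
    have ig: "integrable ?VD (\<lambda>y. ?g (snd y))"
      using integrable_pair_product[OF mV.prob_space_axioms mD.prob_space_axioms _ integrable_gap[OF D x], of "\<lambda>_. 1"]
      by simp
    have Eg: "(\<integral>y. ?g (snd y) \<partial>?VD) = mean_gap D d x"
      using integral_pair_product[OF mV.prob_space_axioms mD.prob_space_axioms _ integrable_gap[OF D x], of "\<lambda>_. 1"]
        mV.prob_space by (simp add: mean_gap_def)
    have "mean_gap P R x = (\<integral>z. (1 - fst z) * ?g (snd (snd z)) \<partial>(?B \<Otimes>\<^sub>M ?VD))"
      unfolding mg[OF xP]
    proof (rule integral_cong_AE)
      show "(\<lambda>z. osum_map V e D z x - max_below P R (osum_map V e D z) x) \<in> borel_measurable (?B \<Otimes>\<^sub>M ?VD)"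
        by (rule mgm[OF xP])
      have "(\<lambda>y. ?g (snd y)) \<in> borel_measurable ?VD" using ig by (rule borel_measurable_integrable)
      from measurable_compose[OF measurable_snd this, of ?B]
      show "(\<lambda>z. (1 - fst z) * ?g (snd (snd z))) \<in> borel_measurable (?B \<Otimes>\<^sub>M ?VD)"
        by (rule borel_measurable_times[rotated]) simp
      show "AE z in ?B \<Otimes>\<^sub>M ?VD. osum_map V e D z x - max_below P R (osum_map V e D z) x =
          (1 - fst z) * ?g (snd (snd z))"
        using inP
      proof eventually_elim
        case (elim z)
        obtain s F G where z: "z = (s, F, G)" by (cases z) auto
        let ?z = "osum_map V e D z"
        have ze: "?z e = s" using dj by (simp add: z osum_map_def)
        have zP: "0 \<le> ?z y \<and> ?z y \<le> 1" if "y \<in> P" for y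
          using elim that by (auto simp: order_polytope_def PiE_iff)
        have zr: "?z y \<le> ?z y'" if "(y, y') \<in> R" "y \<noteq> y'" "y \<in> P" "y' \<in> P" for y y'
          using elim that by (auto simp: order_polytope_def)
        have s: "0 \<le> s" "s \<le> 1" using zP[of e] ze by (auto simp: P_def)
        have zV: "?z y \<le> s" if "y \<in> V" for y
          using zr[of y e] that dj ze by (auto simp: P_def R_def osum_def)
        have zD: "?z y = s + (1 - s) * G y" if "y \<in> D" for y
          using that dj by (auto simp: z osum_map_def)
        have zDs: "s \<le> ?z y" if "y \<in> D" for y
          using zr[of e y] that dj ze by (auto simp: P_def R_def osum_def)
        have finb: "finite (V \<union> insert e (below D d x))" using fin finite_below[OF fin(2)] by simp
        have img: "?z ` below D d x = (\<lambda>y. s + (1 - s) * G y) ` below D d x"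
          using below_subset[of D d x] zD by (intro image_cong) auto
        have "Max (?z ` (V \<union> insert e (below D d x))) = s + (1 - s) * max_below D d G x"
        proof (cases "below D d x = {}")
          \<comment> \<open>For a minimal element of \<open>D\<close> the maximum is the value
            \<open>s\<close> of \<open>e\<close>, which is the image of the default value 0 of
            \<open>max_below\<close> under u to s + (1 - s) u.\<close>
          case True
          have "Max (?z ` (V \<union> insert e (below D d x))) = s"
            using True zV ze fin by (intro Max_eqI) auto
          then show ?thesis using True by (simp add: max_below_eq)
        next
          case False
          have m: "Max (?z ` below D d x) = s + (1 - s) * Max (G ` below D d x)"
            unfolding img using s False finite_below[OF fin(2)] by (intro Max_affine_image) auto
          have "Max (?z ` (V \<union> insert e (below D d x))) = Max (?z ` below D d x)"
          proof (rule Max_eqI)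
            have fb: "finite (?z ` below D d x)" using finite_below[OF fin(2)] by simp
            have "?z ` below D d x \<noteq> {}" using False by simp
            from Max_in[OF fb this] show "Max (?z ` below D d x) \<in> ?z ` (V \<union> insert e (below D d x))"
              by (rule rev_subsetD) auto
            obtain y0 where y0: "y0 \<in> below D d x" using False by blast
            have "s \<le> ?z y0" using zDs y0 below_subset[of D d x] by blast
            also have "\<dots> \<le> Max (?z ` below D d x)" using y0 fb by simp
            finally have sM: "s \<le> Max (?z ` below D d x)" .
            fix u assume "u \<in> ?z ` (V \<union> insert e (below D d x))"
            then show "u \<le> Max (?z ` below D d x)"
              using sM zV ze fb by (auto intro: order_trans)
          qed (use finb in simp)
          then show ?thesis using m False by (simp add: max_below_eq)
        qed
        then have "max_below P R ?z x = s + (1 - s) * max_below D d G x"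
          by (simp add: max_below_eq[of P] bel)
        then show ?case using zD[OF x] by (simp add: z right_diff_distrib)
      qed
    qed
    also have "\<dots> = (1 - \<beta>) * mean_gap D d x"
      using integral_pair_product[OF B.prob_space_axioms VD.prob_space_axioms intB(2) ig] Es Eg by simp
    finally show ?thesis .
  qed
qed

lemma gap_sum_nonneg: "finite_poset V r \<Longrightarrow> 0 \<le> gap_sum V r"
  unfolding gap_sum_def by (intro sum_nonneg mean_gap_nonneg)

text \<open>The only term dropped is the nonnegative gap of \<open>e\<close> itself.\<close>

lemma gap_sum_osum:
  assumes V: "finite_poset V r" and D: "finite_poset D d"
    and dj: "V \<inter> D = {}" "e \<notin> V" "e \<notin> D"
  defines "\<beta> \<equiv> (real (card V) + 1) / (real (card V) + real (card D) + 2)"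
  shows "gap_sum (insert e (V \<union> D)) (osum V r e D d) \<ge> \<beta> * gap_sum V r + (1 - \<beta>) * gap_sum D d"
proof -
  let ?P = "insert e (V \<union> D)"
  let ?R = "osum V r e D d"
  have fin: "finite V" "finite D" using V D by (auto simp: finite_poset_def)
  have P: "finite_poset ?P ?R" by (rule finite_poset_osum[OF V D dj])
  have "gap_sum ?P ?R = mean_gap ?P ?R e + ((\<Sum>x\<in>V. mean_gap ?P ?R x) + (\<Sum>x\<in>D. mean_gap ?P ?R x))"
    unfolding gap_sum_def using fin dj by (simp add: sum.union_disjoint)
  also have "\<dots> = mean_gap ?P ?R e + (\<beta> * gap_sum V r + (1 - \<beta>) * gap_sum D d)"
    using mean_gap_osum[OF V D dj]
    by (simp add: gap_sum_def \<beta>_def sum_distrib_left)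
  finally show ?thesis using mean_gap_nonneg[OF P, of e] by simp
qed

text \<open>The identity relation is its own converse, so the reflection F to 1 - F preserves the
  law and each coordinate has mean 1/2; no element has anything below it.\<close>

lemma gap_sum_antichain:
  assumes D: "finite D"
  shows "gap_sum D (Id_on D) = real (card D) / 2"
proof -
  have P: "finite_poset D (Id_on D)" by (rule finite_poset_Id_on[OF D])
  interpret prob_space "random_point D (Id_on D)" by (rule prob_space_random_point[OF P])
  have "mean_gap D (Id_on D) x = 1 / 2" if x: "x \<in> D" for x
  proof -
    have mb: "max_below D (Id_on D) F x = 0" for F by (auto simp: max_below_eq below_def)
    have i: "integrable (random_point D (Id_on D)) (\<lambda>F. F x)"
      using integrable_gap[OF P x] by (simp add: mb)
    let ?T = "\<lambda>F. \<lambda>i\<in>D. (1::real) - F i"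
    have "?T \<in> lebP D \<rightarrow>\<^sub>M lebP D" by measurable
    then have T: "?T \<in> random_point D (Id_on D) \<rightarrow>\<^sub>M lebP D"
      by (simp add: measurable_cong_sets[OF sets_random_point refl])
    have m: "(\<lambda>F. F x) \<in> borel_measurable (lebP D)" using x by measurable
    have "random_point D (Id_on D) = distr (random_point D (Id_on D)) (lebP D) ?T"
      using random_point_converse[OF P] by simp
    then have "expectation (\<lambda>F. F x) = integral\<^sup>L (distr (random_point D (Id_on D)) (lebP D) ?T) (\<lambda>F. F x)"
      by simp
    also have "\<dots> = expectation (\<lambda>F. ?T F x)" by (rule integral_distr[OF T m])
    also have "\<dots> = 1 - expectation (\<lambda>F. F x)" using x i prob_space by simp
    finally have "expectation (\<lambda>F. F x) = 1 / 2" by simp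
    then show ?thesis by (simp add: mean_gap_def mb)
  qed
  then have "gap_sum D (Id_on D) = (\<Sum>x\<in>D. 1 / 2)"
    unfolding gap_sum_def by (intro sum.cong) auto
  then show ?thesis by simp
qed

section \<open>Stacks of antichains\<close>

text \<open>An antichain that is a module of the order: every permutation of \<open>B\<close>,
  extended by the identity, is an automorphism. The condition is local enough to survive ordinal
  sums on either side.\<close>

definition twins :: "'a set \<Rightarrow> 'a rel \<Rightarrow> 'a set \<Rightarrow> bool" where
  "twins V r B \<longleftrightarrow> antichain V r B \<and>
     (\<forall>x\<in>B. \<forall>x'\<in>B. \<forall>y\<in>V - B. ((x, y) \<in> r \<longleftrightarrow> (x', y) \<in> r) \<and> ((y, x) \<in> r \<longleftrightarrow> (y, x') \<in> r))"

lemma twins_osum_lower: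
  assumes "twins V r B" "finite_poset V r" "finite_poset D d" "V \<inter> D = {}" "e \<notin> V" "e \<notin> D"
  shows "twins (insert e (V \<union> D)) (osum V r e D d) B"
proof -
  note sub = finite_poset_subset[OF assms(2)] finite_poset_subset[OF assms(3)]
  have B: "antichain V r B" "B \<subseteq> V" using assms(1) by (auto simp: twins_def antichain_def)
  have "antichain (insert e (V \<union> D)) (osum V r e D d) B"
    by (rule antichain_osum_lower[OF B(1) assms(2-6)])
  moreover have "((x, y) \<in> osum V r e D d \<longleftrightarrow> (x', y) \<in> osum V r e D d) \<and>
      ((y, x) \<in> osum V r e D d \<longleftrightarrow> (y, x') \<in> osum V r e D d)"
    if xy: "x \<in> B" "x' \<in> B" "y \<in> insert e (V \<union> D) - B" for x x' y
  proof (cases "y \<in> V")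
    case True
    have eq: "(u, y) \<in> osum V r e D d \<longleftrightarrow> (u, y) \<in> r" "(y, u) \<in> osum V r e D d \<longleftrightarrow> (y, u) \<in> r" if "u \<in> B" for u
      using that B(2) True sub assms(4-6) by (auto simp: osum_def)
    have "y \<in> V - B" using True xy(3) by simp
    then have "((x, y) \<in> r \<longleftrightarrow> (x', y) \<in> r) \<and> ((y, x) \<in> r \<longleftrightarrow> (y, x') \<in> r)"
      using assms(1) xy(1,2) unfolding twins_def by blast
    then show ?thesis by (simp only: eq[OF xy(1)] eq[OF xy(2)])
  next
    case False
    have "(u, y) \<in> osum V r e D d" "(y, u) \<notin> osum V r e D d" if "u \<in> B" for u
      using that B(2) False xy(3) sub assms(4-6) by (auto simp: osum_def)
    then show ?thesis using xy by blast
  qed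
  ultimately show ?thesis unfolding twins_def by blast
qed

lemma twins_osum_upper:
  assumes "twins D d B" "finite_poset V r" "finite_poset D d" "V \<inter> D = {}" "e \<notin> V" "e \<notin> D"
  shows "twins (insert e (V \<union> D)) (osum V r e D d) B"
proof -
  note sub = finite_poset_subset[OF assms(2)] finite_poset_subset[OF assms(3)]
  have B: "antichain D d B" "B \<subseteq> D" using assms(1) by (auto simp: twins_def antichain_def)
  have "(x, y) \<notin> osum V r e D d" if "x \<in> B" "y \<in> B" "x \<noteq> y" for x y
    using that B sub assms(4-6) by (auto simp: osum_def antichain_def)
  then have "antichain (insert e (V \<union> D)) (osum V r e D d) B"
    using B(2) by (auto simp: antichain_def)
  moreover have "((x, y) \<in> osum V r e D d \<longleftrightarrow> (x', y) \<in> osum V r e D d) \<and>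
      ((y, x) \<in> osum V r e D d \<longleftrightarrow> (y, x') \<in> osum V r e D d)"
    if xy: "x \<in> B" "x' \<in> B" "y \<in> insert e (V \<union> D) - B" for x x' y
  proof (cases "y \<in> D")
    case True
    have eq: "(u, y) \<in> osum V r e D d \<longleftrightarrow> (u, y) \<in> d" "(y, u) \<in> osum V r e D d \<longleftrightarrow> (y, u) \<in> d" if "u \<in> B" for u
      using that B(2) True sub assms(4-6) by (auto simp: osum_def)
    have "y \<in> D - B" using True xy(3) by simp
    then have "((x, y) \<in> d \<longleftrightarrow> (x', y) \<in> d) \<and> ((y, x) \<in> d \<longleftrightarrow> (y, x') \<in> d)"
      using assms(1) xy(1,2) unfolding twins_def by blast
    then show ?thesis by (simp only: eq[OF xy(1)] eq[OF xy(2)])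
  next
    case False
    have "(u, y) \<notin> osum V r e D d" "(y, u) \<in> osum V r e D d" if "u \<in> B" for u
      using that B(2) False xy(3) sub assms(4-6) by (auto simp: osum_def)
    then show ?thesis using xy by blast
  qed
  ultimately show ?thesis unfolding twins_def by blast
qed

text \<open>The stack has T + 1 antichains of size \<open>m\<close> and \<open>T\<close> separating
  points. A convex combination of numbers that are at least m/2 is again at least m/2, so the bound
  on the gap sum does not depend on \<open>T\<close>, and the height is free to be adapted to the
  poset below.\<close>

lemma stack_exists:
  assumes m: "m \<ge> 1"
  shows "\<exists>d B. finite_poset {s..<s + (T * (m + 1) + m)} d \<and>
    (\<forall>I. antichain {s..<s + (T * (m + 1) + m)} d I \<longrightarrow> card I \<le> m) \<and>
    real m / 2 \<le> gap_sum {s..<s + (T * (m + 1) + m)} d \<and>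
    twins {s..<s + (T * (m + 1) + m)} d B \<and> card B = m"
proof (induction T)
  case 0
  let ?D = "{s..<s + m}"
  have "card I \<le> m" if "antichain ?D (Id_on ?D) I" for I
    using that card_mono[of ?D I] by (auto simp: antichain_def)
  moreover have "twins ?D (Id_on ?D) ?D" by (auto simp: twins_def antichain_def)
  moreover have "real m / 2 \<le> gap_sum ?D (Id_on ?D)" by (simp add: gap_sum_antichain)
  ultimately show ?case
    using finite_poset_Id_on[of ?D] by (intro exI[of _ "Id_on ?D"] exI[of _ ?D]) auto
next
  case (Suc T)
  define q where "q = T * (m + 1) + m"
  let ?V = "{s..<s + q}"
  let ?D = "{s + q + 1..<s + q + 1 + m}"
  let ?d = "Id_on ?D"
  obtain r B where V: "finite_poset ?V r" "\<And>I. antichain ?V r I \<Longrightarrow> card I \<le> m"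
    "real m / 2 \<le> gap_sum ?V r" "twins ?V r B" "card B = m"
    using Suc unfolding q_def by blast
  let ?R = "osum ?V r (s + q) ?D ?d"
  have U: "insert (s + q) (?V \<union> ?D) = {s..<s + (Suc T * (m + 1) + m)}" by (auto simp: q_def)
  have D: "finite_poset ?D ?d" by (rule finite_poset_Id_on) simp
  have dj: "?V \<inter> ?D = {}" "s + q \<notin> ?V" "s + q \<notin> ?D" by auto
  let ?\<beta> = "(real (card ?V) + 1) / (real (card ?V) + real (card ?D) + 2)"
  have \<beta>: "0 \<le> ?\<beta>" "?\<beta> \<le> 1" by (auto simp: divide_le_eq)
  have "real m / 2 = ?\<beta> * (real m / 2) + (1 - ?\<beta>) * (real m / 2)" by (simp add: algebra_simps)
  also have "\<dots> \<le> ?\<beta> * gap_sum ?V r + (1 - ?\<beta>) * gap_sum ?D ?d"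
    using \<beta> V(3) gap_sum_antichain[of ?D] by (intro add_mono mult_left_mono) auto
  also have "\<dots> \<le> gap_sum (insert (s + q) (?V \<union> ?D)) ?R"
    by (rule gap_sum_osum[OF V(1) D dj])
  finally have "real m / 2 \<le> gap_sum (insert (s + q) (?V \<union> ?D)) ?R" .
  moreover have "card I \<le> m" if I: "antichain (insert (s + q) (?V \<union> ?D)) ?R I" for I
    using antichain_osum_cases[OF I]
  proof (elim disjE)
    assume "antichain ?D ?d I"
    then show ?thesis using card_mono[of ?D I] by (auto simp: antichain_def)
  next
    assume "I \<subseteq> {s + q}"
    then show ?thesis using card_mono[of "{s + q}" I] m by auto
  qed (rule V(2))
  moreover have "twins (insert (s + q) (?V \<union> ?D)) ?R B"
    by (rule twins_osum_lower[OF V(4) V(1) D dj])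
  ultimately show ?case
    using V(5) finite_poset_osum[OF V(1) D dj] unfolding U by blast
qed

section \<open>Balance constants\<close>

lemma finite_tuples: "finite X \<Longrightarrow> finite {xs. length xs = k \<and> distinct xs \<and> set xs \<subseteq> X}"
  by (rule finite_subset[OF _ finite_lists_length_eq[of X k]]) auto

lemma tuples_nonempty:
  assumes "finite X" "k \<le> card X"
  shows "{xs. length xs = k \<and> distinct xs \<and> set xs \<subseteq> X} \<noteq> {}"
proof -
  obtain Y where Y: "Y \<subseteq> X" "card Y = k" using assms by (meson obtain_subset_with_card_n)
  then obtain xs where "set xs = Y" "distinct xs" using assms(1) finite_distinct_list finite_subset by metis
  then show ?thesis using Y distinct_card[of xs] by auto
qed

lemma delta_3_le:
  assumes X: "finite X" "3 \<le> card X" and T: "triples_unbalanced \<eta> V r X"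
  shows "delta 3 X V r \<le> 1 / 6 - \<eta>"
  unfolding delta_def
proof (rule Max.boundedI)
  fix t assume "t \<in> (\<lambda>xs. Min ((\<lambda>\<pi>. order_prob V r (permute_list \<pi> xs)) ` {\<pi>. \<pi> permutes {..<3::nat}})) `
    {xs. length xs = 3 \<and> distinct xs \<and> set xs \<subseteq> X}"
  then obtain xs where xs: "length xs = 3" "distinct xs" "set xs \<subseteq> X"
    and t: "t = Min ((\<lambda>\<pi>. order_prob V r (permute_list \<pi> xs)) ` {\<pi>. \<pi> permutes {..<3::nat}})" by auto
  obtain x y z where xyz: "xs = [x, y, z]"
    using xs(1) by (auto simp: numeral_3_eq_3 length_Suc_conv)
  have "unbalanced \<eta> V r x y z" using T xs by (auto simp: triples_unbalanced_def xyz)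
  then obtain ys where ys: "mset ys = {#x, y, z#}" "order_prob V r ys \<le> 1 / 6 - \<eta>"
    by (auto simp: unbalanced_def)
  have "mset ys = mset xs" using ys(1) by (simp add: xyz)
  then obtain \<pi> where \<pi>: "\<pi> permutes {..<length xs}" "permute_list \<pi> xs = ys"
    by (rule mset_eq_permutation)
  have "t \<le> order_prob V r ys"
    unfolding t using \<pi> xs(1) finite_permutations[of "{..<3::nat}"] by (intro Min_le) auto
  then show "t \<le> 1 / 6 - \<eta>" using ys(2) by simp
qed (use X finite_tuples[of X 3] tuples_nonempty[of X 3] in auto)

section \<open>Automorphisms and exact balance\<close>

lemma strict_sorted_unique:
  fixes F :: "'a \<Rightarrow> real"
  assumes "sorted_wrt (\<lambda>x y. F x < F y) xs" "sorted_wrt (\<lambda>x y. F x < F y) ys" "set xs = set ys"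
  shows "xs = ys"
proof -
  have s: "sorted_wrt (<) (map F xs)" "sorted_wrt (<) (map F ys)"
    using assms by (simp_all add: sorted_wrt_map)
  then have "map F xs = map F ys"
    using assms(3) by (intro sorted_distinct_set_unique) (auto simp: strict_sorted_iff)
  moreover have "inj_on F (set xs)" using s(1) by (simp add: strict_sorted_iff distinct_map)
  ultimately show ?thesis using assms(3) by (simp add: inj_on_map_eq_map)
qed

lemma permute_list_inj:
  assumes "distinct xs" "\<pi> permutes {..<length xs}" "\<rho> permutes {..<length xs}"
    and eq: "permute_list \<pi> xs = permute_list \<rho> xs"
  shows "\<pi> = \<rho>"
proof
  fix i
  show "\<pi> i = \<rho> i"
  proof (cases "i < length xs")
    case True
    have "xs ! \<pi> i = xs ! \<rho> i"
      using eq True permute_list_nth[OF assms(2) True] permute_list_nth[OF assms(3) True] by simp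
    moreover have "\<pi> i < length xs" "\<rho> i < length xs"
      using True assms(2,3) permutes_in_image by fastforce+
    ultimately show ?thesis using assms(1) by (simp add: nth_eq_iff_index_eq)
  next
    case False
    then show ?thesis using assms(2,3) by (simp add: permutes_not_in)
  qed
qed

text \<open>Almost surely the coordinates are distinct, and then exactly one rearrangement of
  \<open>xs\<close> is increasing, namely the one found by sorting with key
  \<open>F\<close>.\<close>

lemma sum_order_prob:
  assumes V: "finite_poset V r" and xs: "distinct xs" "set xs \<subseteq> V"
  shows "(\<Sum>\<pi> | \<pi> permutes {..<length xs}. order_prob V r (permute_list \<pi> xs)) = 1"
proof -
  interpret prob_space "random_point V r" by (rule prob_space_random_point[OF V])
  let ?S = "{\<pi>. \<pi> permutes {..<length xs}}"
  let ?E = "\<lambda>\<pi>. {F \<in> space (lebP V). sorted_wrt (\<lambda>x y. F x < F y) (permute_list \<pi> xs)}"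
  have set_eq: "set (permute_list \<pi> xs) = set xs" if "\<pi> \<in> ?S" for \<pi>
    using that by simp
  have ev: "?E \<pi> \<in> events" if "\<pi> \<in> ?S" for \<pi>
    unfolding sets_random_point using set_eq[OF that] xs(2) by (intro sets_sorted_wrt_less) simp
  have "(\<Sum>\<pi>\<in>?S. order_prob V r (permute_list \<pi> xs)) = (\<Sum>\<pi>\<in>?S. prob (?E \<pi>))"
    using xs(2) by (intro sum.cong refl order_prob_eq[OF V]) auto
  also have "\<dots> = prob (\<Union>\<pi>\<in>?S. ?E \<pi>)"
  proof (rule finite_measure_finite_Union[symmetric])
    show "finite ?S" by (simp add: finite_permutations)
    show "?E ` ?S \<subseteq> events" using ev by blast
    show "disjoint_family_on ?E ?S"
      unfolding disjoint_family_on_def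
    proof (intro ballI impI, rule ccontr)
      fix \<pi> \<rho> assume *: "\<pi> \<in> ?S" "\<rho> \<in> ?S" "\<pi> \<noteq> \<rho>" "?E \<pi> \<inter> ?E \<rho> \<noteq> {}"
      then obtain F :: "'a \<Rightarrow> real" where F: "sorted_wrt (\<lambda>x y. F x < F y) (permute_list \<pi> xs)"
        "sorted_wrt (\<lambda>x y. F x < F y) (permute_list \<rho> xs)" by blast
      have "permute_list \<pi> xs = permute_list \<rho> xs"
        using strict_sorted_unique[OF F] set_eq[OF *(1)] set_eq[OF *(2)] by simp
      then show False using permute_list_inj[OF xs(1)] * by blast
    qed
  qed
  also have "\<dots> = 1"
  proof (rule prob_eq_1[THEN iffD2])
    show "(\<Union>\<pi>\<in>?S. ?E \<pi>) \<in> events"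
      using ev by (intro sets.finite_UN) (auto simp: finite_permutations)
    show "AE F in random_point V r. F \<in> (\<Union>\<pi>\<in>?S. ?E \<pi>)"
      using AE_random_point_lebP[OF V AE_lebP_inj[OF finite_poset_finite[OF V]]] AE_space
    proof eventually_elim
      case (elim F)
      have "mset (sort_key F xs) = mset xs" by simp
      then obtain \<pi> where \<pi>: "\<pi> permutes {..<length xs}" "permute_list \<pi> xs = sort_key F xs"
        by (rule mset_eq_permutation)
      have inj: "inj_on F (set xs)" using elim(1) xs(2) by (rule inj_on_subset)
      have "sorted_wrt (<) (map F (sort_key F xs))"
        using xs(1) inj by (simp add: strict_sorted_iff distinct_map)
      then have "sorted_wrt (\<lambda>x y. F x < F y) (permute_list \<pi> xs)"
        by (simp add: \<pi>(2) sorted_wrt_map)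
      then show ?case using \<pi>(1) elim(2) by auto
    qed
  qed
  finally show ?thesis .
qed

text \<open>Pulling a linear extension back along \<open>\<tau>\<close> is injective and sends those
  that order \<open>map \<tau> xs\<close> to those that order \<open>xs\<close>. Equality is
  obtained later by exchanging the roles of the two tuples.\<close>

lemma order_prob_automorphism_le:
  assumes V: "finite_poset V r" and \<tau>: "\<tau> permutes V"
    and aut: "\<And>x y. (x, y) \<in> r \<Longrightarrow> (\<tau> x, \<tau> y) \<in> r"
  shows "order_prob V r (map \<tau> xs) \<le> order_prob V r xs"
proof -
  let ?L = "linear_extensions V r"
  have fin: "finite ?L" by (rule finite_linear_extensions[OF finite_poset_finite[OF V]])
  have ne: "?L \<noteq> {}" by (rule linear_extensions_nonempty[OF V])
  let ?E = "\<lambda>xs. {l. sorted_wrt (\<lambda>x y. (x, y) \<in> l \<and> x \<noteq> y) xs}"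
  let ?f = "\<lambda>l. inv_image l \<tau>"
  have inj\<tau>: "inj \<tau>" and surj\<tau>: "surj \<tau>" and in\<tau>: "\<tau> x \<in> V \<longleftrightarrow> x \<in> V" for x
    using permutes_inj[OF \<tau>] permutes_surj[OF \<tau>] permutes_in_image[OF \<tau>] by auto
  have "?f l \<in> ?L" if "l \<in> ?L" for l
  proof -
    have l: "l \<subseteq> V \<times> V" "refl_on V l" "trans l" "antisym l" "total_on V l" "r \<subseteq> l"
      using that by (auto simp: linear_extensions_def order_on_defs)
    have "?f l \<subseteq> V \<times> V" using l(1) in\<tau> by (auto simp: inv_image_def)
    moreover have "refl_on V (?f l)" using l(2) in\<tau> by (auto simp: inv_image_def refl_on_def)
    moreover have "trans (?f l)" by (rule trans_inv_image[OF l(3)])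
    moreover have "antisym (?f l)"
      using l(4) inj\<tau> by (auto simp: antisym_def inv_image_def dest: injD)
    moreover have "total_on V (?f l)"
      using l(5) in\<tau> inj\<tau> by (auto simp: total_on_def inv_image_def inj_eq)
    moreover have "r \<subseteq> ?f l" using l(6) aut by (auto simp: inv_image_def)
    ultimately show ?thesis by (auto simp: linear_extensions_def order_on_defs)
  qed
  moreover have "?f l \<in> ?E xs" if "l \<in> ?E (map \<tau> xs)" for l
    using that inj\<tau> by (simp add: sorted_wrt_map inv_image_def inj_eq)
  ultimately have sub: "?f ` (?L \<inter> ?E (map \<tau> xs)) \<subseteq> ?L \<inter> ?E xs" by blast
  have "inj ?f"
  proof (rule injI)
    fix l l' assume eq: "?f l = ?f l'"
    have "(x, y) \<in> l \<longleftrightarrow> (x, y) \<in> l'" for x y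
    proof -
      obtain x' y' where "x = \<tau> x'" "y = \<tau> y'" using surj\<tau> by (metis surjD)
      then show ?thesis using eq by (auto simp: inv_image_def set_eq_iff)
    qed
    then show "l = l'" by auto
  qed
  then have "card (?L \<inter> ?E (map \<tau> xs)) \<le> card (?L \<inter> ?E xs)"
    using sub fin by (intro card_inj_on_le) (auto intro: inj_on_subset)
  then show ?thesis
    unfolding order_prob_def measure_pmf_of_set[OF ne fin] by (simp add: divide_right_mono)
qed

text \<open>Inside \<open>B\<close> only reflexive pairs are related; in a pair with one end in
  \<open>B\<close> that end may be replaced by any other element of \<open>B\<close>; all other
  pairs are fixed.\<close>

lemma twins_automorphism:
  assumes V: "finite_poset V r" and B: "twins V r B" and \<tau>: "\<tau> permutes X" and X: "X \<subseteq> B"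
    and xy: "(x, y) \<in> r"
  shows "(\<tau> x, \<tau> y) \<in> r"
proof -
  have BV: "B \<subseteq> V" and anti: "\<And>x y. x \<in> B \<Longrightarrow> y \<in> B \<Longrightarrow> x \<noteq> y \<Longrightarrow> (x, y) \<notin> r"
    using B by (auto simp: twins_def antichain_def)
  have tw: "(u, v) \<in> r \<longleftrightarrow> (u', v) \<in> r" "(v, u) \<in> r \<longleftrightarrow> (v, u') \<in> r"
    if "u \<in> B" "u' \<in> B" "v \<in> V - B" for u u' v
    using B that unfolding twins_def by blast+
  have refl: "(u, u) \<in> r" if "u \<in> V" for u
    using V that by (auto simp: finite_poset_def order_on_defs refl_on_def)
  have xyV: "x \<in> V" "y \<in> V" using xy finite_poset_subset[OF V] by auto
  have \<tau>B: "\<tau> u \<in> B" if "u \<in> B" for u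
    using that X \<tau> by (metis permutes_in_image permutes_not_in subsetD)
  have \<tau>id: "\<tau> u = u" if "u \<notin> B" for u
    using that X \<tau> by (meson permutes_not_in subsetD)
  consider "x \<in> B" "y \<in> B" | "x \<in> B" "y \<notin> B" | "x \<notin> B" "y \<in> B" | "x \<notin> B" "y \<notin> B" by blast
  then show ?thesis
  proof cases
    case 1
    then have "x = y" using anti xy by blast
    then show ?thesis using refl \<tau>B[OF 1(1)] BV by auto
  next
    case 2
    then show ?thesis using tw(1)[OF \<open>x \<in> B\<close> \<tau>B[OF \<open>x \<in> B\<close>], of y] xy xyV \<tau>id[of y] by simp
  next
    case 3
    then show ?thesis using tw(2)[OF \<open>y \<in> B\<close> \<tau>B[OF \<open>y \<in> B\<close>], of x] xy xyV \<tau>id[of x] by simp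
  next
    case 4
    then show ?thesis using xy \<tau>id by simp
  qed
qed

lemma obtain_permutation_map:
  assumes "distinct xs" "distinct ys" "set xs = set ys"
  obtains \<tau> where "\<tau> permutes set xs" "map \<tau> xs = ys"
proof -
  have len: "length xs = length ys" using assms distinct_card by metis
  define g where "g = inv_into {..<length xs} ((!) xs)"
  define \<tau> where "\<tau> x = (if x \<in> set xs then ys ! g x else x)" for x
  have bx: "bij_betw ((!) xs) {..<length xs} (set xs)"
    using assms(1) by (intro bij_betw_nth) auto
  have bw: "bij_betw ((!) ys) {..<length xs} (set xs)"
    using assms len by (intro bij_betw_nth) auto
  have "bij_betw ((!) ys \<circ> g) (set xs) (set xs)"
    unfolding g_def using bij_betw_trans[OF bij_betw_inv_into[OF bx] bw] .
  then have "bij_betw \<tau> (set xs) (set xs)"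
    by (rule bij_betw_cong[THEN iffD1, rotated]) (simp add: \<tau>_def)
  then have "\<tau> permutes set xs" by (rule bij_imp_permutes) (simp add: \<tau>_def)
  moreover have "map \<tau> xs = ys"
  proof (rule nth_equalityI)
    fix i assume "i < length (map \<tau> xs)"
    then have i: "i < length xs" by simp
    have "g (xs ! i) = i"
      unfolding g_def using bx i by (intro inv_into_f_f) (auto simp: bij_betw_def)
    then show "map \<tau> xs ! i = ys ! i" using i by (simp add: \<tau>_def)
  qed (use len in simp)
  ultimately show thesis using that by blast
qed

lemma order_prob_twins:
  assumes V: "finite_poset V r" and B: "twins V r B"
    and xs: "distinct xs" "distinct ys" "set xs = set ys" "set xs \<subseteq> B"
  shows "order_prob V r ys \<le> order_prob V r xs"
proof -
  obtain \<tau> where \<tau>: "\<tau> permutes set xs" "map \<tau> xs = ys"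
    using obtain_permutation_map[OF xs(1-3)] by blast
  have "set xs \<subseteq> V" using xs(4) B by (auto simp: twins_def antichain_def)
  then have "\<tau> permutes V" using \<tau>(1) permutes_subset by blast
  from order_prob_automorphism_le[OF V this twins_automorphism[OF V B \<tau>(1) xs(4)], of xs]
  show ?thesis by (simp add: \<tau>(2))
qed

text \<open>In any poset the k! order probabilities of a tuple add up to 1, so their minimum is at
  most 1/k!. A tuple of twins attains this, because its order probabilities are all equal.\<close>

lemma delta_eq_inverse_fact:
  assumes V: "finite_poset V r" and B: "twins V r B" and k: "k \<le> card B"
  shows "delta k V V r = 1 / fact k"
proof -
  have BV: "B \<subseteq> V" using B by (auto simp: twins_def antichain_def)
  have finV: "finite V" by (rule finite_poset_finite[OF V])
  have finB: "finite B" using BV finV by (rule finite_subset)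
  let ?S = "{\<pi>. \<pi> permutes {..<k}}"
  let ?m = "\<lambda>xs. Min ((\<lambda>\<pi>. order_prob V r (permute_list \<pi> xs)) ` ?S)"
  let ?X = "{xs. length xs = k \<and> distinct xs \<and> set xs \<subseteq> V}"
  have finS: "finite ?S" by (simp add: finite_permutations)
  have neS: "?S \<noteq> {}" using permutes_id by blast
  have cS: "real (card ?S) = fact k" using card_permutations[of "{..<k}" k] by simp
  have finX: "finite (?m ` ?X)" using finite_tuples[OF finV] by (rule finite_imageI)
  show ?thesis
    unfolding delta_def
  proof (rule Max_eqI[OF finX])
    fix t assume "t \<in> ?m ` ?X"
    then obtain xs where xs: "length xs = k" "distinct xs" "set xs \<subseteq> V" and t: "t = ?m xs" by blast
    have "fact k * t = (\<Sum>\<pi>\<in>?S. t)" using cS by simp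
    also have "\<dots> \<le> (\<Sum>\<pi>\<in>?S. order_prob V r (permute_list \<pi> xs))"
      unfolding t using finS by (intro sum_mono Min_le) auto
    also have "\<dots> = 1" using sum_order_prob[OF V xs(2,3)] xs(1) by simp
    finally show "t \<le> 1 / fact k" by (simp add: field_simps)
  next
    obtain xs where xs: "length xs = k" "distinct xs" "set xs \<subseteq> B"
      using tuples_nonempty[OF finB k] by blast
    have xsV: "set xs \<subseteq> V" using xs(3) BV by blast
    have eq: "order_prob V r (permute_list \<pi> xs) = order_prob V r xs" if "\<pi> \<in> ?S" for \<pi>
    proof (rule antisym)
      have p: "distinct (permute_list \<pi> xs)" "set (permute_list \<pi> xs) = set xs"
        using that xs by simp_all
      show "order_prob V r (permute_list \<pi> xs) \<le> order_prob V r xs"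
        using p xs by (intro order_prob_twins[OF V B]) auto
      show "order_prob V r xs \<le> order_prob V r (permute_list \<pi> xs)"
        using p xs by (intro order_prob_twins[OF V B]) auto
    qed
    have "1 = (\<Sum>\<pi>\<in>?S. order_prob V r (permute_list \<pi> xs))"
      using sum_order_prob[OF V xs(2) xsV] xs(1) by simp
    also have "\<dots> = (\<Sum>\<pi>\<in>?S. order_prob V r xs)" using eq by (rule sum.cong[OF refl])
    also have "\<dots> = fact k * order_prob V r xs" using cS by simp
    finally have c: "order_prob V r xs = 1 / fact k" by (simp add: field_simps)
    have "(\<lambda>\<pi>. order_prob V r (permute_list \<pi> xs)) ` ?S = {1 / fact k}"
      using eq neS by (auto simp: c image_iff)
    then have "?m xs = 1 / fact k" by simp
    then show "1 / fact k \<in> ?m ` ?X" using xs xsV by (intro image_eqI[of _ _ xs]) auto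
  qed
qed

lemma width_eqI:
  assumes "finite V" "antichain V r A" "\<And>I. antichain V r I \<Longrightarrow> card I \<le> card A"
  shows "width V r = card A"
  unfolding width_def
proof (rule Max_eqI)
  have "{A. antichain V r A} \<subseteq> Pow V" by (auto simp: antichain_def)
  then show "finite (card ` {A. antichain V r A})"
    using assms(1) by (intro finite_imageI) (auto intro: finite_subset)
qed (use assms in auto)

section \<open>The posets of the theorem\<close>

text \<open>\<open>R\<close> is 125 (p + 1) because 125^2 = 15625 exceeds the constant 15552 of
  \<open>step_laws_separated\<close>; the spacing \<open>d\<close>, about R sqrt x, then separates
  the towers. \<open>J\<close> is the largest number with J d \<le> n, so a capped tower has at most
  3 n + 1 points, the family at most 3 x sqrt x, and, with a stack of comparable size, the whole
  poset at most 18 x sqrt x.\<close>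

lemma poset_exists:
  fixes p M K :: nat
  defines "R \<equiv> 125 * (p + 1)" and "x \<equiv> real (tower_size p M K) + 1"
  assumes p: "p \<ge> 1" and M: "M \<ge> 3" "16 * (8 * (real p + 1) + 1)\<^sup>2 \<le> real M" "16 * (real R)\<^sup>2 \<le> real M"
    and K: "K \<ge> 2"
  shows "\<exists>(V :: nat set) r A. finite_poset V r \<and> antichain V r A \<and> card A = width V r \<and> 2 ^ K \<le> card A \<and>
    delta 3 A V r \<le> 1 / 6 - gain (real p) \<and>
    sqrt x * 2 ^ K / (8 * real R) \<le> real (card A) \<and> real (card V) \<le> 18 * (x * sqrt x) \<and> card A \<le> card V \<and>
    real (card A) / 4 \<le> gap_sum V r \<and> (\<forall>k\<le>card A. delta k V V r = 1 / fact k)"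
proof -
  define n where "n = tower_size p M K"
  define N where "N = tower_law p M K"
  define d where "d = R * nat \<lceil>sqrt x\<rceil>"
  define J where "J = n div d"
  define m where "m = J * 2 ^ K"
  have x: "x = real n + 1" by (simp add: x_def n_def)
  have xn: "0 \<le> x" by (simp add: x)
  have R: "real R \<ge> 1" by (simp add: R_def)
  obtain k where k: "K = Suc k" using K by (cases K) auto
  have "2 * (M + 2) \<le> n" unfolding n_def k by (rule tower_size_Suc_ge)
  then have "real M \<le> x" by (simp add: x)
  then have x16: "16 * (real R)\<^sup>2 \<le> x" using M(3) by simp
  \<comment> \<open>The hypothesis that \<open>M\<close> is at least 16 R^2 enters here: it makes
    \<open>d\<close> at most x/2, so that at least one tower fits and rounding in \<open>J\<close>
    is harmless.\<close>
  have "4 * real R \<le> sqrt x"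
  proof (rule real_le_rsqrt)
    show "(4 * real R)\<^sup>2 \<le> x" using x16 by (simp add: power_mult_distrib)
  qed
  then have sx4: "4 * real R \<le> sqrt x" .
  then have sx: "sqrt x \<ge> 4" using R by linarith
  have xx: "sqrt x * sqrt x = x" by (simp add: x)
  have x0: "x \<ge> 16" using mult_mono[OF sx sx] xx by simp
  have ce: "sqrt x \<le> real (nat \<lceil>sqrt x\<rceil>)" "real (nat \<lceil>sqrt x\<rceil>) \<le> sqrt x + 1"
    using sx by linarith+
  have d1: "real R * sqrt x \<le> real d" unfolding d_def using ce R by (simp add: mult_left_mono)
  have "real (nat \<lceil>sqrt x\<rceil>) \<le> 2 * sqrt x" using ce sx by linarith
  then have "real d \<le> real R * (2 * sqrt x)" unfolding d_def of_nat_mult by (rule mult_left_mono) simp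
  then have d2: "real d \<le> 2 * real R * sqrt x" by simp
  have dx: "real d \<le> x / 2"
  proof -
    have "4 * real R * sqrt x \<le> sqrt x * sqrt x" using sx4 xn by (intro mult_right_mono) auto
    then show ?thesis using d2 xx by simp
  qed
  have d0: "d > 0"
  proof -
    have "0 < real R * sqrt x" using R sx by (intro mult_pos_pos) linarith+
    then show ?thesis using d1 by linarith
  qed
  have dn: "d \<le> n" using dx x0 x by linarith
  have J1: "J \<ge> 1" using dn d0 by (simp add: J_def div_greater_zero_iff Suc_le_eq)
  have Jd: "J * d \<le> n" by (simp add: J_def)
  \<comment> \<open>As \<open>J\<close> is at least 1, rounding down costs at most a factor 2 in the
    lower bound for the number of towers.\<close>
  have "n < d * (J + 1)" unfolding J_def using dividend_less_times_div[OF d0, of n] by (simp add: algebra_simps)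
  also have "\<dots> \<le> d * (2 * J)" using J1 by (intro mult_left_mono) auto
  finally have "real n < real (d * (2 * J))" by (simp only: of_nat_less_iff)
  then have "real n < 2 * real d * real J" by simp
  moreover have "x / 2 \<le> real n" using x x0 by simp
  moreover have "2 * real d * real J \<le> 2 * (2 * real R * sqrt x) * real J"
    using d2 by (intro mult_right_mono) auto
  ultimately have "sqrt x * sqrt x \<le> 8 * real R * real J * sqrt x" using xx by (simp add: mult_ac)
  then have "sqrt x \<le> 8 * real R * real J" by (rule mult_right_le_imp_le) (use sx in linarith)
  then have JL: "sqrt x / (8 * real R) \<le> real J" using R by (simp add: field_simps)
  have JU: "real J \<le> sqrt x"
  proof -
    have "real J * sqrt x \<le> real J * real d"
    proof (rule mult_left_mono)
      have "1 * sqrt x \<le> real R * sqrt x" using R xn by (intro mult_right_mono) auto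
      then show "sqrt x \<le> real d" using d1 by simp
    qed simp
    also have "\<dots> \<le> real n" using Jd by (simp only: of_nat_mult[symmetric] of_nat_le_iff)
    also have "\<dots> \<le> sqrt x * sqrt x" using xx x by simp
    finally show ?thesis by (rule mult_right_le_imp_le) (use sx in linarith)
  qed
  have Nu: "unit_law N" unfolding N_def by (rule tower_law_unit)
  have dd: "15552 * (real p + 1) * (real n + 1) \<le> (real d)\<^sup>2"
  proof -
    have "15552 * (real p + 1) * x \<le> (real R)\<^sup>2 * x"
    proof (rule mult_right_mono)
      have "15552 * (real p + 1) \<le> 15625 * ((real p + 1) * 1)" by simp
      also have "\<dots> \<le> 15625 * ((real p + 1) * (real p + 1))" by (intro mult_left_mono) auto
      finally have "15552 * (real p + 1) \<le> 15625 * ((real p + 1) * (real p + 1))" .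
      then show "15552 * (real p + 1) \<le> (real R)\<^sup>2" by (simp add: R_def power2_eq_square algebra_simps)
    qed (use x0 in simp)
    also have "\<dots> = (real R * sqrt x)\<^sup>2" using x0 by (simp add: power_mult_distrib)
    also have "\<dots> \<le> (real d)\<^sup>2" using d1 R xn by (intro power_mono) auto
    finally show ?thesis using x by (simp add: add.commute)
  qed
  have \<eta>: "gain (real p) \<le> 1 / 12" by (rule gain_le)
  have sep: "(\<integral>w. measure (step_law n (n + i * d) N) {t. t < w} \<partial>step_law n (n + j * d) N) \<le> 1 / 12"
    if ij: "i < j" "j < J" for i j
  proof (rule step_laws_separated[OF Nu _ _ dd ij(1)])
    show "mean N \<le> 1 / 2" unfolding N_def by (rule tower_law_mean[OF p M(1)])
    show "var N \<le> (real p + 1 / 2) / (real n + 1)" unfolding N_def n_def by (rule tower_law_var[OF p M(1)])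
    have "j * d \<le> J * d" using ij by simp
    then show "j * d \<le> n" using Jd by linarith
  qed
  define q where "q = (\<Sum>i<J. n + (n + i * d) + 1)"
  let ?Q = "{0..<0 + q}"
  obtain r A where Q: "finite_poset ?Q r" "antichain ?Q r A" "card A = m"
    "\<And>I. antichain ?Q r I \<Longrightarrow> card I \<le> card A" "triples_unbalanced (gain (real p)) ?Q r A"
    using tower_family_exists[where b = "\<lambda>i. n + i * d" and J = J and s = 0,
        OF tower_exists[OF p M(1,2), of _ K, folded n_def N_def] sep \<eta>]
    unfolding q_def m_def by blast
  have AQ: "A \<subseteq> ?Q" using Q(2) by (simp add: antichain_def)
  have mq: "m \<le> q" using card_mono[OF _ AQ] Q(3) by simp
  have mK: "2 ^ K \<le> m" using J1 by (simp add: m_def)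
  have "(2::nat) ^ 2 \<le> 2 ^ K" using K by (intro power_increasing) auto
  then have m4: "4 \<le> m" using mK by simp
  have m1: "m \<ge> 1" using m4 by simp
  \<comment> \<open>This height makes the stack at least as large as the family below it, so that it
    receives at least half the weight in \<open>gap_sum_osum\<close> and m/2 becomes m/4; yet z
    \<le> 3 q + 1 keeps the total size of the same order as q.\<close>
  define T where "T = q div (m + 1) + 1"
  define z where "z = T * (m + 1) + m"
  have zq: "q \<le> z"
    using dividend_less_times_div[of "m + 1" q] by (simp add: z_def T_def algebra_simps)
  define t where "t = q div (m + 1) * (m + 1)"
  have "t \<le> q" unfolding t_def by (rule div_times_less_eq_dividend)
  moreover have "z = t + (m + 1) + m" unfolding z_def T_def t_def by (simp only: distrib_right mult_1)
  ultimately have zq2: "z \<le> 3 * q + 1" using mq by linarith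
  let ?S = "{q + 1..<q + 1 + z}"
  obtain s B where S: "finite_poset ?S s" "\<And>I. antichain ?S s I \<Longrightarrow> card I \<le> m"
    "real m / 2 \<le> gap_sum ?S s" "twins ?S s B" "card B = m"
    using stack_exists[OF m1, of "q + 1" T] unfolding z_def[symmetric] by blast
  let ?P = "insert q (?Q \<union> ?S)"
  let ?R = "osum ?Q r q ?S s"
  have dj: "?Q \<inter> ?S = {}" "q \<notin> ?Q" "q \<notin> ?S" by auto
  have P: "finite_poset ?P ?R" by (rule finite_poset_osum[OF Q(1) S(1) dj])
  have AP: "antichain ?P ?R A" by (rule antichain_osum_lower[OF Q(2,1) S(1) dj])
  have wP: "card I \<le> card A" if I: "antichain ?P ?R I" for I
    using antichain_osum_cases[OF I]
  proof (elim disjE)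
    assume "antichain ?S s I"
    then show ?thesis using S(2) Q(3) by simp
  next
    assume "I \<subseteq> {q}"
    then show ?thesis using card_mono[of "{q}" I] m1 Q(3) by auto
  qed (rule Q(4))
  have fA: "finite A" using AQ by (rule finite_subset) simp
  have cP: "card ?P = q + 1 + z" using dj by (simp add: card_Un_disjoint)
  have q1: "q \<ge> 1" using mq m1 by simp
  have "q \<le> (\<Sum>i<J. 3 * n + 1)"
    unfolding q_def
  proof (rule sum_mono)
    fix i assume "i \<in> {..<J}"
    then have "i * d \<le> J * d" by simp
    then show "n + (n + i * d) + 1 \<le> 3 * n + 1" using Jd by linarith
  qed
  then have "real q \<le> real (J * (3 * n + 1))" by (simp only: sum_constant card_lessThan of_nat_le_iff of_nat_id)
  also have "\<dots> \<le> real J * (3 * x)" by (simp add: x algebra_simps)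
  also have "\<dots> \<le> sqrt x * (3 * x)" using JU x0 by (intro mult_right_mono) auto
  finally have qx: "real q \<le> 3 * (x * sqrt x)" by (simp add: mult_ac)
  have "card ?P \<le> 6 * q" unfolding cP using zq2 q1 by simp
  then have "real (card ?P) \<le> real (6 * q)" by (simp only: of_nat_le_iff)
  then have cPx: "real (card ?P) \<le> 18 * (x * sqrt x)" using qx by simp
  let ?\<beta> = "(real (card ?Q) + 1) / (real (card ?Q) + real (card ?S) + 2)"
  have \<beta>: "?\<beta> \<le> 1 / 2" using zq by (simp add: divide_le_eq)
  have \<beta>0: "0 \<le> ?\<beta>" by simp
  have "real m / 4 = (1 / 2) * (real m / 2)" by simp
  also have "\<dots> \<le> (1 - ?\<beta>) * gap_sum ?S s" using \<beta> S(3) by (intro mult_mono) auto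
  also have "\<dots> \<le> ?\<beta> * gap_sum ?Q r + (1 - ?\<beta>) * gap_sum ?S s"
    using mult_nonneg_nonneg[OF \<beta>0 gap_sum_nonneg[OF Q(1)]] by linarith
  also have "\<dots> \<le> gap_sum ?P ?R" by (rule gap_sum_osum[OF Q(1) S(1) dj])
  finally have gP: "real m / 4 \<le> gap_sum ?P ?R" .
  have tP: "twins ?P ?R B" by (rule twins_osum_upper[OF S(4) Q(1) S(1) dj])
  have "delta 3 A ?P ?R \<le> 1 / 6 - gain (real p)"
    using triples_unbalanced_osum[OF Q(1) S(1) dj AQ Q(5)] fA m4 Q(3) by (intro delta_3_le) auto
  moreover have "card A = width ?P ?R"
    by (rule width_eqI[OF finite_poset_finite[OF P] AP wP, symmetric])
  moreover have "sqrt x * 2 ^ K / (8 * real R) \<le> real (card A)"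
  proof -
    have "sqrt x / (8 * real R) * 2 ^ K \<le> real J * 2 ^ K" using JL by (intro mult_right_mono) auto
    then show ?thesis by (simp add: Q(3) m_def)
  qed
  moreover have "card A \<le> card ?P" using AQ by (intro card_mono) auto
  moreover have "\<forall>k\<le>card A. delta k ?P ?P ?R = 1 / fact k"
    using delta_eq_inverse_fact[OF P tP] S(5) Q(3) by simp
  ultimately show ?thesis
    using P AP mK cPx gP Q(3) by (intro exI[of _ ?P] exI[of _ ?R] exI[of _ A]) auto
qed

text \<open>A level multiplies the size by 4 + 2/p up to the rounding in \<open>cap_len\<close>.
  From level 1 on (n + 1)/p is at least 1 because \<open>p \<le> M\<close>, and raising 2/p to 4/p
  absorbs the rounding.\<close>

lemma tower_size_growth:
  assumes p: "p \<ge> 1" and M: "p \<le> M"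
  shows "real (tower_size p M (Suc k)) + 1 \<le> (2 * real M + 5) * (4 * (1 + 1 / real p)) ^ k"
proof (induction k)
  case 0
  show ?case by simp
next
  case (Suc k)
  define n where "n = tower_size p M (Suc k)"
  have "2 * (M + 2) \<le> n" unfolding n_def by (rule tower_size_Suc_ge)
  then have "real p \<le> real n + 1" using M by simp
  define u where "u = (real n + 1) / real p"
  have u: "1 \<le> u" using \<open>real p \<le> real n + 1\<close> p by (simp add: u_def)
  have e1: "(2 + 1 / real p) * (real n + 1) = 2 * (real n + 1) + u"
    by (simp only: distrib_right) (simp add: u_def)
  have e2: "4 * (1 + 1 / real p) * (real n + 1) = 4 * (real n + 1) + 4 * u"
    by (simp only: distrib_right distrib_left mult.assoc) (simp add: u_def add_divide_distrib)
  have "tower_size p M (Suc (Suc k)) = 2 * (n + cap_len p n + 1)"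
    unfolding tower_size_Suc[of p M "Suc k"] n_def by (simp add: tower_cap_def del: tower_size.simps)
  then have "real (tower_size p M (Suc (Suc k))) + 1 = 2 * (real n + real (cap_len p n) + 2) - 1"
    by (simp del: tower_size.simps)
  also have "\<dots> \<le> 2 * ((2 + 1 / real p) * (real n + 1) + 1) - 1"
    using cap_len_bounds(2)[OF p, of n] by simp
  also have "\<dots> \<le> 4 * (1 + 1 / real p) * (real n + 1)"
    unfolding e1 e2 using u by (simp add: algebra_simps)
  also have "\<dots> \<le> 4 * (1 + 1 / real p) * ((2 * real M + 5) * (4 * (1 + 1 / real p)) ^ k)"
    using Suc by (intro mult_left_mono) (auto simp: n_def simp del: tower_size.simps)
  finally show ?case by (simp add: mult_ac del: tower_size.simps)
qed

text \<open>With b = 1/2 - 3 \<epsilon>/2 the exponents satisfy (3/2) (2/3 - \<epsilon>) = 1/2 + b.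
  The part sqrt x of the denominator therefore cancels against the number of towers, and what
  remains is 2^K against x^b, which is at most a constant times (\<theta>^b)^K.\<close>

lemma ratio_lower_bound:
  fixes \<epsilon> x C \<theta> R a v :: real
  assumes \<epsilon>: "0 < \<epsilon>" "\<epsilon> < 1 / 6" and x: "x > 0" and C: "C > 0" and \<theta>: "\<theta> > 0" and R: "R > 0"
    and xC: "x \<le> C * \<theta> ^ K" and a: "sqrt x * 2 ^ K / (8 * R) \<le> a" and v: "0 < v" "v \<le> 18 * (x * sqrt x)"
  shows "1 / (8 * R * 18 powr (2 / 3 - \<epsilon>) * C powr (1 / 2 - 3 * \<epsilon> / 2)) *
    (2 / \<theta> powr (1 / 2 - 3 * \<epsilon> / 2)) ^ K \<le> a / v powr (2 / 3 - \<epsilon>)"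
proof -
  define b where "b = 1 / 2 - 3 * \<epsilon> / 2"
  define e where "e = 2 / 3 - \<epsilon>"
  have b0: "b > 0" and e0: "e > 0" using \<epsilon> by (auto simp: b_def e_def)
  have "v powr e \<le> (18 * (x * sqrt x)) powr e" using v e0 by (intro powr_mono2) auto
  also have "x * sqrt x = x powr (3 / 2)"
    using x by (simp add: powr_half_sqrt[symmetric] powr_mult_base)
  also have "(18 * x powr (3 / 2)) powr e = 18 powr e * x powr (3 / 2 * e)"
    using x by (simp add: powr_mult powr_powr)
  finally have ve: "v powr e \<le> 18 powr e * x powr (3 / 2 * e)" .
  have xb: "x powr b \<le> C powr b * (\<theta> powr b) ^ K"
  proof -
    have "x powr b \<le> (C * \<theta> ^ K) powr b" using xC x b0 by (intro powr_mono2) auto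
    also have "\<dots> = C powr b * (\<theta> ^ K) powr b" using C \<theta> by (simp add: powr_mult)
    also have "(\<theta> ^ K) powr b = (\<theta> powr b) ^ K"
      using \<theta> by (simp add: powr_realpow[symmetric] powr_powr mult.commute)
    finally show ?thesis .
  qed
  have split: "x powr (3 / 2 * e) = sqrt x * x powr b"
    using x by (simp add: powr_half_sqrt[symmetric] powr_add[symmetric] b_def e_def algebra_simps)
  have "1 / (8 * R * 18 powr e * C powr b) * (2 / \<theta> powr b) ^ K =
      2 ^ K / (8 * R * 18 powr e) / (C powr b * (\<theta> powr b) ^ K)"
    by (simp add: power_divide)
  also have "\<dots> \<le> 2 ^ K / (8 * R * 18 powr e) / x powr b"
    using xb x R C \<theta> by (intro divide_left_mono mult_pos_pos) auto
  also have "\<dots> = (sqrt x * 2 ^ K / (8 * R)) / (18 powr e * x powr (3 / 2 * e))"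
    unfolding split using x by (simp add: field_simps)
  also have "\<dots> \<le> a / v powr e"
    using a ve v x R by (intro frac_le) (auto intro: order_trans[rotated])
  finally show ?thesis by (simp add: b_def e_def)
qed

theorem theorem7:
  fixes \<epsilon> :: real
  assumes "0 < \<epsilon>" and "\<epsilon> < 1 / 6"
  shows "\<exists>\<eta>>0. \<exists>(V :: nat \<Rightarrow> nat set) (r :: nat \<Rightarrow> nat rel) (A :: nat \<Rightarrow> nat set).
     (\<forall>i. finite_poset (V i) (r i) \<and>
          antichain (V i) (r i) (A i) \<and> card (A i) = width (V i) (r i) \<and>
          3 \<le> card (A i) \<and> delta 3 (A i) (V i) (r i) \<le> 1 / 6 - \<eta>) \<and>
     filterlim (\<lambda>i. card (V i)) at_top sequentially \<and>
     filterlim (\<lambda>i. real (card (A i)) / real (card (V i)) powr (2 / 3 - \<epsilon>)) at_top sequentially \<and>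
     filterlim (\<lambda>i. gap_sum (V i) (r i) / real (card (V i)) powr (2 / 3 - \<epsilon>)) at_top sequentially \<and>
     (\<forall>k\<ge>2. \<exists>N. \<forall>i. N \<le> card (V i) \<longrightarrow>
        k \<le> card (V i) \<and> delta k (V i) (V i) (r i) = 1 / fact k)"
proof -
  define b where "b = 1 / 2 - 3 * \<epsilon> / 2"
  have b: "0 < b" "b \<le> 1" using assms by (auto simp: b_def)
  \<comment> \<open>The parameter \<open>p\<close> is taken so large that 1 + 1/p is below 2^(3
    \<epsilon>). As 4^b = 2^(1 - 3 \<epsilon>) and b is at most 1, this gives \<theta>^b < 2, hence
    a ratio \<rho> above 1.\<close>
  have "2 powr 0 < (2::real) powr (3 * \<epsilon>)" using assms by (intro powr_less_mono) auto
  then have "2 powr (3 * \<epsilon>) - 1 > (0::real)" by simp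
  then obtain p0 where p0: "inverse (real (Suc p0)) < 2 powr (3 * \<epsilon>) - 1"
    using reals_Archimedean by blast
  define p where "p = Suc p0"
  have p: "p \<ge> 1" and pe: "1 + 1 / real p < 2 powr (3 * \<epsilon>)"
    using p0 by (auto simp: p_def inverse_eq_divide)
  define R where "R = 125 * (p + 1)"
  obtain M0 where M0: "max (16 * (8 * (real p + 1) + 1)\<^sup>2) (16 * (real R)\<^sup>2) \<le> real M0"
    using real_arch_simple by blast
  define M where "M = max 3 (max p M0)"
  have M: "M \<ge> 3" "16 * (8 * (real p + 1) + 1)\<^sup>2 \<le> real M" "16 * (real R)\<^sup>2 \<le> real M" "p \<le> M"
    using M0 by (auto simp: M_def)
  define \<theta> where "\<theta> = 4 * (1 + 1 / real p)"
  define C where "C = 2 * real M + 5"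
  \<comment> \<open>Towers start at level 2, as \<open>poset_exists\<close> requires; every maximum
    antichain then has at least four elements and \<open>delta 3\<close> is meaningful from the
    start.\<close>
  define x where "x i = real (tower_size p M (i + 2)) + 1" for i
  define c where "c = 1 / (8 * real R * 18 powr (2 / 3 - \<epsilon>) * C powr b)"
  define \<rho> where "\<rho> = 2 / \<theta> powr b"
  have \<theta>: "\<theta> \<ge> 4" by (simp add: \<theta>_def)
  have C: "C > 0" and R: "real R > 0" by (auto simp: C_def R_def)
  have c: "c > 0" using C R by (simp add: c_def)
  have \<rho>: "\<rho> > 1"
  proof -
    have "\<theta> powr b = 4 powr b * (1 + 1 / real p) powr b"
      unfolding \<theta>_def by (subst powr_mult) auto
    also have "\<dots> \<le> 4 powr b * (1 + 1 / real p) powr 1"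
      using b by (intro mult_left_mono powr_mono) auto
    also have "\<dots> < 4 powr b * 2 powr (3 * \<epsilon>)" using pe by simp
    also have "(4::real) powr b = 2 powr (2 * b)"
      using powr_powr[of 2 2 b] by (simp add: powr_numeral)
    also have "2 powr (2 * b) * 2 powr (3 * \<epsilon>) = (2::real) powr 1"
      unfolding powr_add[symmetric] by (simp add: b_def)
    finally have "\<theta> powr b < 2" by simp
    moreover have "\<theta> powr b > 0" using \<theta> by simp
    ultimately show ?thesis by (simp add: \<rho>_def)
  qed
  have "\<forall>i. \<exists>(V :: nat set) r A. finite_poset V r \<and> antichain V r A \<and> card A = width V r \<and> 2 ^ (i + 2) \<le> card A \<and>
    delta 3 A V r \<le> 1 / 6 - gain (real p) \<and>
    sqrt (x i) * 2 ^ (i + 2) / (8 * real R) \<le> real (card A) \<and> real (card V) \<le> 18 * (x i * sqrt (x i)) \<and> card A \<le> card V \<and>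
    real (card A) / 4 \<le> gap_sum V r \<and> (\<forall>k\<le>card A. delta k V V r = 1 / fact k)"
    unfolding x_def R_def by (intro allI poset_exists[OF p M(1,2) M(3)[unfolded R_def]]) simp
  then obtain V :: "nat \<Rightarrow> nat set" and r A where
    P: "\<And>i. finite_poset (V i) (r i)" "\<And>i. antichain (V i) (r i) (A i)"
      "\<And>i. card (A i) = width (V i) (r i)" "\<And>i. 2 ^ (i + 2) \<le> card (A i)"
      "\<And>i. delta 3 (A i) (V i) (r i) \<le> 1 / 6 - gain (real p)"
      "\<And>i. sqrt (x i) * 2 ^ (i + 2) / (8 * real R) \<le> real (card (A i))"
      "\<And>i. real (card (V i)) \<le> 18 * (x i * sqrt (x i))" "\<And>i. card (A i) \<le> card (V i)"
      "\<And>i. real (card (A i)) / 4 \<le> gap_sum (V i) (r i)"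
      "\<And>i k. k \<le> card (A i) \<Longrightarrow> delta k (V i) (V i) (r i) = 1 / fact k"
    by metis
  have iA: "i \<le> card (A i)" for i
  proof -
    have "i \<le> i + 2" by simp
    also have "\<dots> \<le> 2 ^ (i + 2)" by (rule less_imp_le[OF less_exp])
    finally show ?thesis using P(4)[of i] by linarith
  qed
  have A3: "3 \<le> card (A i)" for i
  proof -
    have "(2::nat) ^ 2 \<le> 2 ^ (i + 2)" by (intro power_increasing) auto
    then have "(2::nat) ^ 2 \<le> card (A i)" using P(4)[of i] by (rule order_trans)
    then show ?thesis by simp
  qed
  have low: "c * \<rho> ^ (i + 2) \<le> real (card (A i)) / real (card (V i)) powr (2 / 3 - \<epsilon>)" for i
    unfolding c_def \<rho>_def b_def
  proof (rule ratio_lower_bound[OF assms _ C _ R _ P(6) _ P(7)])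
    show "0 < x i" by (simp add: x_def add_pos_nonneg)
    show "\<theta> > 0" using \<theta> by simp
    have "x i \<le> C * \<theta> ^ (i + 1)"
      using tower_size_growth[OF p M(4), of "i + 1"] by (simp add: x_def C_def \<theta>_def del: tower_size.simps)
    also have "\<dots> \<le> C * \<theta> ^ (i + 2)" using \<theta> C by (intro mult_left_mono power_increasing) auto
    finally show "x i \<le> C * \<theta> ^ (i + 2)" .
    show "0 < real (card (V i))" using P(8)[of i] A3[of i] by simp
  qed
  have lin: "c * (\<rho> - 1) * real i \<le> c * \<rho> ^ (i + 2)" for i
  proof -
    have "1 + real (i + 2) * (\<rho> - 1) \<le> (1 + (\<rho> - 1)) ^ (i + 2)"
      using \<rho> by (intro Bernoulli_inequality) simp
    moreover have "(\<rho> - 1) * real i \<le> 1 + real (i + 2) * (\<rho> - 1)" using \<rho> by (simp add: algebra_simps)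
    ultimately have "(\<rho> - 1) * real i \<le> \<rho> ^ (i + 2)" by simp
    then show ?thesis using c by (simp add: mult.assoc)
  qed
  have lim0: "filterlim (\<lambda>i. (c * (\<rho> - 1)) * real i) at_top sequentially"
    using c \<rho> by (intro filterlim_tendsto_pos_mult_at_top[OF tendsto_const _ filterlim_real_sequentially]) simp
  have limA: "filterlim (\<lambda>i. real (card (A i)) / real (card (V i)) powr (2 / 3 - \<epsilon>)) at_top sequentially"
    by (rule filterlim_at_top_mono[OF lim0]) (intro always_eventually allI order_trans[OF lin low])
  have limS: "filterlim (\<lambda>i. gap_sum (V i) (r i) / real (card (V i)) powr (2 / 3 - \<epsilon>)) at_top sequentially"
  proof (rule filterlim_at_top_mono)
    show "filterlim (\<lambda>i. 1 / 4 * (real (card (A i)) / real (card (V i)) powr (2 / 3 - \<epsilon>))) at_top sequentially"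
      by (rule filterlim_tendsto_pos_mult_at_top[OF tendsto_const _ limA]) simp
    have "1 / 4 * (real (card (A i)) / real (card (V i)) powr (2 / 3 - \<epsilon>)) \<le>
        gap_sum (V i) (r i) / real (card (V i)) powr (2 / 3 - \<epsilon>)" for i
      using divide_right_mono[OF P(9)[of i], of "real (card (V i)) powr (2 / 3 - \<epsilon>)"] by simp
    then show "\<forall>\<^sub>F i in sequentially. 1 / 4 * (real (card (A i)) / real (card (V i)) powr (2 / 3 - \<epsilon>)) \<le>
        gap_sum (V i) (r i) / real (card (V i)) powr (2 / 3 - \<epsilon>)" by simp
  qed
  have limV: "filterlim (\<lambda>i. card (V i)) at_top sequentially"
  proof (rule filterlim_at_top_mono[OF filterlim_ident])
    show "\<forall>\<^sub>F i in sequentially. i \<le> card (V i)"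
      using iA P(8) by (intro always_eventually allI) (rule order_trans)
  qed
  \<comment> \<open>The threshold concerns the size of the poset rather than its index, and sizes
    are not claimed to be monotone. A size above the sum of the first \<open>k\<close> sizes forces
    the index to be at least \<open>k\<close>, and the antichain has at least as many elements as
    the index.\<close>
  have large: "\<exists>N. \<forall>i. N \<le> card (V i) \<longrightarrow> k \<le> card (V i) \<and> delta k (V i) (V i) (r i) = 1 / fact k" for k
  proof (intro exI allI impI)
    fix i assume N: "Suc (\<Sum>j<k. card (V j)) \<le> card (V i)"
    have "k \<le> i"
    proof (rule ccontr)
      assume "\<not> k \<le> i"
      then have "card (V i) \<le> (\<Sum>j<k. card (V j))" by (intro member_le_sum) auto
      then show False using N by simp
    qed
    then have "k \<le> card (A i)" using iA[of i] by linarith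
    then show "k \<le> card (V i) \<and> delta k (V i) (V i) (r i) = 1 / fact k"
      using P(8)[of i] P(10) by simp
  qed
  show ?thesis
    using gain_pos[of "real p"] P(1,2,3,5) A3 limV limA limS large
    by (intro exI[of _ "gain (real p)"] conjI exI[of _ V] exI[of _ r] exI[of _ A]) auto
qed

end
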